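(* Let $r\ge1$ and $\bm{\ell}=(\ell_{ij})_{1\le i\le j\le r}\in\mathbb{Z}_{\ge0}^{r(r+1)/2}$. Then, as meromorphic functions of $s_{1r}$, $$\zeta_{\mathrm{A}_r}(-\bm{\ell};s_{1r})=\sum_{\substack{p_{ij}+q_{ij}=\ell_{ij}\\2\le i\le j\le r}}\Bigl(\prod_{2\le i\le j\le r}\binom{\ell_{ij}}{q_{ij}}(-1)^{q_{ij}}\Bigr)\,\zeta_r\bigl(-\bm{\ell}'(\bm{p},\bm{q}),s_{1r}(\bm{p})\bigr),$$ where the sum runs over all families of non-negative integers $p_{ij},q_{ij}$ ($2\le i\le j\le r$) with $p_{ij}+q_{ij}=\ell_{ij}$, and the $k$-th component of the argument $(-\bm{\ell}'(\bm{p},\bm{q}),s_{1r}(\bm{p}))$ of $\zeta_r$ is $$-\ell_{1k}-\sum_{i=2}^{k}p_{ik}-\sum_{j=k+1}^{r}q_{k+1,j}\quad(k=1,\dots,r-1),\qquad s_{1r}(\bm{p})=s_{1r}-\sum_{i=2}^{r}p_{ir}\quad(k=r),$$ empty sums being $0$. In particular, $$\zeta_{\mathrm{A}_r}^{\mathrm{rev}}(-\bm{\ell})=\sum_{\substack{p_{ij}+q_{ij}=\ell_{ij}\\2\le i\le j\le r}}\Bigl(\prod_{2\le i\le j\le r}\binom{\ell_{ij}}{p_{ij}}(-1)^{q_{ij}}\Bigr)\,\zeta_r^{\mathrm{rev}}\bigl(-\bm{\ell}'(\bm{p},\bm{q}),-\ell_{1r}(\bm{p})\bigr),$$ where $-\ell_{1r}(\bm{p}):=-\ell_{1r}-\sum_{i=2}^r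 p_{ir}$.
   Context: For $\bm{s}=(s_{ij})_{1\le i\le j\le r}$, the zeta function of type $\mathrm{A}_r$ is $\zeta_{\mathrm{A}_r}(\bm{s})=\sum_{m_1,\dots,m_r\ge1}\prod_{1\le i\le j\le r}(m_i+\cdots+m_j)^{-s_{ij}}$, continued meromorphically to $\mathbb{C}^{r(r+1)/2}$. The function $\zeta_{\mathrm{A}_r}(-\bm{\ell};s_{1r})$ of one complex variable $s_{1r}$ is obtained by putting $s_{ij}=-\ell_{ij}$ for all $(i,j)\ne(1,r)$; the series converges absolutely for $\mathrm{Re}(s_{1r})$ sufficiently large and is continued meromorphically. The reverse value is $\zeta_{\mathrm{A}_r}^{\mathrm{rev}}(-\bm{\ell}):=\lim_{s_{1r}\to-\ell_{1r}}\zeta_{\mathrm{A}_r}(-\bm{\ell};s_{1r})$. The Euler--Zagier multiple zeta function is $\zeta_r(s_1,\dots,s_r)=\sum_{m_1,\dots,m_r\ge1}\prod_{k=1}^r(m_1+\cdots+m_k)^{-s_k}$, continued meromorphically to $\mathbb{C}^r$; with $s_1,\dots,s_{r-1}$ fixed it converges for $\mathrm{Re}(s_r)$ sufficiently large. Its reverse value at non-positive integers is $\zeta_r^{\mathrm{rev}}(-n_1,\dots,-n_r):=\lim_{s_r\to-n_r}\cdots\lim_{s_1\to-n_1}\zeta_r(s_1,\dots,s_r)$ (the limit in $s_1$ is taken first, that in $s_r$ last). *)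

theory Defs
  imports "HOL-Complex_Analysis.Complex_Analysis"
begin

text \<open>
  The dimension \<open>r\<close> is a natural number, so \<open>\<complex>\<^sup>r\<close> is realised as the set of families of complex
  numbers indexed by \<open>{1..r}\<close> (extensional functions).  As a subspace of the function type with
  its product topology it carries the usual topology of \<open>\<complex>\<^sup>r\<close>.
\<close>

definition cspace :: "nat \<Rightarrow> (nat \<Rightarrow> complex) set" where
  "cspace r = ({1..r} \<rightarrow>\<^sub>E UNIV)"

text \<open>
  Holomorphy in several variables: continuous and complex differentiable in each variable
  separately (equivalent to local power series expansions by Osgood's lemma).
\<close>

definition holomorphic_cspace ::
  "nat \<Rightarrow> ((nat \<Rightarrow> complex) \<Rightarrow> complex) \<Rightarrow> (nat \<Rightarrow> complex) set \<Rightarrow> bool" where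
  "holomorphic_cspace r f U \<longleftrightarrow>
     openin (top_of_set (cspace r)) U \<and> continuous_on U f \<and>
     (\<forall>s\<in>U. \<forall>k\<in>{1..r}. (\<lambda>z. f (s(k := z))) field_differentiable at (s k))"

text \<open>
  Locally a quotient of holomorphic functions whose denominator vanishes on no nonempty open set.
\<close>

definition meromorphic_cspace :: "nat \<Rightarrow> ((nat \<Rightarrow> complex) \<Rightarrow> complex) \<Rightarrow> bool" where
  "meromorphic_cspace r F \<longleftrightarrow>
     (\<forall>a\<in>cspace r. \<exists>U f g. a \<in> U \<and> holomorphic_cspace r f U \<and> holomorphic_cspace r g U \<and>
        U \<subseteq> closure {s\<in>U. g s \<noteq> 0} \<and> (\<forall>s\<in>U. g s \<noteq> 0 \<longrightarrow> F s = f s / g s))"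

text \<open>
  The previous definition leaves the values of \<open>F\<close> on a thin set unspecified.  A function is
  nicely meromorphic if, in addition, it takes the correct value at every point to which it
  extends holomorphically; the values at the remaining points carry no information.
\<close>

definition nicely_meromorphic_cspace :: "nat \<Rightarrow> ((nat \<Rightarrow> complex) \<Rightarrow> complex) \<Rightarrow> bool" where
  "nicely_meromorphic_cspace r F \<longleftrightarrow>
     meromorphic_cspace r F \<and>
     (\<forall>a U h. a \<in> U \<longrightarrow> holomorphic_cspace r h U \<longrightarrow> U \<subseteq> closure {s\<in>U. F s = h s} \<longrightarrow> F a = h a)"

definition pos_tuples :: "nat \<Rightarrow> (nat \<Rightarrow> nat) set" where
  "pos_tuples r = ({1..r} \<rightarrow>\<^sub>E {1..})"

definition EZ_term :: "nat \<Rightarrow> (nat \<Rightarrow> complex) \<Rightarrow> (nat \<Rightarrow> nat) \<Rightarrow> complex" where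
  "EZ_term r s m = (\<Prod>k=1..r. of_nat (\<Sum>i=1..k. m i) powr (- s k))"

text \<open>
  The meromorphic continuation to \<open>\<complex>\<^sup>r\<close> of the series, which converges (absolutely) when all real
  parts are large.  By the identity theorem it is determined at each of its regular points.
\<close>

definition EZ_zeta :: "nat \<Rightarrow> (nat \<Rightarrow> complex) \<Rightarrow> complex" where
  "EZ_zeta r = (SOME F. nicely_meromorphic_cspace r F \<and>
     (\<exists>c. \<forall>s\<in>cspace r. (\<forall>k\<in>{1..r}. Re (s k) > c) \<longrightarrow> (EZ_term r s has_sum F s) (pos_tuples r)))"

text \<open>
  \<open>has_iterated_limit F a k s v\<close>: the iterated limit of \<open>F\<close> as the first coordinate tends to \<open>a 1\<close>
  (innermost limit), then the second to \<open>a 2\<close>, and so on up to the \<open>k\<close>-th (outermost limit), the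
  coordinates of \<open>s\<close> beyond \<open>k\<close> being held fixed, is \<open>v\<close>.  Each inner limit is required to exist for
  all values of the next variable in a punctured neighbourhood of its limit point.
\<close>

primrec has_iterated_limit ::
  "((nat \<Rightarrow> complex) \<Rightarrow> complex) \<Rightarrow> (nat \<Rightarrow> complex) \<Rightarrow> nat \<Rightarrow> (nat \<Rightarrow> complex) \<Rightarrow> complex \<Rightarrow> bool" where
  "has_iterated_limit F a 0 s v \<longleftrightarrow> v = F s"
| "has_iterated_limit F a (Suc k) s v \<longleftrightarrow>
     (\<exists>g. (\<forall>\<^sub>F z in at (a (Suc k)). has_iterated_limit F a k (s(Suc k := z)) (g z)) \<and>
          (g \<longlongrightarrow> v) (at (a (Suc k))))"

text \<open>
  The base point (here again \<open>a\<close>) is immaterial for \<open>a \<in> cspace r\<close>: all \<open>r\<close> coordinates get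
  overwritten.
\<close>

definition has_EZ_rev :: "nat \<Rightarrow> (nat \<Rightarrow> complex) \<Rightarrow> complex \<Rightarrow> bool" where
  "has_EZ_rev r a v \<longleftrightarrow> has_iterated_limit (EZ_zeta r) a r a v"

definition EZ_zeta_rev :: "nat \<Rightarrow> (nat \<Rightarrow> complex) \<Rightarrow> complex" where
  "EZ_zeta_rev r a = (THE v. has_EZ_rev r a v)"

definition A_index :: "nat \<Rightarrow> (nat \<times> nat) set" where
  "A_index r = {(i, j). 1 \<le> i \<and> i \<le> j \<and> j \<le> r}"

definition A_term :: "nat \<Rightarrow> (nat \<times> nat \<Rightarrow> complex) \<Rightarrow> (nat \<Rightarrow> nat) \<Rightarrow> complex" where
  "A_term r s m = (\<Prod>(i, j)\<in>A_index r. of_nat (\<Sum>k=i..j. m k) powr (- s (i, j)))"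

text \<open>
  The variable with index \<open>(1, r)\<close> is left free and called \<open>z\<close>, so the value of \<open>l\<close> there is
  irrelevant; the series converges when the real part of \<open>z\<close> is large.
\<close>

definition A_zeta :: "nat \<Rightarrow> (nat \<times> nat \<Rightarrow> nat) \<Rightarrow> complex \<Rightarrow> complex" where
  "A_zeta r l = (SOME F. F nicely_meromorphic_on UNIV \<and>
     (\<exists>c. \<forall>z. Re z > c \<longrightarrow>
        (A_term r ((\<lambda>ij. - of_nat (l ij))((1, r) := z)) has_sum F z) (pos_tuples r)))"

definition A_zeta_rev :: "nat \<Rightarrow> (nat \<times> nat \<Rightarrow> nat) \<Rightarrow> complex" where
  "A_zeta_rev r l = Lim (at (- of_nat (l (1, r)))) (A_zeta r l)"

definition A_index2 :: "nat \<Rightarrow> (nat \<times> nat) set" where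
  "A_index2 r = {(i, j). 2 \<le> i \<and> i \<le> j \<and> j \<le> r}"

definition splittings ::
  "nat \<Rightarrow> (nat \<times> nat \<Rightarrow> nat) \<Rightarrow> ((nat \<times> nat \<Rightarrow> nat) \<times> (nat \<times> nat \<Rightarrow> nat)) set" where
  "splittings r l = {(p, q). p \<in> (A_index2 r \<rightarrow>\<^sub>E UNIV) \<and> q \<in> (A_index2 r \<rightarrow>\<^sub>E UNIV) \<and>
     (\<forall>ij\<in>A_index2 r. p ij + q ij = l ij)}"

definition EZ_arg ::
  "nat \<Rightarrow> (nat \<times> nat \<Rightarrow> nat) \<Rightarrow> (nat \<times> nat \<Rightarrow> nat) \<Rightarrow> (nat \<times> nat \<Rightarrow> nat) \<Rightarrow> complex \<Rightarrow> nat \<Rightarrow> complex" where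
  "EZ_arg r l p q z = (\<lambda>k\<in>{1..r}.
     if k < r
     then - of_nat (l (1, k)) - (\<Sum>i=2..k. of_nat (p (i, k))) - (\<Sum>j=k+1..r. of_nat (q (k+1, j)))
     else z - (\<Sum>i=2..r. of_nat (p (i, r))))"

end

theory Submission
  imports Defs
begin

text \<open>
  Write \<open>M\<^sub>k = m\<^sub>1 + \<dots> + m\<^sub>k\<close>.  Since \<open>m\<^sub>i + \<dots> + m\<^sub>j = M\<^sub>j - M\<^bsub>i-1\<^esub>\<close>, the binomial theorem turns each
  summand of the series of type A into a finite combination of summands of Euler--Zagier series,
  which gives the identity where the real part of the free variable is large; the rest is analytic
  continuation.

  The continuation of the Euler--Zagier function goes by induction on \<open>r\<close>.  Summing the expansion of
  \<open>(n - 1)\<^bsup>1-s\<^esup> - n\<^bsup>1-s\<^esup>\<close> in powers \<open>n\<^bsup>-s-k\<^esup>\<close> over \<open>n = M\<^sub>r\<close> expresses \<open>(s\<^sub>r - 1) \<zeta>\<^sub>r(s)\<close> by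
  \<open>\<zeta>\<^bsub>r-1\<^esub>(s\<^sub>1, \<dots>, s\<^bsub>r-2\<^esub>, s\<^bsub>r-1\<^esub> + s\<^sub>r - 1)\<close>, by shifts of itself to the right in \<open>s\<^sub>r\<close>, and by a remainder
  that converges further to the left.  Multiplied by \<open>exp(2 \<pi> \<i> (s\<^sub>k + \<dots> + s\<^sub>r)) - 1\<close> for all
  \<open>k < r\<close>, factors invariant under these shifts, the function becomes entire.

  If \<open>s\<^sub>1, \<dots>, s\<^bsub>r-1\<^esub>\<close> are non-positive integers, then the coefficients of the Dirichlet series in \<open>s\<^sub>r\<close>
  are polynomial in \<open>n\<close>, so that it is a combination of shifts \<open>\<zeta>(s\<^sub>r - j)\<close> and is regular at
  non-positive integers.  The inner limits of the reverse value are values at regular points.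
\<close>

section \<open>Holomorphic functions of several variables\<close>

text \<open>The choice operator in \<open>EZ_zeta\<close> fixes values only at regular points, so
  all knowledge of it passes through a quotient \<open>H / EZ_den\<close> with \<open>H\<close>
  entire, valid where \<open>EZ_den\<close> is nonzero. The periodic factors have many more zeros
  than \<zeta> has poles, but the individual polar hyperplanes move under the shifts of the
  recursion, while these factors do not. The induction hypothesis carries a linear factor t - 1 at t
  = s_(r-1) + s_r - 1; it is a zero of the new periodic factor and is absorbed there.

  The price is that for r > 1 all periodic factors vanish at integer tuples, so the quotient says
  nothing at the points where reverse values are taken. The order of the limits resolves this: every
  factor involves s_r, so for integral s_1, ..., s_(r-1) and non-integral s_r none vanishes. The
  inner limits therefore happen at points of continuity, and only a separate function of s_r, built
  from shifts of the Riemann zeta function, is evaluated at the integer itself.\<close>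

lemma continuous_on_fun_upd: "continuous_on A (\<lambda>z. s(k := z))"
proof (rule continuous_on_coordinatewise_then_product)
  fix i
  show "continuous_on A (\<lambda>z. (s(k := z)) i)"
    by (cases "i = k") simp_all
qed

lemma cspace_fun_upd: "s \<in> cspace r \<Longrightarrow> k \<in> {1..r} \<Longrightarrow> s(k := z) \<in> cspace r"
  by (auto simp: cspace_def PiE_def extensional_def)

lemma open_slice:
  assumes "openin (top_of_set (cspace r)) U" "s \<in> cspace r" "k \<in> {1..r}"
  shows "open {z. s(k := z) \<in> U}"
proof -
  obtain T where T: "open T" "U = cspace r \<inter> T"
    using assms(1) by (auto simp: openin_open)
  have "{z. s(k := z) \<in> U} = (\<lambda>z. s(k := z)) -` T"
    using T cspace_fun_upd[OF assms(2,3)] by auto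
  thus ?thesis
    using open_vimage[OF T(1) continuous_on_fun_upd] by simp
qed

lemma holomorphic_cspace_openin: "holomorphic_cspace r f U \<Longrightarrow> openin (top_of_set (cspace r)) U"
  by (simp add: holomorphic_cspace_def)

lemma holomorphic_cspace_continuous_on: "holomorphic_cspace r f U \<Longrightarrow> continuous_on U f"
  by (simp add: holomorphic_cspace_def)

lemma holomorphic_cspace_slice:
  assumes f: "holomorphic_cspace r f U" and s: "s \<in> cspace r" "k \<in> {1..r}"
    and A: "\<And>z. z \<in> A \<Longrightarrow> s(k := z) \<in> U"
  shows "(\<lambda>z. f (s(k := z))) holomorphic_on A"
  unfolding holomorphic_on_def
proof
  fix z assume "z \<in> A"
  hence "(\<lambda>x. f ((s(k := z))(k := x))) field_differentiable at ((s(k := z)) k)"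
    using f s A unfolding holomorphic_cspace_def by blast
  thus "(\<lambda>z. f (s(k := z))) field_differentiable at z within A"
    by (simp add: field_differentiable_at_within)
qed

text \<open>Slices of a relatively open set are open in the plane, so differentiability at a point
  may be replaced by holomorphy on whole slices. In this form the closure properties below reduce to
  the one-variable rules.\<close>

lemma holomorphic_cspaceI:
  assumes "openin (top_of_set (cspace r)) U" "continuous_on U f"
    and "\<And>s k. s \<in> U \<Longrightarrow> s \<in> cspace r \<Longrightarrow> k \<in> {1..r} \<Longrightarrow> (\<lambda>z. f (s(k := z))) holomorphic_on {z. s(k := z) \<in> U}"
  shows "holomorphic_cspace r f U"
  unfolding holomorphic_cspace_def
proof (intro conjI ballI assms(1,2))
  fix s k assume s: "s \<in> U" and k: "k \<in> {1..r}"
  have s': "s \<in> cspace r"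
    using assms(1) s by (auto dest: openin_imp_subset)
  have "(\<lambda>z. f (s(k := z))) holomorphic_on {z. s(k := z) \<in> U}" "open {z. s(k := z) \<in> U}"
    using assms(3)[OF s s' k] open_slice[OF assms(1) s' k] by auto
  thus "(\<lambda>z. f (s(k := z))) field_differentiable at (s k)"
    using s by (auto intro: holomorphic_on_imp_differentiable_at)
qed

lemma holomorphic_cspace_subset:
  assumes "holomorphic_cspace r f U" "V \<subseteq> U" "openin (top_of_set (cspace r)) V"
  shows "holomorphic_cspace r f V"
  using assms unfolding holomorphic_cspace_def by (auto intro: continuous_on_subset)

lemma holomorphic_cspace_restrict:
  "holomorphic_cspace r f (cspace r) \<Longrightarrow> openin (top_of_set (cspace r)) U \<Longrightarrow> holomorphic_cspace r f U"
  using holomorphic_cspace_subset openin_imp_subset by blast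

lemma holomorphic_cspace_cong:
  assumes "holomorphic_cspace r f U" "\<And>s. s \<in> U \<Longrightarrow> f s = g s"
  shows "holomorphic_cspace r g U"
proof (rule holomorphic_cspaceI)
  show "openin (top_of_set (cspace r)) U" using assms(1) by (rule holomorphic_cspace_openin)
  show "continuous_on U g"
    using holomorphic_cspace_continuous_on[OF assms(1)] assms(2) by (subst continuous_on_cong) auto
  fix s k assume s: "s \<in> U" "s \<in> cspace r" "k \<in> {1..r}"
  have "(\<lambda>z. f (s(k := z))) holomorphic_on {z. s(k := z) \<in> U}"
    by (rule holomorphic_cspace_slice[OF assms(1) s(2,3)]) auto
  thus "(\<lambda>z. g (s(k := z))) holomorphic_on {z. s(k := z) \<in> U}"
    by (rule holomorphic_transform) (use assms(2) in auto)
qed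

lemma holomorphic_cspace_local:
  assumes "\<And>a. a \<in> U \<Longrightarrow> \<exists>V. a \<in> V \<and> V \<subseteq> U \<and> holomorphic_cspace r f V"
  shows "holomorphic_cspace r f U"
proof -
  have op: "openin (top_of_set (cspace r)) U"
  proof (subst openin_subopen, intro ballI)
    fix a assume "a \<in> U"
    then obtain V where "a \<in> V" "V \<subseteq> U" "holomorphic_cspace r f V"
      using assms by blast
    thus "\<exists>T. openin (top_of_set (cspace r)) T \<and> a \<in> T \<and> T \<subseteq> U"
      using holomorphic_cspace_openin[of r f V] by blast
  qed
  have "continuous (at a within U) f" if a: "a \<in> U" for a
  proof -
    obtain V where V: "a \<in> V" "V \<subseteq> U" "holomorphic_cspace r f V"
      using assms a by blast
    obtain T where T: "open T" "V = cspace r \<inter> T"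
      using holomorphic_cspace_openin[OF V(3)] by (auto simp: openin_open)
    have "U \<subseteq> cspace r" using op by (auto dest: openin_imp_subset)
    hence "at a within U = at a within V"
      using T V by (intro at_within_nhd[of _ T]) auto
    moreover have "continuous (at a within V) f"
      using V(1) holomorphic_cspace_continuous_on[OF V(3)] by (simp add: continuous_on_eq_continuous_within)
    ultimately show ?thesis by simp
  qed
  moreover have "(\<lambda>z. f (s(k := z))) field_differentiable at (s k)" if "s \<in> U" "k \<in> {1..r}" for s k
    using assms[OF that(1)] that(2) unfolding holomorphic_cspace_def by blast
  ultimately show ?thesis
    using op unfolding holomorphic_cspace_def by (auto simp: continuous_on_eq_continuous_within)
qed

lemma holomorphic_cspace_const [simp]:
  "openin (top_of_set (cspace r)) U \<Longrightarrow> holomorphic_cspace r (\<lambda>_. c) U"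
  by (auto simp: holomorphic_cspace_def)

lemma holomorphic_cspace_coord:
  "openin (top_of_set (cspace r)) U \<Longrightarrow> holomorphic_cspace r (\<lambda>s. s i) U"
proof (rule holomorphic_cspaceI)
  show "continuous_on U (\<lambda>s. s i :: complex)"
    by (rule continuous_on_subset[OF continuous_on_product_coordinates]) simp
  fix s :: "nat \<Rightarrow> complex" and k
  show "(\<lambda>z. (s(k := z)) i) holomorphic_on {z. s(k := z) \<in> U}"
    by (cases "i = k") (auto intro!: holomorphic_intros)
qed auto

lemma holomorphic_cspace_add:
  assumes "holomorphic_cspace r f U" "holomorphic_cspace r g U"
  shows "holomorphic_cspace r (\<lambda>s. f s + g s) U"
proof (rule holomorphic_cspaceI[OF holomorphic_cspace_openin[OF assms(1)]], goal_cases)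
  case 1
  show ?case
    using assms by (intro continuous_intros holomorphic_cspace_continuous_on) auto
next
  case (2 s k)
  thus ?case
    using assms by (intro holomorphic_intros holomorphic_cspace_slice[of r _ U]) auto
qed

lemma holomorphic_cspace_mult:
  assumes "holomorphic_cspace r f U" "holomorphic_cspace r g U"
  shows "holomorphic_cspace r (\<lambda>s. f s * g s) U"
proof (rule holomorphic_cspaceI[OF holomorphic_cspace_openin[OF assms(1)]], goal_cases)
  case 1
  show ?case
    using assms by (intro continuous_intros holomorphic_cspace_continuous_on) auto
next
  case (2 s k)
  thus ?case
    using assms by (intro holomorphic_intros holomorphic_cspace_slice[of r _ U]) auto
qed

lemma holomorphic_cspace_diff:
  assumes "holomorphic_cspace r f U" "holomorphic_cspace r g U"
  shows "holomorphic_cspace r (\<lambda>s. f s - g s) U"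
proof (rule holomorphic_cspaceI[OF holomorphic_cspace_openin[OF assms(1)]], goal_cases)
  case 1
  show ?case
    using assms by (intro continuous_intros holomorphic_cspace_continuous_on) auto
next
  case (2 s k)
  thus ?case
    using assms by (intro holomorphic_intros holomorphic_cspace_slice[of r _ U]) auto
qed

lemma holomorphic_cspace_divide:
  assumes "holomorphic_cspace r f U" "holomorphic_cspace r g U" "\<And>s. s \<in> U \<Longrightarrow> g s \<noteq> 0"
  shows "holomorphic_cspace r (\<lambda>s. f s / g s) U"
proof (rule holomorphic_cspaceI[OF holomorphic_cspace_openin[OF assms(1)]], goal_cases)
  case 1
  show ?case
    using assms by (intro continuous_intros holomorphic_cspace_continuous_on) auto
next
  case (2 s k)
  thus ?case
    using assms by (intro holomorphic_intros holomorphic_cspace_slice[of r _ U]) auto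
qed

lemma holomorphic_cspace_sum:
  assumes "\<And>i. i \<in> I \<Longrightarrow> holomorphic_cspace r (f i) U" "openin (top_of_set (cspace r)) U"
  shows "holomorphic_cspace r (\<lambda>s. \<Sum>i\<in>I. f i s) U"
  using assms(1) by (induction I rule: infinite_finite_induct)
    (auto simp: assms(2) intro!: holomorphic_cspace_add)

lemma holomorphic_cspace_prod:
  assumes "\<And>i. i \<in> I \<Longrightarrow> holomorphic_cspace r (f i) U" "openin (top_of_set (cspace r)) U"
  shows "holomorphic_cspace r (\<lambda>s. \<Prod>i\<in>I. f i s) U"
  using assms(1) by (induction I rule: infinite_finite_induct)
    (auto simp: assms(2) intro!: holomorphic_cspace_mult)

lemma holomorphic_cspace_compose:
  assumes f: "holomorphic_cspace r f U" and h: "h holomorphic_on A" and "open A" and "f ` U \<subseteq> A"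
  shows "holomorphic_cspace r (\<lambda>s. h (f s)) U"
proof (rule holomorphic_cspaceI)
  show "openin (top_of_set (cspace r)) U" by (rule holomorphic_cspace_openin[OF f])
  show "continuous_on U (\<lambda>s. h (f s))"
    by (rule continuous_on_compose2[OF holomorphic_on_imp_continuous_on[OF h]
          holomorphic_cspace_continuous_on[OF f]]) (use assms in auto)
  fix s k assume s: "s \<in> U" "s \<in> cspace r" "k \<in> {1..r}"
  show "(\<lambda>z. h (f (s(k := z)))) holomorphic_on {z. s(k := z) \<in> U}"
    by (rule holomorphic_on_compose_gen[of "\<lambda>z. f (s(k := z))" _ h A, unfolded o_def])
      (use assms s in \<open>auto intro!: holomorphic_cspace_slice[OF f]\<close>)
qed

section \<open>Polydiscs, locally uniform series and the identity theorem\<close>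

lemma openin_box:
  assumes "\<And>k. k \<in> {1..r} \<Longrightarrow> open (V k)"
  shows "openin (top_of_set (cspace r)) {s\<in>cspace r. \<forall>k\<in>{1..r}. s k \<in> V k}"
proof -
  have "open ((\<lambda>s::nat\<Rightarrow>complex. s k) -` V k)" if "k \<in> {1..r}" for k
    by (rule open_vimage) (use assms that in auto)
  hence "open (\<Inter>k\<in>{1..r}. (\<lambda>s::nat\<Rightarrow>complex. s k) -` V k)"
    by (intro open_INT) auto
  moreover have "{s\<in>cspace r. \<forall>k\<in>{1..r}. s k \<in> V k} = cspace r \<inter> (\<Inter>k\<in>{1..r}. (\<lambda>s. s k) -` V k)"
    by auto
  ultimately show ?thesis by (auto simp: openin_open)
qed

definition polydisc :: "nat \<Rightarrow> (nat \<Rightarrow> complex) \<Rightarrow> real \<Rightarrow> (nat \<Rightarrow> complex) set" where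
  "polydisc r a e = {s\<in>cspace r. \<forall>k\<in>{1..r}. s k \<in> ball (a k) e}"

lemma openin_polydisc: "openin (top_of_set (cspace r)) (polydisc r a e)"
  unfolding polydisc_def by (rule openin_box) auto

lemma polydisc_self: "a \<in> cspace r \<Longrightarrow> e > 0 \<Longrightarrow> a \<in> polydisc r a e"
  by (auto simp: polydisc_def)

text \<open>Outside \<open>{1..r}\<close> all elements of \<open>cspace r\<close> equal
  \<open>undefined\<close>, so of a basic open set of the product topology only finitely many
  conditions remain.\<close>

lemma polydisc_basis:
  assumes "openin (top_of_set (cspace r)) U" "a \<in> U"
  obtains e where "e > 0" "polydisc r a e \<subseteq> U"
proof -
  obtain T where T: "open T" "U = cspace r \<inter> T"
    using assms(1) by (auto simp: openin_open)
  have "openin (product_topology (\<lambda>i. euclidean) UNIV) T"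
    using T(1) by (simp add: open_fun_def)
  from product_topology_open_contains_basis[OF this, of a] obtain X where
    X: "a \<in> PiE UNIV X" "\<And>i. open (X i)" "PiE UNIV X \<subseteq> T"
    using assms(2) T by auto
  have "\<forall>i. \<exists>e>0. ball (a i) e \<subseteq> X i"
    using X(1,2) openE by (metis PiE_mem UNIV_I)
  then obtain d where d: "\<And>i. d i > 0" "\<And>i. ball (a i) (d i) \<subseteq> X i" by metis
  \<comment> \<open>The inserted 1 keeps the set nonempty when \<open>r = 0\<close>.\<close>
  define e where "e = Min (insert 1 (d ` {1..r}))"
  have e: "e > 0"
    unfolding e_def using d(1) by (subst Min_gr_iff) auto
  have e': "e \<le> d k" if "k \<in> {1..r}" for k
    unfolding e_def using that by (intro Min_le) auto
  have "polydisc r a e \<subseteq> U"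
  proof
    fix s assume s: "s \<in> polydisc r a e"
    have "s i \<in> X i" for i
    proof (cases "i \<in> {1..r}")
      case True
      hence "s i \<in> ball (a i) (d i)" using s e'[OF True] by (force simp: polydisc_def)
      thus ?thesis using d(2) by blast
    next
      case False
      hence "s i = a i" using s assms(2) T by (auto simp: polydisc_def cspace_def PiE_def extensional_def)
      thus ?thesis using X(1) by auto
    qed
    thus "s \<in> U" using X(3) T s by (auto simp: polydisc_def)
  qed
  thus ?thesis using that e by blast
qed

text \<open>The M-test gives uniform convergence near each point. This yields joint continuity at
  once, and on each slice the one-variable theorem on uniform limits of holomorphic functions
  applies.\<close>

lemma holomorphic_cspace_suminf:
  fixes f :: "nat \<Rightarrow> (nat \<Rightarrow> complex) \<Rightarrow> complex"
  assumes f: "\<And>n. holomorphic_cspace r (f n) U" 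
    and bd: "\<And>a. a \<in> U \<Longrightarrow> \<exists>V M. a \<in> V \<and> openin (top_of_set (cspace r)) V \<and> summable M \<and>
               (\<forall>s\<in>V. \<forall>n. norm (f n s) \<le> M n)"
  shows "holomorphic_cspace r (\<lambda>s. \<Sum>n. f n s) U"
proof (rule holomorphic_cspace_local)
  fix a assume a: "a \<in> U"
  obtain V0 M where V0: "a \<in> V0" "openin (top_of_set (cspace r)) V0" "summable M"
      "\<And>s n. s \<in> V0 \<Longrightarrow> norm (f n s) \<le> M n"
    using bd[OF a] by blast
  define V where "V = V0 \<inter> U"
  have V: "openin (top_of_set (cspace r)) V" "a \<in> V" "V \<subseteq> U"
    using V0 a holomorphic_cspace_openin[OF f] by (auto simp: V_def)
  have unif: "uniform_limit V (\<lambda>n s. \<Sum>i<n. f i s) (\<lambda>s. \<Sum>n. f n s) sequentially"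
    by (rule Weierstrass_m_test) (use V0 in \<open>auto simp: V_def\<close>)
  have fV: "holomorphic_cspace r (\<lambda>s. \<Sum>i<n. f i s) V" for n
    using V by (intro holomorphic_cspace_sum holomorphic_cspace_subset[OF f])
  have "holomorphic_cspace r (\<lambda>s. \<Sum>n. f n s) V"
  proof (rule holomorphic_cspaceI[OF V(1)])
    show "continuous_on V (\<lambda>s. \<Sum>n. f n s)"
      by (rule uniform_limit_theorem[OF _ unif])
         (auto intro!: always_eventually holomorphic_cspace_continuous_on[OF fV])
    fix s k assume s: "s \<in> V" "s \<in> cspace r" "k \<in> {1..r}"
    define A where "A = {z. s(k := z) \<in> V}"
    show "(\<lambda>z. \<Sum>n. f n (s(k := z))) holomorphic_on A"
    proof (rule holomorphic_uniform_sequence)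
      show "open A" unfolding A_def by (rule open_slice[OF V(1) s(2,3)])
      show "(\<lambda>z. \<Sum>i<n. f i (s(k := z))) holomorphic_on A" for n
        by (rule holomorphic_cspace_slice[OF fV s(2,3)]) (auto simp: A_def)
      fix z assume "z \<in> A"
      then obtain d where d: "d > 0" "cball z d \<subseteq> A"
        using \<open>open A\<close> open_contains_cball by blast
      have "uniform_limit (cball z d) (\<lambda>n z. \<Sum>i<n. f i (s(k := z))) (\<lambda>z. \<Sum>n. f n (s(k := z))) sequentially"
        by (rule uniform_limit_compose'[OF unif]) (use d A_def in auto)
      thus "\<exists>d>0. cball z d \<subseteq> A \<and> uniform_limit (cball z d)
             (\<lambda>n z. \<Sum>i<n. f i (s(k := z))) (\<lambda>z. \<Sum>n. f n (s(k := z))) sequentially"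
        using d by blast
    qed
  qed
  thus "\<exists>V. a \<in> V \<and> V \<subseteq> U \<and> holomorphic_cspace r (\<lambda>s. \<Sum>n. f n s) V" using V by blast
qed

text \<open>The one-variable theorem is applied to one coordinate after another. The product form of
  \<open>P\<close> makes each slice a full connected set \<open>V k\<close>.\<close>

lemma identity_theorem_cspace:
  assumes V: "\<And>k. k \<in> {1..r} \<Longrightarrow> open (V k)" "\<And>k. k \<in> {1..r} \<Longrightarrow> connected (V k)"
    and P: "P = {s\<in>cspace r. \<forall>k\<in>{1..r}. s k \<in> V k}"
    and h: "holomorphic_cspace r h P"
    and W: "openin (top_of_set (cspace r)) W" "W \<subseteq> P" "w \<in> W" "\<And>s. s \<in> W \<Longrightarrow> h s = 0"
    and s: "s \<in> P"
  shows "h s = 0"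
proof -
  obtain e where e: "e > 0" "polydisc r w e \<subseteq> W"
    using polydisc_basis[OF W(1,3)] by blast
  have w: "w \<in> P" using W by blast
  \<comment> \<open>At stage \<open>j\<close> the first \<open>j\<close> coordinates already range
    over the whole factors, and only the later ones must stay near \<open>w\<close>.\<close>
  have "\<forall>s\<in>P. (\<forall>k\<in>{j+1..r}. s k \<in> ball (w k) e) \<longrightarrow> h s = 0" if "j \<le> r" for j
    using that
  proof (induction j)
    case 0
    thus ?case using e(2) W(4) by (auto simp: polydisc_def P subset_iff)
  next
    case (Suc j)
    show ?case
    proof (intro ballI impI)
      fix s assume s: "s \<in> P" "\<forall>k\<in>{Suc j+1..r}. s k \<in> ball (w k) e"
      have k: "Suc j \<in> {1..r}" using Suc by auto
      have sc: "s \<in> cspace r" using s P by auto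
      have "(\<lambda>z. h (s(Suc j := z))) (s (Suc j)) = 0"
      proof (rule analytic_continuation_open[where f = "\<lambda>z. h (s(Suc j := z))" and g = "\<lambda>_. 0"
            and s = "ball (w (Suc j)) e \<inter> V (Suc j)" and s' = "V (Suc j)"])
        show "(\<lambda>z. h (s(Suc j := z))) holomorphic_on V (Suc j)"
          by (rule holomorphic_cspace_slice[OF h sc k]) (use s P cspace_fun_upd[OF sc k] in auto)
        show "ball (w (Suc j)) e \<inter> V (Suc j) \<noteq> {}"
        proof -
          have "w (Suc j) \<in> ball (w (Suc j)) e \<inter> V (Suc j)"
            using w k e P by simp
          thus ?thesis by blast
        qed
        show "h (s(Suc j := z)) = 0" if "z \<in> ball (w (Suc j)) e \<inter> V (Suc j)" for z
        proof -
          have "s(Suc j := z) \<in> P" 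
            using s P cspace_fun_upd[OF sc k] that by auto
          moreover have "\<forall>k\<in>{j+1..r}. (s(Suc j := z)) k \<in> ball (w k) e"
            using s that by auto
          ultimately show ?thesis using Suc by auto
        qed
      qed (use V k s P in \<open>auto intro!: open_Int\<close>)
      thus "h s = 0" by simp
    qed
  qed
  from this[of r] s show ?thesis by auto
qed

section \<open>Dirichlet series\<close>

lemma norm_nat_powr: "norm ((of_nat n :: complex) powr z) = real n powr Re z"
  using norm_powr_real_powr[of "of_nat n" z] by simp

lemma nat_powr_holomorphic [holomorphic_intros]:
  assumes "f holomorphic_on A"
  shows "(\<lambda>z. (of_nat n :: complex) powr f z) holomorphic_on A"
proof (cases "n = 0")
  case False
  thus ?thesis using assms by (auto simp: powr_def intro!: holomorphic_intros)
qed simp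

lemma summable_Suc_powr: "x < -1 \<Longrightarrow> summable (\<lambda>m. real (Suc m) powr x)"
  using summable_real_powr_iff[of x] by (subst summable_Suc_iff) simp

text \<open>
  For \<open>m = 0\<close> the first summand is \<open>0\<close>, since \<open>0 powr _ = 0\<close>; this makes the boundary term of the
  summation by parts below vanish.
\<close>

definition taylor_rem :: "nat \<Rightarrow> complex \<Rightarrow> nat \<Rightarrow> complex" where
  "taylor_rem N s m = of_nat m powr (1 - s) - of_nat (Suc m) powr (1 - s) -
     (\<Sum>k<N. pochhammer (s - 1) (Suc k) / fact (Suc k) * of_nat (Suc m) powr (- s - of_nat k))"

text \<open>Gives nonnegative majorants of the binomial coefficients, uniform over a disc of
  exponents.\<close>

lemma norm_pochhammer_le: "norm z \<le> R \<Longrightarrow> norm (pochhammer (z :: complex) n) \<le> pochhammer R n"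
proof (induction n)
  case (Suc n)
  have "0 \<le> pochhammer R n" using Suc norm_ge_zero order_trans by blast
  moreover have "norm (z + of_nat n) \<le> R + of_nat n"
    using Suc.prems norm_triangle_ineq[of z "of_nat n"] by simp
  ultimately show ?case
    using Suc by (auto simp: pochhammer_Suc norm_mult intro!: mult_mono)
qed simp

text \<open>The signs of the generalised binomial coefficient and of the power of \<open>- u\<close>
  cancel, which leaves rising factorials that can be majorised termwise.\<close>

lemma neg_binomial_series:
  assumes "norm u < 1"
  shows "(\<lambda>n. pochhammer (s - 1) n / fact n * u ^ n) sums (1 - u :: complex) powr (1 - s)"
proof -
  have "(\<lambda>n. ((1 - s) gchoose n) * (- u) ^ n) sums (1 + (- u)) powr (1 - s)"
    by (rule gen_binomial_complex) (use assms in simp)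
  also have "(\<lambda>n. ((1 - s) gchoose n) * (- u) ^ n) = (\<lambda>n. pochhammer (s - 1) n / fact n * u ^ n)"
  proof
    fix n
    have "((1 - s) gchoose n) * (- u) ^ n = ((-1) ^ n * (-1) ^ n) * (pochhammer (s - 1) n / fact n * u ^ n)"
      unfolding gbinomial_pochhammer power_minus[of u] by simp
    thus "((1 - s) gchoose n) * (- u) ^ n = pochhammer (s - 1) n / fact n * u ^ n"
      by (simp flip: power_add)
  qed
  finally show ?thesis by simp
qed

text \<open>With n = m + 1 \<ge> 2 and u = 1 / n \<le> 1/2, the remainder is n^(1-s) times the tail
  of the binomial series of (1 - u)^(1-s) beyond order N. In that tail u^(N+1) can be extracted and
  the rest compared with the series at 1/2, so the size is n^(1 - Re s) n^(-N-1). The constant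
  depends on the disc only.\<close>

lemma taylor_rem_bound:
  assumes "R \<ge> 0"
  shows "\<exists>C\<ge>0. \<forall>s m. norm (s - 1) \<le> R \<longrightarrow>
           norm (taylor_rem N s m) \<le> C * real (Suc m) powr (- Re s - real N)"
proof -
  define p where "p = (\<lambda>n. pochhammer R n / fact n)"
  have p0: "p n \<ge> 0" for n
    unfolding p_def using assms by (cases "R = 0") (auto intro!: divide_nonneg_pos pochhammer_nonneg simp: pochhammer_0_left)
  have sump: "summable (\<lambda>n. p n * (1/2) ^ n)"
  proof -
    \<comment> \<open>The majorants are themselves the coefficients of a binomial series, namely for
      the exponent with s - 1 = R, evaluated at 1/2.\<close>
    have "summable (\<lambda>n. complex_of_real (p n * (1/2) ^ n))"
      using neg_binomial_series[of "1/2" "of_real R + 1"]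
      by (auto simp: p_def sums_iff pochhammer_of_real)
    thus ?thesis using summable_of_real_iff[where 'a = complex] by blast
  qed
  have pc: "norm (pochhammer (s - 1) n / fact n) \<le> p n" if "norm (s - 1) \<le> R" for s :: complex and n
    unfolding p_def norm_divide using norm_pochhammer_le[OF that] by (auto intro!: divide_right_mono)
  define S where "S = (\<Sum>n. p n * (1/2) ^ n)"
  have S0: "S \<ge> 0" unfolding S_def by (intro suminf_nonneg sump) (auto simp: p0)
  \<comment> \<open>The bracket takes care of \<open>m = 0\<close>, where u = 1 and the tail
    estimate fails; the last summand takes care of all other \<open>m\<close>.\<close>
  define C where "C = (1 + (\<Sum>k<N. p (Suc k))) + 2 ^ (N + 1) * S"
  have C0: "C \<ge> 0" unfolding C_def by (intro add_nonneg_nonneg sum_nonneg p0 mult_nonneg_nonneg S0) auto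
  have "norm (taylor_rem N s m) \<le> C * real (Suc m) powr (- Re s - real N)" if s: "norm (s - 1) \<le> R" for s m
  proof (cases "m = 0")
    case True
    have "norm (taylor_rem N s m) \<le> 1 + (\<Sum>k<N. norm (pochhammer (s - 1) (Suc k) / fact (Suc k)))"
      unfolding taylor_rem_def True
      by (simp, rule order_trans[OF norm_triangle_ineq4], auto intro: sum_norm_le)
    also have "\<dots> \<le> 1 + (\<Sum>k<N. p (Suc k))"
      by (intro add_mono sum_mono pc s order_refl)
    also have "\<dots> \<le> C" unfolding C_def using S0 by simp
    finally show ?thesis using True by simp
  next
    case False
    define u where "u = 1 / (of_nat (Suc m) :: complex)"
    define c where "c = (\<lambda>n. pochhammer (s - 1) n / fact n)"
    have nu: "norm u = 1 / real (Suc m)" unfolding u_def by (simp add: norm_divide del: of_nat_Suc)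
    have nu2: "norm u \<le> 1/2" using False unfolding nu by (simp add: field_simps)
    have ser: "(\<lambda>n. c n * u ^ n) sums (1 - u) powr (1 - s)"
      unfolding c_def by (rule neg_binomial_series) (use nu2 in linarith)
    have "real m = real (Suc m) * (1 - 1 / real (Suc m))"
      by (simp add: field_simps)
    hence "(of_nat m :: complex) = of_real (real (Suc m)) * of_real (1 - 1 / real (Suc m))"
      by (metis of_real_mult of_real_of_nat_eq)
    hence m: "(of_nat m :: complex) powr (1 - s) = of_nat (Suc m) powr (1 - s) * (1 - u) powr (1 - s)"
      by (simp only:, subst powr_times_real) (auto simp: u_def simp del: of_nat_Suc)
    have "(\<lambda>n. c (n + (N + 1)) * u ^ (n + (N + 1))) sums ((1 - u) powr (1 - s) - (\<Sum>n<N + 1. c n * u ^ n))"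
      by (rule sums_split_initial_segment[OF ser])
    also have "(\<Sum>n<N + 1. c n * u ^ n) = 1 + (\<Sum>k<N. c (Suc k) * u ^ Suc k)"
      unfolding Suc_eq_plus1[symmetric] by (subst sum.lessThan_Suc_shift) (simp add: c_def)
    finally have tail: "(\<lambda>n. c (n + (N + 1)) * u ^ (n + (N + 1))) sums ((1 - u) powr (1 - s) - 1 - (\<Sum>k<N. c (Suc k) * u ^ Suc k))"
      by (simp add: algebra_simps)
    have eq: "taylor_rem N s m = of_nat (Suc m) powr (1 - s) * ((1 - u) powr (1 - s) - 1 - (\<Sum>k<N. c (Suc k) * u ^ Suc k))"
    proof -
      have "of_nat (Suc m) powr (- s - of_nat k) = of_nat (Suc m) powr (1 - s) * u ^ Suc k" for k
      proof -
        have "of_nat (Suc m) powr (- s - of_nat k) = of_nat (Suc m) powr (1 - s - of_nat (Suc k))"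
          by (simp add: algebra_simps del: of_nat_Suc, simp)
        also have "\<dots> = of_nat (Suc m) powr (1 - s) / of_nat (Suc m) powr (of_nat (Suc k))"
          by (rule powr_diff)
        also have "of_nat (Suc m) powr (of_nat (Suc k)) = (of_nat (Suc m) :: complex) ^ Suc k"
          by (subst powr_nat') (auto simp del: of_nat_Suc)
        finally show ?thesis by (simp add: u_def power_divide del: of_nat_Suc)
      qed
      thus ?thesis unfolding taylor_rem_def m c_def
        by (simp add: algebra_simps sum_distrib_left del: of_nat_Suc power_Suc)
    qed
    have "norm ((1 - u) powr (1 - s) - 1 - (\<Sum>k<N. c (Suc k) * u ^ Suc k)) \<le> (2 * norm u) ^ (N + 1) * S"
    proof -
      have le: "norm (c (n + (N + 1)) * u ^ (n + (N + 1))) \<le> (2 * norm u) ^ (N + 1) * (p (n + (N + 1)) * (1/2) ^ (n + (N + 1)))" for n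
      proof -
        have "norm (c (n + (N + 1)) * u ^ (n + (N + 1))) \<le> p (n + (N + 1)) * (norm u ^ (N + 1) * (1/2) ^ n)"
          unfolding norm_mult power_add norm_power
          by (subst mult.commute[of "norm u ^ n"], intro mult_mono order_refl power_mono nu2)
             (use pc[OF s] p0 in \<open>simp_all add: c_def del: fact_Suc add_Suc_right\<close>)
        also have "\<dots> = (2 * norm u) ^ (N + 1) * (p (n + (N + 1)) * (1/2) ^ (n + (N + 1)))"
          by (simp add: power_add power_mult_distrib power_divide field_simps)
        finally show ?thesis .
      qed
      have sm: "summable (\<lambda>n. p (n + (N + 1)) * (1/2) ^ (n + (N + 1)))"
        using summable_ignore_initial_segment[OF sump, of "N + 1"] by simp
      have "norm ((1 - u) powr (1 - s) - 1 - (\<Sum>k<N. c (Suc k) * u ^ Suc k)) 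
           \<le> (\<Sum>n. (2 * norm u) ^ (N + 1) * (p (n + (N + 1)) * (1/2) ^ (n + (N + 1))))"
        unfolding sums_unique[OF tail] by (rule norm_suminf_le[OF le summable_mult[OF sm]])
      also have "\<dots> = (2 * norm u) ^ (N + 1) * (\<Sum>n. (p (n + (N + 1)) * (1/2) ^ (n + (N + 1))))"
        by (rule suminf_mult[OF sm])
      also have "\<dots> \<le> (2 * norm u) ^ (N + 1) * S"
      proof (rule mult_left_mono)
        have "0 \<le> (\<Sum>n<N+1. p n * (1/2) ^ n)" by (intro sum_nonneg mult_nonneg_nonneg p0) auto
        thus "(\<Sum>n. (p (n + (N + 1)) * (1/2) ^ (n + (N + 1)))) \<le> S"
          unfolding S_def suminf_split_initial_segment[OF sump, of "N + 1"] by simp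
      qed auto
      finally show ?thesis .
    qed
    hence "norm (taylor_rem N s m) \<le> real (Suc m) powr (1 - Re s) * ((2 * norm u) ^ (N + 1) * S)"
      unfolding eq norm_mult norm_nat_powr minus_complex.sel one_complex.sel by (intro mult_left_mono) auto
    also have "\<dots> = 2 ^ (N + 1) * S * (real (Suc m) powr (1 - Re s) * norm u ^ (N + 1))"
      by (simp add: power_mult_distrib del: power_Suc)
    also have "real (Suc m) powr (1 - Re s) * norm u ^ (N + 1) = real (Suc m) powr (- Re s - real N)"
    proof -
      have "norm u ^ (N + 1) = real (Suc m) powr (- real (N + 1))"
        unfolding nu by (subst powr_minus, subst powr_realpow) (auto simp: power_divide field_simps)
      thus ?thesis by (simp only: powr_add[symmetric]) simp
    qed
    also have "2 ^ (N + 1) * S * \<dots> \<le> C * \<dots>"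
      by (rule mult_right_mono) (use p0 in \<open>auto simp: C_def intro!: add_nonneg_nonneg sum_nonneg\<close>)
    finally show ?thesis .
  qed
  thus ?thesis using C0 by blast
qed

section \<open>Dirichlet series with polynomially bounded coefficients\<close>

definition dirichlet :: "(nat \<Rightarrow> complex) \<Rightarrow> complex \<Rightarrow> complex" where
  "dirichlet a z = (\<Sum>m. a m * of_nat (Suc m) powr (- z))"

lemma dirichlet_norm_summable:
  assumes "\<And>m. norm (a m) \<le> real (Suc m) powr c" "Re z > c + 1"
  shows "summable (\<lambda>m. norm (a m * of_nat (Suc m) powr (- z)))"
proof (rule summable_comparison_test')
  show "summable (\<lambda>m. real (Suc m) powr (c - Re z))"
    by (rule summable_Suc_powr) (use assms in simp)
  fix m
  have "norm (a m * of_nat (Suc m) powr (- z)) \<le> real (Suc m) powr c * real (Suc m) powr (- Re z)"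
    unfolding norm_mult norm_nat_powr uminus_complex.sel by (intro mult_mono assms) auto
  also have "\<dots> = real (Suc m) powr (c - Re z)"
    by (simp only: powr_add[symmetric]) simp
  finally show "norm (norm (a m * of_nat (Suc m) powr (- z))) \<le> real (Suc m) powr (c - Re z)"
    by simp
qed

lemma dirichlet_sums:
  assumes "\<And>m. norm (a m) \<le> real (Suc m) powr c" "Re z > c + 1"
  shows "(\<lambda>m. a m * of_nat (Suc m) powr (- z)) sums dirichlet a z"
  unfolding dirichlet_def by (rule summable_sums[OF summable_norm_cancel[OF dirichlet_norm_summable[OF assms]]])

text \<open>Abel summation: the lower boundary term is 0 by the convention on powers of 0, and the
  upper one tends to 0. The differences are estimated by the size of \<open>a\<close> alone, which
  is why the half-plane starts at \<open>c + 2\<close>.\<close>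

lemma summation_by_parts_sums:
  assumes a: "\<And>m. norm (a m) \<le> real (Suc m) powr c" and z: "Re z > c + 2" and c: "c \<ge> 0"
  shows "(\<lambda>m. a m * (of_nat m powr (1 - z) - of_nat (Suc m) powr (1 - z))) sums
           dirichlet (\<lambda>m. a (Suc m) - a m) (z - 1)"
proof -
  define b where "b = (\<lambda>m. (of_nat m :: complex) powr (1 - z))"
  have b0: "b 0 = 0" by (simp add: b_def)
  have Sb: "real (Suc (Suc m)) powr c \<le> 2 powr c * real (Suc m) powr c" for m
    unfolding powr_mult[symmetric] by (rule powr_mono2[OF c]) auto
  have "summable (\<lambda>m. (a (Suc m) - a m) * b (Suc m))"
  proof (rule summable_comparison_test')
    show "summable (\<lambda>m. (2 powr c + 1) * real (Suc m) powr (c + 1 - Re z))"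
      by (intro summable_mult summable_Suc_powr) (use z in simp)
    fix m
    have "norm (a (Suc m) - a m) \<le> 2 powr c * real (Suc m) powr c + real (Suc m) powr c"
      using norm_triangle_ineq4[of "a (Suc m)" "a m"] a[of "Suc m"] a[of m] Sb[of m] by linarith
    hence "norm ((a (Suc m) - a m) * b (Suc m)) \<le> ((2 powr c + 1) * real (Suc m) powr c) * real (Suc m) powr (1 - Re z)"
      unfolding norm_mult b_def norm_nat_powr minus_complex.sel one_complex.sel
      by (intro mult_mono) (auto simp: algebra_simps)
    also have "\<dots> = (2 powr c + 1) * real (Suc m) powr (c + 1 - Re z)"
      by (simp only: mult.assoc powr_add[symmetric]) (simp add: algebra_simps)
    finally show "norm ((a (Suc m) - a m) * b (Suc m)) \<le> (2 powr c + 1) * real (Suc m) powr (c + 1 - Re z)" .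
  qed
  hence 1: "(\<lambda>M. \<Sum>m<M. (a (Suc m) - a m) * b (Suc m)) \<longlonglongrightarrow> dirichlet (\<lambda>m. a (Suc m) - a m) (z - 1)"
    using summable_LIMSEQ by (simp add: dirichlet_def b_def del: of_nat_Suc)
  have 2: "(\<lambda>M. a M * b M) \<longlonglongrightarrow> 0"
  proof (rule Lim_null_comparison)
    show "\<forall>\<^sub>F M in sequentially. norm (a M * b M) \<le> 2 powr c * real M powr (c + 1 - Re z)"
      using eventually_gt_at_top[of 0]
    proof eventually_elim
      case (elim M)
      then obtain m where m: "M = Suc m" by (cases M) auto
      have "norm (a M * b M) \<le> (2 powr c * real M powr c) * real M powr (1 - Re z)"
        unfolding norm_mult b_def norm_nat_powr minus_complex.sel one_complex.sel m
        using a[of "Suc m"] Sb[of m] by (intro mult_mono) auto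
      also have "\<dots> = 2 powr c * real M powr (c + 1 - Re z)"
        by (simp only: mult.assoc powr_add[symmetric]) (simp add: algebra_simps)
      finally show ?case .
    qed
    have "(\<lambda>M. real M powr (c + 1 - Re z)) \<longlonglongrightarrow> 0"
      using z by (intro tendsto_neg_powr filterlim_real_sequentially) auto
    from tendsto_mult_left[OF this, of "2 powr c"] show "(\<lambda>M. 2 powr c * real M powr (c + 1 - Re z)) \<longlonglongrightarrow> 0"
      by simp
  qed
  have 3: "(\<Sum>m<M. a m * (b m - b (Suc m))) = (\<Sum>m<M. (a (Suc m) - a m) * b (Suc m)) - a M * b M" for M
    by (induction M) (auto simp: algebra_simps b0)
  have "(\<lambda>M. \<Sum>m<M. a m * (b m - b (Suc m))) \<longlonglongrightarrow> dirichlet (\<lambda>m. a (Suc m) - a m) (z - 1) - 0"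
    unfolding 3 by (rule tendsto_diff[OF 1 2])
  thus ?thesis by (simp add: sums_def b_def del: of_nat_Suc)
qed

text \<open>Expanding \<open>(n - 1)\<^sup>1\<^sup>-\<^sup>z\<close> around \<open>n\<close> under the sum over \<open>n\<close>.\<close>

lemma dirichlet_shift:
  assumes a: "\<And>m. norm (a m) \<le> real (Suc m) powr c" and z: "Re z > c + 2" and c: "c \<ge> 0"
  shows "(z - 1) * dirichlet a z = dirichlet (\<lambda>m. a (Suc m) - a m) (z - 1)
           - (\<Sum>k=1..j. pochhammer (z - 1) (Suc k) / fact (Suc k) * dirichlet a (z + of_nat k))
           - (\<Sum>m. a m * taylor_rem (Suc j) z m)"
proof -
  define q where "q = (\<lambda>k. pochhammer (z - 1) (Suc k) / fact (Suc k))"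
  have s: "(\<lambda>m. a m * of_nat (Suc m) powr (- z - of_nat k)) sums dirichlet a (z + of_nat k)" for k
    using dirichlet_sums[OF a, of "z + of_nat k"] z by (simp del: of_nat_Suc)
  have 1: "(\<lambda>m. \<Sum>k<Suc j. q k * (a m * of_nat (Suc m) powr (- z - of_nat k))) sums (\<Sum>k<Suc j. q k * dirichlet a (z + of_nat k))"
    by (intro sums_sum sums_mult s)
  have "(\<lambda>m. a m * (of_nat m powr (1 - z) - of_nat (Suc m) powr (1 - z)) - (\<Sum>k<Suc j. q k * (a m * of_nat (Suc m) powr (- z - of_nat k)))) sums
     (dirichlet (\<lambda>m. a (Suc m) - a m) (z - 1) - (\<Sum>k<Suc j. q k * dirichlet a (z + of_nat k)))"
    by (intro sums_diff summation_by_parts_sums[OF a z c] 1)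
  also have "(\<lambda>m. a m * (of_nat m powr (1 - z) - of_nat (Suc m) powr (1 - z)) - (\<Sum>k<Suc j. q k * (a m * of_nat (Suc m) powr (- z - of_nat k)))) = (\<lambda>m. a m * taylor_rem (Suc j) z m)"
    unfolding taylor_rem_def q_def by (simp only: right_diff_distrib sum_distrib_left mult_ac)
  finally have "(\<Sum>m. a m * taylor_rem (Suc j) z m) = dirichlet (\<lambda>m. a (Suc m) - a m) (z - 1) - (\<Sum>k<Suc j. q k * dirichlet a (z + of_nat k))"
    by (rule sums_unique[symmetric])
  \<comment> \<open>The summand for k = 0 has coefficient z - 1 and contains the unshifted series;
    it is the one to be solved for.\<close>
  also have "(\<Sum>k<Suc j. q k * dirichlet a (z + of_nat k)) = (z - 1) * dirichlet a z + (\<Sum>k=1..j. q k * dirichlet a (z + of_nat k))"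
  proof -
    have "{..<Suc j} = insert 0 {1..j}" by auto
    thus ?thesis by (simp add: q_def)
  qed
  finally show ?thesis unfolding q_def by (simp add: algebra_simps)
qed

section \<open>Continuation in the last variable\<close>

text \<open>A chain rule for substitutions in which each variable enters just one coordinate of the
  image. This covers both the shifts of the last variable and the merging of the last two variables,
  and only one-variable composition is involved.\<close>

lemma holomorphic_cspace_map:
  assumes f: "holomorphic_cspace q f U" and V: "openin (top_of_set (cspace r)) V"
    and T: "continuous_on V T" "T ` V \<subseteq> U"
    and sl: "\<And>s k. s \<in> V \<Longrightarrow> k \<in> {1..r} \<Longrightarrow>
       \<exists>k'\<in>{1..q}. \<exists>\<psi>. \<psi> holomorphic_on UNIV \<and> (\<forall>z. T (s(k := z)) = (T s)(k' := \<psi> z))"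
  shows "holomorphic_cspace r (\<lambda>s. f (T s)) V"
proof (rule holomorphic_cspaceI[OF V])
  show "continuous_on V (\<lambda>s. f (T s))"
    by (rule continuous_on_compose2[OF holomorphic_cspace_continuous_on[OF f] T])
  fix s k assume s: "s \<in> V" "s \<in> cspace r" "k \<in> {1..r}"
  obtain k' \<psi> where k': "k' \<in> {1..q}" "\<psi> holomorphic_on UNIV" "\<And>z. T (s(k := z)) = (T s)(k' := \<psi> z)"
    using sl[OF s(1,3)] by blast
  have Ts: "T s \<in> cspace q"
    using s T openin_imp_subset[OF holomorphic_cspace_openin[OF f]] by blast
  have "(\<lambda>y. f ((T s)(k' := y))) holomorphic_on {y. (T s)(k' := y) \<in> U}"
    by (rule holomorphic_cspace_slice[OF f Ts k'(1)]) auto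
  hence "(\<lambda>z. f ((T s)(k' := \<psi> z))) holomorphic_on {z. s(k := z) \<in> V}"
    by (rule holomorphic_on_compose_gen[unfolded o_def, rotated])
       (use k' T in \<open>auto intro: holomorphic_on_subset simp flip: k'(3)\<close>)
  thus "(\<lambda>z. f (T (s(k := z)))) holomorphic_on {z. s(k := z) \<in> V}"
    by (simp add: k'(3))
qed

lemma continuous_on_coord: "continuous_on A (\<lambda>s::nat \<Rightarrow> complex. s i)"
  by (rule continuous_on_subset[OF continuous_on_product_coordinates]) simp

lemma continuous_on_fun_upd':
  assumes "continuous_on A g"
  shows "continuous_on A (\<lambda>s::nat \<Rightarrow> complex. s(i := g s))"
proof (rule continuous_on_coordinatewise_then_product)
  fix j
  show "continuous_on A (\<lambda>s. (s(i := g s)) j)"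
    using assms by (cases "j = i") (simp_all add: continuous_on_coord)
qed

text \<open>The growth of the coefficients, and with it the abscissa of convergence in the last
  variable, is uniform only while the other real parts are bounded below; hence the two separate
  bounds.\<close>

definition rdom :: "nat \<Rightarrow> real \<Rightarrow> real \<Rightarrow> (nat \<Rightarrow> complex) set" where
  "rdom r R x = {s\<in>cspace r. (\<forall>k\<in>{1..<r}. Re (s k) > - R) \<and> Re (s r) > x}"

lemma rdom_mono: "R \<le> R' \<Longrightarrow> x' \<le> x \<Longrightarrow> rdom r R x \<subseteq> rdom r R' x'"
  unfolding rdom_def by fastforce

lemma openin_rdom:
  assumes "r \<ge> 1"
  shows "openin (top_of_set (cspace r)) (rdom r R x)"
proof -
  have "rdom r R x = {s\<in>cspace r. \<forall>k\<in>{1..r}. s k \<in> (if k < r then {z. Re z > - R} else {z. Re z > x})}"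
    using assms unfolding rdom_def by (auto split: if_splits)
  thus ?thesis
    by (simp only:) (rule openin_box, auto intro: open_halfspace_Re_gt)
qed

lemma rdom_fun_upd_last:
  assumes "s \<in> rdom r R x" "r \<ge> 1" "Re z > y"
  shows "s(r := z) \<in> rdom r R y"
  using assms by (auto simp: rdom_def intro: cspace_fun_upd)

lemma holomorphic_cspace_nat_powr:
  "openin (top_of_set (cspace r)) U \<Longrightarrow> holomorphic_cspace r (\<lambda>s. of_nat n powr (- s i)) U"
  by (rule holomorphic_cspace_compose[OF holomorphic_cspace_coord, where h = "\<lambda>z. of_nat n powr (- z)" and A = UNIV])
     (auto intro!: holomorphic_intros)

lemma dirichlet_holomorphic:
  assumes r: "r \<ge> 1" and a: "\<And>m. holomorphic_cspace r (\<lambda>s. a s m) (cspace r)"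
    and bd: "\<And>s m. s \<in> cspace r \<Longrightarrow> (\<forall>k\<in>{1..<r}. Re (s k) > - R) \<Longrightarrow> norm (a s m) \<le> real (Suc m) powr c"
  shows "holomorphic_cspace r (\<lambda>s. dirichlet (a s) (s r)) (rdom r R (c + 1))"
  unfolding dirichlet_def
proof (rule holomorphic_cspace_suminf)
  show "holomorphic_cspace r (\<lambda>s. a s m * of_nat (Suc m) powr (- s r)) (rdom r R (c + 1))" for m
    by (intro holomorphic_cspace_mult holomorphic_cspace_nat_powr openin_rdom r
          holomorphic_cspace_restrict[OF a])
  fix t assume t: "t \<in> rdom r R (c + 1)"
  define x where "x = (Re (t r) + (c + 1)) / 2"
  have x: "c + 1 < x" "x < Re (t r)" using t by (auto simp: x_def rdom_def)
  show "\<exists>V M. t \<in> V \<and> openin (top_of_set (cspace r)) V \<and> summable M \<and>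
          (\<forall>s\<in>V. \<forall>m. norm (a s m * of_nat (Suc m) powr (- s r)) \<le> M m)"
  proof (intro exI conjI ballI allI)
    show "t \<in> rdom r R x" using t x by (auto simp: rdom_def)
    show "openin (top_of_set (cspace r)) (rdom r R x)" by (rule openin_rdom[OF r])
    show "summable (\<lambda>m. real (Suc m) powr (c - x))" by (rule summable_Suc_powr) (use x in simp)
    fix s m assume s: "s \<in> rdom r R x"
    have "norm (a s m * of_nat (Suc m) powr (- s r)) \<le> real (Suc m) powr c * real (Suc m) powr (- x)"
      unfolding norm_mult norm_nat_powr uminus_complex.sel
      by (intro mult_mono bd powr_mono) (use s in \<open>auto simp: rdom_def\<close>)
    also have "\<dots> = real (Suc m) powr (c - x)"
      by (simp only: powr_add[symmetric]) simp
    finally show "norm (a s m * of_nat (Suc m) powr (- s r)) \<le> real (Suc m) powr (c - x)" .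
  qed
qed

text \<open>Abstracts one stage of the induction on \<open>r\<close>. The coefficients
  \<open>a\<close> do not depend on the last variable, \<open>w\<close> clears the poles and is
  invariant under integer shifts, and \<open>B\<close> is an entire continuation of \<open>w\<close>
  times the series of differences, which the previous stage provides.\<close>

locale dirichlet_family =
  fixes r :: nat and a :: "(nat \<Rightarrow> complex) \<Rightarrow> nat \<Rightarrow> complex"
    and w B :: "(nat \<Rightarrow> complex) \<Rightarrow> complex"
  assumes r: "r \<ge> 1"
    and a_holo: "\<And>m. holomorphic_cspace r (\<lambda>s. a s m) (cspace r)"
    and a_last: "\<And>s z m. a (s(r := z)) m = a s m"
    and a_bound: "\<And>R. R \<ge> 0 \<Longrightarrow> \<exists>c\<ge>0. \<forall>s\<in>cspace r. (\<forall>k\<in>{1..<r}. Re (s k) > - R) \<longrightarrow>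
                   (\<forall>m. norm (a s m) \<le> real (Suc m) powr c)"
    and w_holo: "holomorphic_cspace r w (cspace r)"
    and w_shift: "\<And>s k. s \<in> cspace r \<Longrightarrow> w (s(r := s r + of_nat k)) = w s"
    and B_holo: "holomorphic_cspace r B (cspace r)"
    and B_eq: "\<And>R. R \<ge> 0 \<Longrightarrow> \<exists>x. \<forall>s\<in>rdom r R x.
                 B s = w s * dirichlet (\<lambda>m. a s (Suc m) - a s m) (s r - 1)"
begin

text \<open>The function to be continued; \<open>s r - 1\<close> is the factor with which the
  unshifted series appears in \<open>dirichlet_shift\<close>.\<close>

definition Lambda :: "(nat \<Rightarrow> complex) \<Rightarrow> complex" where
  "Lambda s = w s * (s r - 1) * dirichlet (a s) (s r)"

lemma taylor_rem_holo:
  "openin (top_of_set (cspace r)) U \<Longrightarrow> holomorphic_cspace r (\<lambda>s. taylor_rem N (s r) m) U"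
proof (rule holomorphic_cspace_compose[OF holomorphic_cspace_coord, where h = "\<lambda>z. taylor_rem N z m" and A = UNIV])
  have "(\<lambda>z. pochhammer (z - 1 :: complex) k) holomorphic_on UNIV" for k
    by (induction k) (auto simp: pochhammer_Suc intro!: holomorphic_intros)
  thus "(\<lambda>z. taylor_rem N z m) holomorphic_on UNIV"
    unfolding taylor_rem_def by (intro holomorphic_intros) auto
qed auto

context
  fixes R c :: real
  assumes c: "c \<ge> 0"
    and bd: "\<And>s m. s \<in> cspace r \<Longrightarrow> (\<forall>k\<in>{1..<r}. Re (s k) > - R) \<Longrightarrow> norm (a s m) \<le> real (Suc m) powr c"
begin

lemma norm_coeff_le: "s \<in> rdom r R x \<Longrightarrow> norm (a s m) \<le> real (Suc m) powr c"
  using bd by (auto simp: rdom_def)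

text \<open>The bound on \<open>taylor_rem\<close> gains one power of \<open>Suc m\<close> for every
  extra Taylor term, so each term moves the half-plane of convergence one unit to the left.\<close>

lemma remainder_holo:
  "holomorphic_cspace r (\<lambda>s. \<Sum>m. a s m * taylor_rem N (s r) m) (rdom r R (c + 1 - real N))"
proof (rule holomorphic_cspace_suminf)
  show "holomorphic_cspace r (\<lambda>s. a s m * taylor_rem N (s r) m) (rdom r R (c + 1 - real N))" for m
    by (intro holomorphic_cspace_mult holomorphic_cspace_restrict[OF a_holo] taylor_rem_holo openin_rdom r)
  fix t assume t: "t \<in> rdom r R (c + 1 - real N)"
  define x where "x = (Re (t r) + (c + 1 - real N)) / 2"
  have x: "c + 1 - real N < x" "x < Re (t r)" using t by (auto simp: x_def rdom_def)
  \<comment> \<open>Bounds the distance of the last coordinate from 1 throughout the unit polydisc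
    around \<open>t\<close>, which is what makes the constant \<open>C\<close> uniform
    there.\<close>
  define Q where "Q = norm (t r - 1) + 1"
  obtain C where C: "C \<ge> 0" "\<And>s m. norm (s - 1) \<le> Q \<Longrightarrow> norm (taylor_rem N s m) \<le> C * real (Suc m) powr (- Re s - real N)"
    using taylor_rem_bound[of Q N] by (auto simp: Q_def)
  have op: "openin (top_of_set (cspace r)) (rdom r R x \<inter> polydisc r t 1)"
    by (intro openin_Int openin_rdom r openin_polydisc)
  show "\<exists>V M. t \<in> V \<and> openin (top_of_set (cspace r)) V \<and> summable M \<and>
          (\<forall>s\<in>V. \<forall>m. norm (a s m * taylor_rem N (s r) m) \<le> M m)"
  proof (intro exI conjI ballI allI)
    show "t \<in> rdom r R x \<inter> polydisc r t 1" using t x by (auto simp: rdom_def polydisc_def)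
    show "openin (top_of_set (cspace r)) (rdom r R x \<inter> polydisc r t 1)" by fact
    show "summable (\<lambda>m. C * real (Suc m) powr (c - x - real N))"
      by (intro summable_mult summable_Suc_powr) (use x in simp)
    fix s m assume s: "s \<in> rdom r R x \<inter> polydisc r t 1"
    have "dist (t r) (s r) < 1" using s r by (auto simp: polydisc_def)
    hence "norm (s r - 1) \<le> Q"
      unfolding Q_def dist_norm using norm_triangle_ineq[of "s r - t r" "t r - 1"] by (simp add: norm_minus_commute)
    note C(2)[OF this, of m]
    also have "C * real (Suc m) powr (- Re (s r) - real N) \<le> C * real (Suc m) powr (- x - real N)"
      by (intro mult_left_mono powr_mono C) (use s in \<open>auto simp: rdom_def\<close>)
    finally have "norm (a s m * taylor_rem N (s r) m) \<le> real (Suc m) powr c * (C * real (Suc m) powr (- x - real N))"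
      unfolding norm_mult using s norm_coeff_le[of s x m] by (intro mult_mono) auto
    also have "\<dots> = C * real (Suc m) powr (c - x - real N)"
      by (simp only: mult.left_commute powr_add[symmetric]) (simp add: algebra_simps)
    finally show "norm (a s m * taylor_rem N (s r) m) \<le> C * real (Suc m) powr (c - x - real N)" .
  qed
qed

text \<open>Each step gains a strip of width 1: a shift of the last variable by k \<ge> 1 carries
  the new region into the old one, where \<open>H\<close> is already available, and the remaining
  terms are holomorphic on the new region.\<close>

lemma continuation_step:
  assumes x0: "c + 2 \<le> x0" "\<And>s. s \<in> rdom r R x0 \<Longrightarrow> B s = w s * dirichlet (\<lambda>m. a s (Suc m) - a s m) (s r - 1)"
  shows "\<exists>H. holomorphic_cspace r H (rdom r R (x0 - real j)) \<and> (\<forall>s\<in>rdom r R x0. H s = Lambda s)"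
proof (induction j)
  case 0
  have "holomorphic_cspace r Lambda (rdom r R x0)"
    unfolding Lambda_def
  proof (intro holomorphic_cspace_mult holomorphic_cspace_diff holomorphic_cspace_coord
      holomorphic_cspace_const openin_rdom r)
    show "holomorphic_cspace r w (rdom r R x0)"
      by (rule holomorphic_cspace_restrict[OF w_holo openin_rdom[OF r]])
    show "holomorphic_cspace r (\<lambda>s. dirichlet (a s) (s r)) (rdom r R x0)"
      by (rule holomorphic_cspace_subset[OF dirichlet_holomorphic[OF r a_holo bd] rdom_mono])
         (use x0(1) in \<open>auto intro!: openin_rdom r\<close>)
  qed
  thus ?case by auto
next
  case (Suc j)
  then obtain H where H: "holomorphic_cspace r H (rdom r R (x0 - real j))" "\<And>s. s \<in> rdom r R x0 \<Longrightarrow> H s = Lambda s"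
    by blast
  define D where "D = rdom r R (x0 - real (Suc j))"
  have D: "openin (top_of_set (cspace r)) D" unfolding D_def by (rule openin_rdom[OF r])
  define sh where "sh = (\<lambda>k s. s(r := s r + of_nat k :: complex))"
  \<comment> \<open>The last factor of the rising factorial of length k + 1 is s_r - 1 + k. That is
    the linear factor of \<open>Lambda\<close> at the point shifted by k, so it moves into
    \<open>H\<close> and a rising factorial of length k remains.\<close>
  define H' where "H' = (\<lambda>s. B s - (\<Sum>k=1..Suc j. pochhammer (s r - 1) k / fact (Suc k) * H (sh k s))
                       - w s * (\<Sum>m. a s m * taylor_rem (Suc (Suc j)) (s r) m))"
  have shH: "holomorphic_cspace r (\<lambda>s. H (sh k s)) D" if k: "k \<in> {1..Suc j}" for k
  proof (rule holomorphic_cspace_map[OF H(1) D])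
    show "continuous_on D (sh k)" unfolding sh_def
      by (intro continuous_on_fun_upd' continuous_intros continuous_on_coord)
    show "sh k ` D \<subseteq> rdom r R (x0 - real j)"
    proof safe
      fix s assume s: "s \<in> D"
      hence "Re (s r) > x0 - real (Suc j)" by (simp add: D_def rdom_def)
      thus "sh k s \<in> rdom r R (x0 - real j)"
        unfolding sh_def using s k by (intro rdom_fun_upd_last[of _ _ _ "x0 - real (Suc j)"] r) (auto simp: D_def)
    qed
    fix s i assume s: "s \<in> D" "i \<in> {1..r}"
    show "\<exists>k'\<in>{1..r}. \<exists>\<psi>. \<psi> holomorphic_on UNIV \<and> (\<forall>z. sh k (s(i := z)) = (sh k s)(k' := \<psi> z))"
    proof (cases "i = r")
      case True
      thus ?thesis using r
        by (intro bexI[of _ r] exI[of _ "\<lambda>z. z + of_nat k"]) (auto simp: sh_def intro!: holomorphic_intros)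
    next
      case False
      thus ?thesis using s(2)
        by (intro bexI[of _ i] exI[of _ "\<lambda>z. z"]) (auto simp: sh_def fun_upd_twist intro!: holomorphic_intros)
    qed
  qed
  have poch: "holomorphic_cspace r (\<lambda>s. pochhammer (s r - 1) k) D" for k
  proof (induction k)
    case (Suc k)
    thus ?case unfolding pochhammer_Suc
      by (intro holomorphic_cspace_mult holomorphic_cspace_add holomorphic_cspace_diff
            holomorphic_cspace_coord holomorphic_cspace_const D)
  qed (auto simp: D)
  have "holomorphic_cspace r H' D" unfolding H'_def
  proof (intro holomorphic_cspace_diff holomorphic_cspace_sum holomorphic_cspace_mult shH
      holomorphic_cspace_divide poch holomorphic_cspace_const D)
    show "holomorphic_cspace r B D" "holomorphic_cspace r w D"
      by (rule holomorphic_cspace_restrict[OF B_holo D], rule holomorphic_cspace_restrict[OF w_holo D])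
    show "holomorphic_cspace r (\<lambda>s. \<Sum>m. a s m * taylor_rem (Suc (Suc j)) (s r) m) D"
    proof (rule holomorphic_cspace_subset[OF remainder_holo _ D])
      show "D \<subseteq> rdom r R (c + 1 - real (Suc (Suc j)))"
        unfolding D_def by (rule rdom_mono) (use x0(1) in auto)
    qed
  qed (simp_all del: fact_Suc)
  moreover have "H' s = Lambda s" if s: "s \<in> rdom r R x0" for s
  proof -
    have sc: "s \<in> cspace r" and re: "Re (s r) > c + 2" using s x0(1) by (auto simp: rdom_def)
    have Hsh: "H (sh k s) = w s * (s r - 1 + of_nat k) * dirichlet (a s) (s r + of_nat k)" for k
    proof -
      have "sh k s \<in> rdom r R x0"
        unfolding sh_def by (rule rdom_fun_upd_last[OF s r]) (use s in \<open>auto simp: rdom_def\<close>)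
      hence "H (sh k s) = Lambda (sh k s)" by (rule H(2))
      thus ?thesis unfolding Lambda_def sh_def a_last w_shift[OF sc] by (simp add: algebra_simps)
    qed
    have e1: "(\<Sum>k=1..Suc j. pochhammer (s r - 1) k / fact (Suc k) * H (sh k s)) =
       w s * (\<Sum>k=1..Suc j. pochhammer (s r - 1) (Suc k) / fact (Suc k) * dirichlet (a s) (s r + of_nat k))"
      unfolding sum_distrib_left pochhammer_Suc Hsh
      by (intro sum.cong refl) (simp only: times_divide_eq_left times_divide_eq_right mult_ac)
    note e2 = dirichlet_shift[of "a s" c "s r" "Suc j", OF norm_coeff_le[OF s] re c]
    show ?thesis
      unfolding H'_def Lambda_def x0(2)[OF s] e1 mult.assoc[of "w s" "s r - 1"] e2
      by (simp only: right_diff_distrib)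
  qed
  ultimately show ?case unfolding D_def by blast
qed

end

lemma continuation_local:
  assumes "R \<ge> 0"
  shows "\<exists>H x. holomorphic_cspace r H (rdom r R y) \<and> (\<forall>s\<in>rdom r R x. H s = Lambda s)"
proof -
  obtain c where c: "c \<ge> 0" "\<And>s m. s \<in> cspace r \<Longrightarrow> (\<forall>k\<in>{1..<r}. Re (s k) > - R) \<Longrightarrow> norm (a s m) \<le> real (Suc m) powr c"
    using a_bound[OF assms] by blast
  obtain x where x: "\<And>s. s \<in> rdom r R x \<Longrightarrow> B s = w s * dirichlet (\<lambda>m. a s (Suc m) - a s m) (s r - 1)"
    using B_eq[OF assms] by blast
  define x0 where "x0 = max (c + 2) x"
  obtain j :: nat where j: "x0 - y \<le> real j"
    using real_arch_simple by blast
  have "rdom r R x0 \<subseteq> rdom r R x" by (rule rdom_mono) (auto simp: x0_def)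
  hence "\<exists>H. holomorphic_cspace r H (rdom r R (x0 - real j)) \<and> (\<forall>s\<in>rdom r R x0. H s = Lambda s)"
    using x by (intro continuation_step[OF c]) (auto simp: x0_def)
  then obtain H where H: "holomorphic_cspace r H (rdom r R (x0 - real j))" "\<forall>s\<in>rdom r R x0. H s = Lambda s"
    by blast
  have "holomorphic_cspace r H (rdom r R y)"
    by (rule holomorphic_cspace_subset[OF H(1) rdom_mono openin_rdom[OF r]]) (use j in auto)
  thus ?thesis using H(2) by blast
qed

text \<open>Local continuations exist on an increasing sequence of regions that exhausts the space.
  Two of them agree because along the last variable both equal \<open>Lambda\<close> far to the
  right, so the one-variable identity theorem suffices for gluing.\<close>

lemma continuation:
  "\<exists>H. holomorphic_cspace r H (cspace r) \<and> (\<forall>R\<ge>0. \<exists>x. \<forall>s\<in>rdom r R x. H s = Lambda s)"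
proof -
  define D where "D = (\<lambda>n::nat. rdom r (real n) (- real n))"
  have "\<exists>H x. holomorphic_cspace r H (D n) \<and> (\<forall>s\<in>rdom r (real n) x. H s = Lambda s)" for n
    unfolding D_def by (rule continuation_local) auto
  then obtain H X where H: "\<And>n. holomorphic_cspace r (H n) (D n)"
      "\<And>n s. s \<in> rdom r (real n) (X n) \<Longrightarrow> H n s = Lambda s"
    by metis
  have Dmono: "D n \<subseteq> D m" if "n \<le> m" for n m
    unfolding D_def using that by (intro rdom_mono) auto
  have eq: "H n s = H m s" if nm: "n \<le> m" and s: "s \<in> D n" for n m s
  proof -
    define y where "y = max (- real n) (max (X n) (X m))"
    have sc: "s \<in> cspace r" using s by (simp add: D_def rdom_def)
    have upd: "s(r := z) \<in> D n" "s(r := z) \<in> D m" if "Re z > - real n" for z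
      using rdom_fun_upd_last[OF s[unfolded D_def] r that] Dmono[OF nm] by (auto simp: D_def)
    have "H n (s(r := s r)) = H m (s(r := s r))"
    proof (rule analytic_continuation_open[where f = "\<lambda>z. H n (s(r := z))" and g = "\<lambda>z. H m (s(r := z))"
          and s = "{z. Re z > y}" and s' = "{z. Re z > - real n}"])
      show "{z. Re z > y} \<noteq> {}" by (auto intro!: exI[of _ "of_real (y + 1)"])
      show "connected {z. Re z > - real n}"
        by (intro convex_connected convex_halfspace_Re_gt)
      show "{z. Re z > y} \<subseteq> {z. Re z > - real n}" by (auto simp: y_def)
      show "(\<lambda>z. H n (s(r := z))) holomorphic_on {z. Re z > - real n}"
           "(\<lambda>z. H m (s(r := z))) holomorphic_on {z. Re z > - real n}"
        by (rule holomorphic_cspace_slice[OF H(1) sc], use r upd in auto)+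
      show "s r \<in> {z. Re z > - real n}" using s by (simp add: D_def rdom_def)
      fix z assume z: "z \<in> {z. Re z > y}"
      hence "s(r := z) \<in> rdom r (real n) (X n)" "s(r := z) \<in> rdom r (real n) (X m)"
        using rdom_fun_upd_last[OF s[unfolded D_def] r] by (auto simp: y_def)
      moreover have "rdom r (real n) (X m) \<subseteq> rdom r (real m) (X m)"
        using nm by (intro rdom_mono) auto
      ultimately show "H n (s(r := z)) = H m (s(r := z))" using H(2) by (metis subsetD)
    qed (auto intro: open_halfspace_Re_gt)
    thus ?thesis by simp
  qed
  have ex: "\<exists>n. s \<in> D n" if "s \<in> cspace r" for s
  proof -
    obtain n :: nat where n: "(\<Sum>k\<in>{1..r}. norm (s k)) < real n"
      using reals_Archimedean2 by blast
    have "Re (s k) > - real n" if "k \<in> {1..r}" for k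
    proof -
      have "norm (s k) \<le> (\<Sum>k\<in>{1..r}. norm (s k))"
        using that by (intro member_le_sum) auto
      thus ?thesis using n abs_Re_le_cmod[of "s k"] by linarith
    qed
    thus ?thesis using \<open>s \<in> cspace r\<close> r by (intro exI[of _ n]) (simp add: D_def rdom_def)
  qed
  define G where "G = (\<lambda>s. H (LEAST n. s \<in> D n) s)"
  have G: "G s = H n s" if "s \<in> D n" for s n
    unfolding G_def by (rule eq[OF Least_le[of "\<lambda>n. s \<in> D n"] LeastI[of "\<lambda>n. s \<in> D n"]]) (rule that)+
  have "holomorphic_cspace r G (cspace r)"
  proof (rule holomorphic_cspace_local)
    fix t assume "t \<in> cspace r"
    then obtain n where n: "t \<in> D n" using ex by blast
    have "holomorphic_cspace r G (D n)"
      by (rule holomorphic_cspace_cong[OF H(1)]) (use G in auto)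
    thus "\<exists>V. t \<in> V \<and> V \<subseteq> cspace r \<and> holomorphic_cspace r G V"
      using n by (intro exI[of _ "D n"]) (auto simp: D_def rdom_def)
  qed
  moreover have "\<exists>x. \<forall>s\<in>rdom r R x. G s = Lambda s" for R
  proof -
    obtain n :: nat where n: "R \<le> real n" using real_arch_simple by blast
    have "G s = Lambda s" if s: "s \<in> rdom r R (max (X n) (- real n))" for s
    proof -
      have "s \<in> D n" using s rdom_mono[OF n, of "- real n" "max (X n) (- real n)" r] by (auto simp: D_def)
      moreover have "s \<in> rdom r (real n) (X n)" using s rdom_mono[OF n, of "X n" "max (X n) (- real n)" r] by auto
      ultimately show ?thesis using G H(2) by simp
    qed
    thus ?thesis by blast
  qed
  ultimately show ?thesis by blast
qed

end

text \<open>The truncated sum of M_1^(-s_1) ... M_k^(-s_k) over 1 \<le> M_1 < ... < M_k < n. The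
  strict inequalities express that the increments m_i are positive, and the value is the coefficient
  belonging to M_(k+1) = n.\<close>

primrec EZ_partial :: "(nat \<Rightarrow> complex) \<Rightarrow> nat \<Rightarrow> nat \<Rightarrow> complex" where
  "EZ_partial s 0 n = 1"
| "EZ_partial s (Suc k) n = (\<Sum>m=1..<n. EZ_partial s k m * of_nat m powr (- s (Suc k)))"

definition EZ_sum :: "nat \<Rightarrow> (nat \<Rightarrow> complex) \<Rightarrow> complex" where
  "EZ_sum r s = dirichlet (\<lambda>m. EZ_partial s (r - 1) (Suc m)) (s r)"

lemma EZ_partial_cong: "(\<And>i. i \<in> {1..k} \<Longrightarrow> s i = t i) \<Longrightarrow> EZ_partial s k n = EZ_partial t k n"
  by (induction k arbitrary: n) auto

text \<open>Each of the \<open>k\<close> summations costs at most one power of n for its length and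
  \<open>R\<close> powers for its summand.\<close>

lemma EZ_partial_bound:
  assumes "R \<ge> 0" "\<And>i. i \<in> {1..k} \<Longrightarrow> Re (s i) > - R" "n \<ge> 1"
  shows "norm (EZ_partial s k n) \<le> real n powr (real k * (R + 1))"
  using assms(2,3)
proof (induction k arbitrary: n)
  case (Suc k)
  define E where "E = real k * (R + 1) + R"
  have E0: "E \<ge> 0" using assms(1) by (simp add: E_def)
  have Rk: "- Re (s (Suc k)) \<le> R" using Suc.prems(1)[of "Suc k"] by simp
  have "norm (EZ_partial s k m * of_nat m powr (- s (Suc k))) \<le> real n powr E" if m: "m \<in> {1..<n}" for m
  proof -
    have "norm (EZ_partial s k m * of_nat m powr (- s (Suc k))) \<le> real m powr (real k * (R + 1)) * real m powr R"
      unfolding norm_mult norm_nat_powr uminus_complex.sel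
      by (intro mult_mono Suc.IH powr_mono) (use Rk Suc.prems(1) m in auto)
    also have "\<dots> = real m powr E" by (simp add: E_def powr_add)
    also have "\<dots> \<le> real n powr E" using m E0 by (intro powr_mono2) auto
    finally show ?thesis .
  qed
  hence "norm (EZ_partial s (Suc k) n) \<le> (\<Sum>m=1..<n. real n powr E)"
    unfolding EZ_partial.simps by (rule sum_norm_le)
  also have "\<dots> \<le> real n * real n powr E"
    by (auto intro!: mult_right_mono)
  also have "\<dots> = real n powr (real (Suc k) * (R + 1))"
  proof -
    have "real n * real n powr E = real n powr (1 + E)"
      using Suc.prems(2) by (simp add: powr_add)
    also have "1 + E = real (Suc k) * (R + 1)" by (simp add: E_def algebra_simps)
    finally show ?thesis .
  qed
  finally show ?case .
qed simp

lemma EZ_partial_holo: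
  "openin (top_of_set (cspace r)) U \<Longrightarrow> holomorphic_cspace r (\<lambda>s. EZ_partial s k n) U"
proof (induction k arbitrary: n)
  case (Suc k)
  thus ?case unfolding EZ_partial.simps
    by (intro holomorphic_cspace_sum holomorphic_cspace_mult holomorphic_cspace_nat_powr Suc)
qed simp

section \<open>Periodic factors that cancel the polar hyperplanes\<close>

definition per :: "complex \<Rightarrow> complex" where
  "per w = exp (2 * of_real pi * \<i> * w) - 1"

lemma per_add_int: "per (w + of_int n) = per w"
proof -
  have "exp (2 * of_real pi * \<i> * (w + of_int n)) = exp (2 * of_real pi * \<i> * w) * exp (2 * of_real pi * \<i> * of_int n)"
    by (simp add: exp_add ring_distribs)
  also have "exp (2 * of_real pi * \<i> * of_int n :: complex) = 1"
    by (auto simp: exp_eq_1)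
  finally show ?thesis by (simp add: per_def)
qed

lemma per_eq_0_iff: "per w = 0 \<longleftrightarrow> w \<in> \<int>"
proof
  assume "per w = 0"
  hence "exp (2 * of_real pi * \<i> * w) = 1" by (simp add: per_def)
  then obtain n :: int where n: "Im w = 0" "2 * pi * Re w = of_int (2 * n) * pi"
    by (auto simp: exp_eq_1)
  hence "Re w = of_int n" by simp
  hence "w = of_int n" using n(1) by (auto simp: complex_eq_iff)
  thus "w \<in> \<int>" by simp
next
  assume "w \<in> \<int>"
  then obtain n where "w = of_int n" by (auto elim: Ints_cases)
  thus "per w = 0" using per_add_int[of 0 n] by (simp add: per_def)
qed

lemma per_holomorphic: "per holomorphic_on A"
  unfolding per_def by (intro holomorphic_intros)

text \<open>The quotient of \<open>per\<close> by u has a removable singularity at 0. It splits off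
  the linear factor that meets the denominator of the previous stage.\<close>

lemma per_factor: "\<exists>\<phi>. \<phi> holomorphic_on UNIV \<and> (\<forall>u. per u = u * \<phi> u)"
proof -
  have "(\<lambda>z. if z = 0 then deriv per 0 else per z / z - per 0 / (z - 0)) holomorphic_on UNIV"
    by (rule pole_theorem[OF per_holomorphic]) auto
  moreover have "per 0 = 0" by (simp add: per_eq_0_iff)
  ultimately show ?thesis by (intro exI conjI) auto
qed

text \<open>The index k = r is left out because the linear factor \<open>s r - 1\<close> plays its
  part.\<close>

definition per_prod :: "nat \<Rightarrow> (nat \<Rightarrow> complex) \<Rightarrow> complex" where
  "per_prod r s = (\<Prod>k=1..<r. per (\<Sum>j=k..r. s j))"

lemma per_prod_holo: "openin (top_of_set (cspace r)) U \<Longrightarrow> holomorphic_cspace r (per_prod q) U"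
  unfolding per_prod_def
  by (intro holomorphic_cspace_prod holomorphic_cspace_compose[where h = per and A = UNIV]
      holomorphic_cspace_sum holomorphic_cspace_coord per_holomorphic) auto

lemma per_prod_shift: "per_prod r (s(r := s r + of_nat n)) = per_prod r s"
  unfolding per_prod_def
proof (rule prod.cong)
  fix k assume k: "k \<in> {1..<r}"
  have eq: "{k..r} = insert r {k..<r}" using k by auto
  have "(\<Sum>j=k..r. (s(r := s r + of_nat n)) j) = (\<Sum>j=k..r. s j) + of_int (int n)"
    unfolding eq by (simp add: algebra_simps)
  thus "per (\<Sum>j=k..r. (s(r := s r + of_nat n)) j) = per (\<Sum>j=k..r. s j)"
    by (simp only: per_add_int)
qed simp

text \<open>
  The differences of the coefficients for \<open>r\<close> give the series for \<open>r - 1\<close> at the point whose last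
  coordinate is \<open>s\<^bsub>r-1\<^esub> + s\<^sub>r - 1\<close>.
\<close>

lemma EZ_continuation:
  "\<exists>H. holomorphic_cspace (Suc q) H (cspace (Suc q)) \<and> (\<forall>R\<ge>0. \<exists>x. \<forall>s\<in>rdom (Suc q) R x.
      H s = per_prod (Suc q) s * (s (Suc q) - 1) * EZ_sum (Suc q) s)"
proof (induction q)
  case 0
  \<comment> \<open>In dimension 1 the coefficients are constant, so their differences, and with
    them \<open>B\<close>, are 0.\<close>
  interpret dirichlet_family "Suc 0" "\<lambda>s m. 1" "\<lambda>_. 1" "\<lambda>_. 0"
    by unfold_locales (auto simp: dirichlet_def intro!: exI[of _ "0::real"])
  show ?case using continuation by (simp add: Lambda_def EZ_sum_def per_prod_def)
next
  case (Suc q)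
  define r where "r = Suc (Suc q)"
  obtain H where H: "holomorphic_cspace (Suc q) H (cspace (Suc q))"
      "\<And>R. R \<ge> 0 \<Longrightarrow> \<exists>x. \<forall>s\<in>rdom (Suc q) R x. H s = per_prod (Suc q) s * (s (Suc q) - 1) * EZ_sum (Suc q) s"
    using Suc by blast
  obtain \<phi> where \<phi>: "\<phi> holomorphic_on UNIV" "\<And>u. per u = u * \<phi> u"
    using per_factor by blast
  define T where "T = (\<lambda>s::nat\<Rightarrow>complex. \<lambda>i\<in>{1..Suc q}. if i = Suc q then s (Suc q) + s r - 1 else s i)"
  \<comment> \<open>Let u = s_(r-1) + s_r. The hypothesis at \<open>T s\<close> contributes the
    factor u - 2, and by periodicity \<open>per u\<close> equals (u - 2)
    \<open>\<phi> (u - 2)\<close>; so \<open>\<phi> (u - 2)\<close> is what is missing for the full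
    new factor.\<close>
  define B where "B = (\<lambda>s. \<phi> (s (Suc q) + s r - 2) * H (T s))"
  have Tc: "T s \<in> cspace (Suc q)" for s by (auto simp: T_def cspace_def)
  interpret dirichlet_family r "\<lambda>s m. EZ_partial s (Suc q) (Suc m)" "per_prod r" B
  proof
    show "r \<ge> 1" by (simp add: r_def)
    show "holomorphic_cspace r (\<lambda>s. EZ_partial s (Suc q) (Suc m)) (cspace r)" for m
      by (rule EZ_partial_holo) simp
    show "EZ_partial (s(r := z)) (Suc q) (Suc m) = EZ_partial s (Suc q) (Suc m)" for s z m
      by (rule EZ_partial_cong) (auto simp: r_def)
    show "\<exists>c\<ge>0. \<forall>s\<in>cspace r. (\<forall>k\<in>{1..<r}. - R < Re (s k)) \<longrightarrow>
             (\<forall>m. norm (EZ_partial s (Suc q) (Suc m)) \<le> real (Suc m) powr c)" if R: "R \<ge> 0" for R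
    proof (intro exI conjI ballI impI allI)
      show "real (Suc q) * (R + 1) \<ge> 0" using R by simp
      fix s m assume "s \<in> cspace r" "\<forall>k\<in>{1..<r}. - R < Re (s k)"
      thus "norm (EZ_partial s (Suc q) (Suc m)) \<le> real (Suc m) powr (real (Suc q) * (R + 1))"
        by (intro EZ_partial_bound R) (auto simp: r_def)
    qed
    show "holomorphic_cspace r (per_prod r) (cspace r)" by (rule per_prod_holo) simp
    show "per_prod r (s(r := s r + of_nat n)) = per_prod r s" for s n by (rule per_prod_shift)
    show "holomorphic_cspace r B (cspace r)"
      unfolding B_def
    proof (rule holomorphic_cspace_mult)
      show "holomorphic_cspace r (\<lambda>s. \<phi> (s (Suc q) + s r - 2)) (cspace r)"
        by (rule holomorphic_cspace_compose[OF _ \<phi>(1)])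
           (auto intro!: holomorphic_cspace_diff holomorphic_cspace_add holomorphic_cspace_coord)
      show "holomorphic_cspace r (\<lambda>s. H (T s)) (cspace r)"
      proof (rule holomorphic_cspace_map[OF H(1)])
        show "continuous_on (cspace r) T"
        proof (rule continuous_on_coordinatewise_then_product)
          fix i
          show "continuous_on (cspace r) (\<lambda>s. T s i)"
          proof (cases "i \<in> {1..Suc q}")
            case True
            thus ?thesis
              by (cases "i = Suc q") (simp_all add: T_def continuous_on_coord continuous_on_add continuous_on_diff)
          next
            case False
            hence "T s i = undefined" for s unfolding T_def restrict_def by (simp only: if_False)
            thus ?thesis by simp
          qed
        qed
        show "T ` cspace r \<subseteq> cspace (Suc q)" using Tc by blast
        fix s k assume k: "k \<in> {1..r}"
        show "\<exists>k'\<in>{1..Suc q}. \<exists>\<psi>. \<psi> holomorphic_on UNIV \<and> (\<forall>z. T (s(k := z)) = (T s)(k' := \<psi> z))"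
        proof (cases "k \<le> q")
          case True
          thus ?thesis using k
            by (intro bexI[of _ k] exI[of _ "\<lambda>z. z"]) (auto simp: T_def fun_eq_iff r_def intro!: holomorphic_intros)
        next
          case False
          hence "k = Suc q \<or> k = r" using k by (auto simp: r_def)
          thus ?thesis
          proof
            assume "k = Suc q"
            thus ?thesis
              by (intro bexI[of _ "Suc q"] exI[of _ "\<lambda>z. z + s r - 1"])
                 (auto simp: T_def fun_eq_iff r_def intro!: holomorphic_intros)
          next
            assume "k = r"
            thus ?thesis
              by (intro bexI[of _ "Suc q"] exI[of _ "\<lambda>z. s (Suc q) + z - 1"])
                 (auto simp: T_def fun_eq_iff r_def intro!: holomorphic_intros)
          qed
        qed
      qed simp
    qed
    show "\<exists>x. \<forall>s\<in>rdom r R x. B s = per_prod r s *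
            dirichlet (\<lambda>m. EZ_partial s (Suc q) (Suc (Suc m)) - EZ_partial s (Suc q) (Suc m)) (s r - 1)"
      if R: "R \<ge> 0" for R
    proof -
      obtain x where x: "\<And>s. s \<in> rdom (Suc q) R x \<Longrightarrow> H s = per_prod (Suc q) s * (s (Suc q) - 1) * EZ_sum (Suc q) s"
        using H(2)[OF R] by blast
      \<comment> \<open>The bound on the last variable is chosen so that s_(r-1) + s_r - 1 has real
        part above \<open>x\<close> although s_(r-1) may have real part close to
        \<open>- R\<close>.\<close>
      have "B s = per_prod r s *
            dirichlet (\<lambda>m. EZ_partial s (Suc q) (Suc (Suc m)) - EZ_partial s (Suc q) (Suc m)) (s r - 1)"
        if s: "s \<in> rdom r R (x + R + 1)" for s
      proof -
        define u where "u = s (Suc q) + s r"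
        have Ts: "T s \<in> rdom (Suc q) R x"
        proof -
          have "- R < Re (s (Suc q))" "x + R + 1 < Re (s r)" "\<forall>k\<in>{1..q}. - R < Re (s k)"
            using s by (auto simp: rdom_def r_def)
          thus ?thesis using Tc[of s] by (auto simp: rdom_def T_def)
        qed
        have d: "dirichlet (\<lambda>m. EZ_partial s (Suc q) (Suc (Suc m)) - EZ_partial s (Suc q) (Suc m)) (s r - 1) = EZ_sum (Suc q) (T s)"
        proof -
          have 1: "EZ_partial (T s) q n = EZ_partial s q n" for n
            by (rule EZ_partial_cong) (auto simp: T_def)
          have 2: "- s (Suc q) + - (s r - 1) = - T s (Suc q)" by (simp add: T_def)
          have 3: "EZ_partial s (Suc q) (Suc (Suc m)) - EZ_partial s (Suc q) (Suc m) =
                     EZ_partial s q (Suc m) * of_nat (Suc m) powr (- s (Suc q))" for m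
          proof -
            have "{1..<Suc (Suc m)} = insert (Suc m) {1..<Suc m}" by auto
            thus ?thesis by (simp del: of_nat_Suc)
          qed
          show ?thesis
            unfolding EZ_sum_def dirichlet_def 3 diff_Suc_1 1 mult.assoc powr_add[symmetric] 2 ..
        qed
        have p1: "per_prod r s = per_prod (Suc q) (T s) * per u"
        proof -
          have "{1..<r} = insert (Suc q) {1..<Suc q}" "{Suc q..r} = {Suc q, r}" by (auto simp: r_def)
          hence "per_prod r s = (\<Prod>k=1..<Suc q. per (\<Sum>j=k..r. s j)) * per u"
            by (simp add: per_prod_def u_def r_def mult.commute)
          also have "(\<Prod>k=1..<Suc q. per (\<Sum>j=k..r. s j)) = per_prod (Suc q) (T s)"
            unfolding per_prod_def
          proof (rule prod.cong)
            fix k assume k: "k \<in> {1..<Suc q}"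
            have e: "{k..r} = insert r (insert (Suc q) {k..q})" "{k..Suc q} = insert (Suc q) {k..q}"
              using k by (auto simp: r_def)
            have "(\<Sum>j=k..q. T s j) = (\<Sum>j=k..q. s j)"
              by (intro sum.cong) (use k in \<open>auto simp: T_def\<close>)
            \<comment> \<open>The 1 subtracted in the merged coordinate is an integer shift, which
              \<open>per\<close> does not see.\<close>
            hence "(\<Sum>j=k..r. s j) = (\<Sum>j=k..Suc q. T s j) + of_int 1"
              unfolding e by (simp add: r_def, simp add: T_def r_def algebra_simps)
            thus "per (\<Sum>j=k..r. s j) = per (\<Sum>j=k..Suc q. T s j)" by (simp only: per_add_int)
          qed simp
          finally show ?thesis .
        qed
        have p2: "per u = (u - 2) * \<phi> (u - 2)"
          using per_add_int[of "u - 2" 2] \<phi>(2)[of "u - 2"] by simp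
        have "B s = \<phi> (u - 2) * (per_prod (Suc q) (T s) * (T s (Suc q) - 1) * EZ_sum (Suc q) (T s))"
          by (simp add: B_def x[OF Ts] u_def)
        also have "T s (Suc q) - 1 = u - 2" by (simp add: T_def u_def)
        finally show ?thesis unfolding d p1 p2 by (simp only: mult_ac)
      qed
      thus ?thesis by blast
    qed
  qed
  have "Lambda s = per_prod r s * (s r - 1) * EZ_sum r s" for s
    unfolding Lambda_def EZ_sum_def by (simp only: r_def diff_Suc_1)
  thus ?case using continuation unfolding r_def by simp
qed

section \<open>Summation over tuples\<close>

definition tuples_of_sum :: "nat \<Rightarrow> nat \<Rightarrow> (nat \<Rightarrow> nat) set" where
  "tuples_of_sum r n = {m\<in>pos_tuples r. (\<Sum>i=1..r. m i) = n}"

lemma finite_tuples_of_sum: "finite (tuples_of_sum r n)"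
proof (rule finite_subset)
  show "tuples_of_sum r n \<subseteq> ({1..r} \<rightarrow>\<^sub>E {..n})"
  proof
    fix m assume m: "m \<in> tuples_of_sum r n"
    have "m i \<le> n" if "i \<in> {1..r}" for i
      using m member_le_sum[of i "{1..r}" m] that by (auto simp: tuples_of_sum_def)
    thus "m \<in> ({1..r} \<rightarrow>\<^sub>E {..n})"
      using m by (auto simp: tuples_of_sum_def pos_tuples_def PiE_def Pi_def)
  qed
qed (auto intro: finite_PiE)

lemma EZ_term_Suc:
  assumes "\<And>i. i \<in> {1..q} \<Longrightarrow> m' i = m i"
  shows "EZ_term (Suc q) s m = EZ_term q s m' * of_nat (\<Sum>i=1..Suc q. m i) powr (- s (Suc q))"
proof -
  have "EZ_term q s m' = EZ_term q s m"
    unfolding EZ_term_def by (intro prod.cong refl) (use assms in \<open>auto intro!: arg_cong2[of _ _ _ _ "(powr)"] sum.cong\<close>)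
  thus ?thesis by (simp add: EZ_term_def)
qed

text \<open>Splitting off the last entry: if the other entries have sum k, with 1 \<le> k < n, then
  the last one is n - k. This turns a sum over tuples into the recursion of
  \<open>EZ_partial\<close>.\<close>

lemma sum_EZ_term:
  assumes "n \<ge> 1"
  shows "(\<Sum>m\<in>tuples_of_sum (Suc q) n. EZ_term (Suc q) s m) = EZ_partial s q n * of_nat n powr (- s (Suc q))"
  using assms
proof (induction q arbitrary: n)
  case 0
  have "tuples_of_sum (Suc 0) n = {\<lambda>i\<in>{1}. n}"
    using 0 by (auto simp: tuples_of_sum_def pos_tuples_def PiE_def extensional_def fun_eq_iff)
  thus ?case by (simp add: EZ_term_def)
next
  case (Suc q)
  let ?S = "Sigma {1..<n} (tuples_of_sum (Suc q))"
  have "(\<Sum>m\<in>tuples_of_sum (Suc (Suc q)) n. EZ_term (Suc (Suc q)) s m) =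
        (\<Sum>(k, m)\<in>?S. EZ_term (Suc q) s m * of_nat n powr (- s (Suc (Suc q))))"
  proof (rule sum.reindex_bij_witness[of _ "\<lambda>(k, m). m(Suc (Suc q) := n - k)"
        "\<lambda>m. (\<Sum>i=1..Suc q. m i, restrict m {1..Suc q})"])
    fix m assume m: "m \<in> tuples_of_sum (Suc (Suc q)) n"
    hence ext: "m i = undefined" if "i \<notin> {1..Suc (Suc q)}" for i
      using that by (auto simp: tuples_of_sum_def pos_tuples_def PiE_def extensional_def)
    have pos: "m i \<ge> 1" if "i \<in> {1..Suc (Suc q)}" for i
      using m that by (auto simp: tuples_of_sum_def pos_tuples_def PiE_def Pi_def)
    have n: "n = (\<Sum>i=1..Suc q. m i) + m (Suc (Suc q))"
      using m by (simp add: tuples_of_sum_def)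
    have "(restrict m {1..Suc q})(Suc (Suc q) := n - (\<Sum>i=1..Suc q. m i)) = m"
    proof
      fix i show "((restrict m {1..Suc q})(Suc (Suc q) := n - (\<Sum>i=1..Suc q. m i))) i = m i"
        using ext[of i] n by auto
    qed
    thus "(case (\<Sum>i=1..Suc q. m i, restrict m {1..Suc q}) of (k, m) \<Rightarrow> m(Suc (Suc q) := n - k)) = m"
      by simp
    have p0: "0 < m (Suc (Suc q))" using pos[of "Suc (Suc q)"] by simp
    have "(\<Sum>i=1..Suc q. m i) \<ge> (\<Sum>i=1..Suc q. 1)"
      by (intro sum_mono pos) auto
    thus "(\<Sum>i=1..Suc q. m i, restrict m {1..Suc q}) \<in> ?S"
      using pos p0 n by (auto simp: tuples_of_sum_def pos_tuples_def)
    have "EZ_term (Suc (Suc q)) s m = EZ_term (Suc q) s (restrict m {1..Suc q}) * of_nat (\<Sum>i=1..Suc (Suc q). m i) powr (- s (Suc (Suc q)))"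
      by (rule EZ_term_Suc) auto
    also have "(\<Sum>i=1..Suc (Suc q). m i) = n" using m by (simp add: tuples_of_sum_def)
    finally show "(case (\<Sum>i=1..Suc q. m i, restrict m {1..Suc q}) of (k, m) \<Rightarrow> EZ_term (Suc q) s m * of_nat n powr (- s (Suc (Suc q)))) = EZ_term (Suc (Suc q)) s m"
      by (simp only: prod.case)
  next
    fix x assume x: "x \<in> ?S"
    obtain k m where km: "x = (k, m)" by (cases x)
    have k: "1 \<le> k" "k < n" and m: "m \<in> pos_tuples (Suc q)" "(\<Sum>i=1..Suc q. m i) = k"
      using x by (auto simp: km tuples_of_sum_def)
    have s: "(\<Sum>i=1..Suc q. (m(Suc (Suc q) := n - k)) i) = k"
      unfolding m(2)[symmetric] by (intro sum.cong) auto
    have r: "restrict (m(Suc (Suc q) := n - k)) {1..Suc q} = m"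
      using m(1) by (auto simp: fun_eq_iff pos_tuples_def PiE_def extensional_def)
    show "(\<Sum>i=1..Suc q. (case x of (k, m) \<Rightarrow> m(Suc (Suc q) := n - k)) i,
           restrict (case x of (k, m) \<Rightarrow> m(Suc (Suc q) := n - k)) {1..Suc q}) = x"
      using s r by (simp add: km)
    have "(\<Sum>i=1..Suc (Suc q). (m(Suc (Suc q) := n - k)) i) = n"
      using s k by simp
    moreover have "m(Suc (Suc q) := n - k) \<in> pos_tuples (Suc (Suc q))"
      using m(1) k by (auto simp: pos_tuples_def PiE_def Pi_def extensional_def)
    ultimately show "(case x of (k, m) \<Rightarrow> m(Suc (Suc q) := n - k)) \<in> tuples_of_sum (Suc (Suc q)) n"
      by (simp add: km tuples_of_sum_def)
  qed
  also have "\<dots> = (\<Sum>k=1..<n. \<Sum>m\<in>tuples_of_sum (Suc q) k. EZ_term (Suc q) s m * of_nat n powr (- s (Suc (Suc q))))"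
    by (rule sum.Sigma[symmetric]) (auto simp: finite_tuples_of_sum)
  also have "\<dots> = EZ_partial s (Suc q) n * of_nat n powr (- s (Suc (Suc q)))"
    using Suc.IH by (simp flip: sum_distrib_right)
  finally show ?case .
qed

text \<open>Reduces absolute convergence to the same summation formulas at the real point with the
  same real parts.\<close>

lemma norm_EZ_term: "of_real (norm (EZ_term r s m)) = EZ_term r (\<lambda>i. of_real (Re (s i))) m"
  unfolding EZ_term_def prod_norm[symmetric] of_real_prod
  by (intro prod.cong refl) (simp only: norm_nat_powr uminus_complex.sel powr_of_real[symmetric] of_nat_0_le_iff of_real_of_nat_eq of_real_minus)

lemma EZ_coeff_bound:
  assumes "R \<ge> 0" "\<And>i. i \<in> {1..q} \<Longrightarrow> Re (s i) > - R"
  shows "norm (EZ_partial s q (Suc m)) \<le> real (Suc m) powr (real q * (R + 1))"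
  by (rule EZ_partial_bound) (use assms in auto)

text \<open>The tuples are grouped by their total, which makes each group finite. Absolute
  summability over the groups is known from the Dirichlet series at the real parts, so the grouped
  sum equals the unordered one.\<close>

lemma EZ_has_sum:
  assumes R: "R \<ge> 0" "\<And>i. i \<in> {1..q} \<Longrightarrow> Re (s i) > - R" and last: "Re (s (Suc q)) > real q * (R + 1) + 1"
  shows "(EZ_term (Suc q) s has_sum EZ_sum (Suc q) s) (pos_tuples (Suc q))"
proof -
  let ?r = "Suc q"
  define F where "F = (\<lambda>m. tuples_of_sum ?r (Suc m))"
  let ?S = "Sigma UNIV F"
  have sm: "summable (\<lambda>m. norm (EZ_partial s q (Suc m) * of_nat (Suc m) powr (- s ?r)))"
    if "\<And>i. i \<in> {1..q} \<Longrightarrow> Re (s i) > - R" "Re (s ?r) > real q * (R + 1) + 1" for s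
    by (rule dirichlet_norm_summable[OF EZ_coeff_bound]) (use R that in auto)
  define g where "g = (\<lambda>m. \<Sum>t\<in>F m. norm (EZ_term ?r s t))"
  define s' where "s' = (\<lambda>i. complex_of_real (Re (s i)))"
  have g: "g m = norm (EZ_partial s' q (Suc m) * of_nat (Suc m) powr (- s' ?r))" for m
  proof -
    have "complex_of_real (g m) = EZ_partial s' q (Suc m) * of_nat (Suc m) powr (- s' ?r)"
      unfolding g_def F_def of_real_sum norm_EZ_term s'_def[symmetric] by (rule sum_EZ_term) simp
    moreover have "g m \<ge> 0" by (auto simp: g_def intro: sum_nonneg)
    ultimately show ?thesis by (metis abs_of_nonneg norm_of_real)
  qed
  have "summable g"
    unfolding g by (rule sm) (use assms in \<open>auto simp: s'_def\<close>)
  hence gs: "g summable_on UNIV"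
  proof (intro norm_summable_imp_summable_on)
    have "norm (g m) = g m" for m by (simp add: g)
    thus "summable g \<Longrightarrow> summable (\<lambda>m. norm (g m))" by presburger
  qed
  have "(\<lambda>x. norm (EZ_term ?r s (snd x))) summable_on ?S"
  proof (rule summable_on_SigmaI[OF _ gs])
    show "((\<lambda>t. norm (EZ_term ?r s (snd (m, t)))) has_sum g m) (F m)" for m
      unfolding g_def by (auto simp: F_def intro!: has_sum_finite finite_tuples_of_sum)
  qed auto
  hence "(\<lambda>x. EZ_term ?r s (snd x)) summable_on ?S"
    by (rule abs_summable_summable)
  hence "((\<lambda>x. EZ_term ?r s (snd x)) has_sum EZ_sum ?r s) ?S"
  proof (rule has_sum_SigmaI[rotated 2])
    show "((\<lambda>m. \<Sum>t\<in>F m. EZ_term ?r s t) has_sum EZ_sum ?r s) UNIV"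
    proof -
      have "((\<lambda>m. EZ_partial s q (Suc m) * of_nat (Suc m) powr (- s ?r)) has_sum EZ_sum ?r s) UNIV"
      proof (rule norm_summable_imp_has_sum)
        show "summable (\<lambda>m. norm (EZ_partial s q (Suc m) * of_nat (Suc m) powr (- s ?r)))"
          by (rule sm) (use assms in auto)
        show "(\<lambda>m. EZ_partial s q (Suc m) * of_nat (Suc m) powr (- s ?r)) sums EZ_sum ?r s"
          unfolding EZ_sum_def diff_Suc_1 by (rule dirichlet_sums[OF EZ_coeff_bound]) (use assms in auto)
      qed
      thus ?thesis unfolding F_def by (subst sum_EZ_term) auto
    qed
    show "((\<lambda>t. EZ_term ?r s (snd (m, t))) has_sum (\<Sum>t\<in>F m. EZ_term ?r s t)) (F m)" for m
      by (auto simp: F_def intro!: has_sum_finite finite_tuples_of_sum)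
  qed
  moreover have "bij_betw snd ?S (pos_tuples ?r)"
  proof (rule bij_betwI[where g = "\<lambda>t. ((\<Sum>i=1..?r. t i) - 1, t)"])
    show "snd \<in> ?S \<rightarrow> pos_tuples ?r" by (auto simp: F_def tuples_of_sum_def)
    show "(\<lambda>t. ((\<Sum>i=1..?r. t i) - 1, t)) \<in> pos_tuples ?r \<rightarrow> ?S"
    proof
      fix t assume t: "t \<in> pos_tuples ?r"
      have "t ?r \<ge> 1" using t by (auto simp: pos_tuples_def PiE_def Pi_def)
      thus "((\<Sum>i=1..?r. t i) - 1, t) \<in> ?S"
        using t by (auto simp: F_def tuples_of_sum_def)
    qed
    show "((\<Sum>i=1..?r. snd x i) - 1, snd x) = x" if "x \<in> ?S" for x
      using that by (auto simp: F_def tuples_of_sum_def)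
  qed auto
  ultimately show ?thesis
    using has_sum_reindex_bij_betw[of snd ?S "pos_tuples ?r" "EZ_term ?r s"] by blast
qed

section \<open>Meromorphic functions of several variables\<close>

text \<open>As a subset of all functions, the space is a product of planes and of one-point
  sets.\<close>

lemma connected_cspace: "connected (cspace r)"
proof -
  have "cspace r = (\<Pi>\<^sub>E i\<in>UNIV. if i \<in> {1..r} then UNIV else {undefined})"
    by (auto simp: cspace_def PiE_def Pi_def extensional_def split: if_splits)
  moreover have "connectedin (product_topology (\<lambda>_. euclidean) UNIV)
      (\<Pi>\<^sub>E i\<in>UNIV. if i \<in> {1..r} then (UNIV :: complex set) else {undefined})"
    by (subst connectedin_PiE) auto
  ultimately show ?thesis
    by (simp only: euclidean_product_topology connectedin_iff_connected)
qed

text \<open>The closures in the definitions are taken in the whole function type. This lemma and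
  \<open>denseI\<close> translate density into meeting every nonempty relatively open
  subset.\<close>

lemma dense_meets:
  assumes "U \<subseteq> closure K" "K \<subseteq> cspace r" "openin (top_of_set (cspace r)) W" "W \<subseteq> U" "W \<noteq> {}"
  shows "W \<inter> K \<noteq> {}"
proof -
  obtain T where T: "open T" "W = cspace r \<inter> T"
    using assms(3) by (auto simp: openin_open)
  obtain x where "x \<in> W" using assms(5) by blast
  hence "x \<in> closure K" "x \<in> T" using assms T by auto
  hence "T \<inter> K \<noteq> {}" using T(1) by (metis disjoint_iff open_Int_closure_eq_empty)
  thus ?thesis using T assms(2) by auto
qed

lemma denseI:
  assumes "openin (top_of_set (cspace r)) U"
    and "\<And>W. openin (top_of_set (cspace r)) W \<Longrightarrow> W \<subseteq> U \<Longrightarrow> W \<noteq> {} \<Longrightarrow> W \<inter> K \<noteq> {}"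
  shows "U \<subseteq> closure K"
proof
  fix x assume x: "x \<in> U"
  show "x \<in> closure K"
  proof (rule ccontr)
    assume nx: "x \<notin> closure K"
    have "openin (top_of_set (cspace r)) (U \<inter> (- closure K))"
      using assms(1) by (intro openin_Int_open) auto
    from assms(2)[OF this] x nx show False using closure_subset by blast
  qed
qed

lemma openin_nonzero:
  assumes "holomorphic_cspace r f U"
  shows "openin (top_of_set (cspace r)) {s\<in>U. f s \<noteq> 0}"
proof -
  have "openin (top_of_set U) (U \<inter> f -` (- {0}))"
    by (rule continuous_openin_preimage_gen) (use holomorphic_cspace_continuous_on[OF assms] in auto)
  hence "openin (top_of_set (cspace r)) (U \<inter> f -` (- {0}))"
    using holomorphic_cspace_openin[OF assms] openin_trans by blast
  also have "U \<inter> f -` (- {0}) = {s\<in>U. f s \<noteq> 0}" by auto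
  finally show ?thesis .
qed

lemma vanish_dense:
  assumes f: "holomorphic_cspace r f U" and K: "U \<subseteq> closure K" "K \<subseteq> U" "\<And>s. s \<in> K \<Longrightarrow> f s = 0" and s: "s \<in> U"
  shows "f s = 0"
proof (rule ccontr)
  assume "f s \<noteq> 0"
  have "U \<subseteq> cspace r" using holomorphic_cspace_openin[OF f] by (rule openin_imp_subset)
  hence "{s\<in>U. f s \<noteq> 0} \<inter> K \<noteq> {}"
    by (intro dense_meets[OF K(1) _ openin_nonzero[OF f]]) (use K \<open>f s \<noteq> 0\<close> s in auto)
  thus False using K(3) by auto
qed

context
  fixes r :: nat and H g :: "(nat \<Rightarrow> complex) \<Rightarrow> complex" and p :: "nat \<Rightarrow> complex"
  assumes H: "holomorphic_cspace r H (cspace r)" and g: "holomorphic_cspace r g (cspace r)"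
    and p: "p \<in> cspace r" "g p \<noteq> 0"
begin

text \<open>A zero set with interior would, by the identity theorem on the whole space, force
  \<open>g\<close> to vanish at \<open>p\<close> as well.\<close>

lemma nonzero_meets_openin:
  assumes "openin (top_of_set (cspace r)) W" "W \<noteq> {}"
  shows "\<exists>s\<in>W. g s \<noteq> 0"
proof (rule ccontr)
  assume z: "\<not> (\<exists>s\<in>W. g s \<noteq> 0)"
  obtain w where w: "w \<in> W" using assms by blast
  have "g p = 0"
    by (rule identity_theorem_cspace[where P = "cspace r" and V = "\<lambda>_. UNIV" and W = W and w = w])
       (use z w assms g p openin_imp_subset[OF assms(1)] in auto)
  thus False using p by simp
qed

lemma nonzero_dense: "openin (top_of_set (cspace r)) U \<Longrightarrow> U \<subseteq> closure {s\<in>U. g s \<noteq> 0}"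
  by (rule denseI) (use nonzero_meets_openin in blast)+

lemma holomorphic_cspace_quotient:
  "holomorphic_cspace r (\<lambda>s. H s / g s) {s\<in>cspace r. g s \<noteq> 0}"
  using openin_nonzero[OF g] by (intro holomorphic_cspace_divide holomorphic_cspace_restrict[OF H] holomorphic_cspace_restrict[OF g]) auto

text \<open>The value at a point is that of any local holomorphic \<open>h\<close> with h g = H; two
  such functions agree where \<open>g\<close> is nonzero, which is dense, hence everywhere.
  Conversely, a holomorphic function that agrees with \<open>F\<close> on a dense set satisfies the
  same equation and is therefore one of these \<open>h\<close>. Points without such an
  \<open>h\<close> receive an arbitrary value.\<close>

lemma nicely_meromorphic_quotient:
  "\<exists>F. nicely_meromorphic_cspace r F \<and>
       (\<forall>U h. holomorphic_cspace r h U \<longrightarrow> (\<forall>s\<in>U. h s * g s = H s) \<longrightarrow> (\<forall>s\<in>U. F s = h s))"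
proof -
  define E where "E = (\<lambda>a v. \<exists>U h. a \<in> U \<and> holomorphic_cspace r h U \<and> (\<forall>s\<in>U. h s * g s = H s) \<and> v = h a)"
  have uniq: "v = v'" if v: "E a v" "E a v'" for a v v'
  proof -
    obtain U h where h: "a \<in> U" "holomorphic_cspace r h U" "\<forall>s\<in>U. h s * g s = H s" "v = h a"
      using v(1) by (auto simp: E_def)
    obtain V k where k: "a \<in> V" "holomorphic_cspace r k V" "\<forall>s\<in>V. k s * g s = H s" "v' = k a"
      using v(2) by (auto simp: E_def)
    have op: "openin (top_of_set (cspace r)) (U \<inter> V)"
      using h k by (intro openin_Int holomorphic_cspace_openin)
    have "h a - k a = 0"
    proof (rule vanish_dense[where f = "\<lambda>s. h s - k s" and s = a, OF _ nonzero_dense[OF op]])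
      show "holomorphic_cspace r (\<lambda>s. h s - k s) (U \<inter> V)"
        by (intro holomorphic_cspace_diff holomorphic_cspace_subset[OF h(2) _ op]
              holomorphic_cspace_subset[OF k(2) _ op]) auto
      fix s assume "s \<in> {s \<in> U \<inter> V. g s \<noteq> 0}"
      hence "h s * g s = k s * g s" "g s \<noteq> 0" using h(3) k(3) by auto
      thus "h s - k s = 0" by simp
    qed (use h k in auto)
    thus ?thesis using h k by simp
  qed
  define F where "F = (\<lambda>a. SOME v. E a v)"
  have F: "F a = v" if "E a v" for a v
    using uniq[OF someI[of "E a", OF that] that] by (simp add: F_def)
  have F': "F s = h s" if "holomorphic_cspace r h U" "\<forall>s\<in>U. h s * g s = H s" "s \<in> U" for U h s
    by (rule F) (use that in \<open>auto simp: E_def\<close>)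
  have Fq: "F s = H s / g s" if "s \<in> cspace r" "g s \<noteq> 0" for s
    by (rule F'[OF holomorphic_cspace_quotient]) (use that in auto)
  have "nicely_meromorphic_cspace r F"
    unfolding nicely_meromorphic_cspace_def
  proof (intro conjI allI impI)
    show "meromorphic_cspace r F"
      unfolding meromorphic_cspace_def
      by (intro ballI exI[of _ "cspace r"] exI[of _ H] exI[of _ g])
         (use H g nonzero_dense[of "cspace r"] Fq in auto)
    fix a U h assume a: "a \<in> U" and h: "holomorphic_cspace r h U" and d: "U \<subseteq> closure {s \<in> U. F s = h s}"
    have op: "openin (top_of_set (cspace r)) U" by (rule holomorphic_cspace_openin[OF h])
    have UC: "U \<subseteq> cspace r" using op by (rule openin_imp_subset)
    have "h s * g s - H s = 0" if s: "s \<in> U" for s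
    proof (rule vanish_dense[where f = "\<lambda>s. h s * g s - H s" and K = "{s\<in>U. F s = h s \<and> g s \<noteq> 0}", OF _ _ _ _ s])
      show "holomorphic_cspace r (\<lambda>s. h s * g s - H s) U"
        by (intro holomorphic_cspace_diff holomorphic_cspace_mult h holomorphic_cspace_restrict[OF g] holomorphic_cspace_restrict[OF H] op)
      show "U \<subseteq> closure {s\<in>U. F s = h s \<and> g s \<noteq> 0}"
      proof (rule denseI[OF op])
        fix W assume W: "openin (top_of_set (cspace r)) W" "W \<subseteq> U" "W \<noteq> {}"
        have "openin (top_of_set (cspace r)) {s\<in>W. g s \<noteq> 0}"
          by (rule openin_nonzero[OF holomorphic_cspace_restrict[OF g W(1)]])
        from dense_meets[OF d _ this] have "{s\<in>W. g s \<noteq> 0} \<inter> {s \<in> U. F s = h s} \<noteq> {}"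
          using nonzero_meets_openin[OF W(1,3)] W(2) UC by auto
        thus "W \<inter> {s\<in>U. F s = h s \<and> g s \<noteq> 0} \<noteq> {}" by auto
      qed
      show "h t * g t - H t = 0" if "t \<in> {s\<in>U. F s = h s \<and> g s \<noteq> 0}" for t
        using that Fq[of t] UC by auto
    qed auto
    thus "F a = h a" by (intro F'[OF h]) (use a in auto)
  qed
  thus ?thesis using F' by blast
qed

text \<open>
  The set of points near which \<open>F = H / g\<close> on a dense subset is open; it is closed because on a
  polydisc the identity theorem applies to \<open>f\<^sub>1 g - g\<^sub>1 H\<close> for a local representation \<open>F = f\<^sub>1 / g\<^sub>1\<close>.
\<close>

lemma nicely_meromorphic_eq_quotient:
  assumes F: "nicely_meromorphic_cspace r F"
    and W: "openin (top_of_set (cspace r)) W" "W \<noteq> {}" "\<And>s. s \<in> W \<Longrightarrow> F s * g s = H s"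
    and a: "a \<in> cspace r" "g a \<noteq> 0"
  shows "F a = H a / g a"
proof -
  define P where "P = (\<lambda>a. \<exists>U. openin (top_of_set (cspace r)) U \<and> a \<in> U \<and>
                    U \<subseteq> closure {s\<in>U. g s \<noteq> 0 \<and> F s * g s = H s})"
  have "P a" if a: "a \<in> cspace r" for a
  proof -
    obtain w where w: "w \<in> W" using W by blast
    show ?thesis
    proof (rule connected_induction_simple[OF connected_cspace _ a, of w])
      show "w \<in> cspace r" using w openin_imp_subset[OF W(1)] by blast
      have "{s\<in>W. g s \<noteq> 0 \<and> F s * g s = H s} = {s\<in>W. g s \<noteq> 0}" using W(3) by auto
      hence "W \<subseteq> closure {s\<in>W. g s \<noteq> 0 \<and> F s * g s = H s}"
        using nonzero_dense[OF W(1)] by simp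
      thus "P w" unfolding P_def using W(1) w by (intro exI[of _ W] conjI)
      fix b assume b: "b \<in> cspace r"
      have "meromorphic_cspace r F" using F by (simp add: nicely_meromorphic_cspace_def)
      note this[unfolded meromorphic_cspace_def, rule_format, OF b]
      then obtain U f1 g1 where U: "b \<in> U" and f1: "holomorphic_cspace r f1 U" and g1: "holomorphic_cspace r g1 U"
        and dU: "U \<subseteq> closure {s\<in>U. g1 s \<noteq> 0}" and Feq: "\<And>s. s \<in> U \<Longrightarrow> g1 s \<noteq> 0 \<Longrightarrow> F s = f1 s / g1 s"
        by auto
      have opU: "openin (top_of_set (cspace r)) U" by (rule holomorphic_cspace_openin[OF f1])
      have UC: "U \<subseteq> cspace r" using opU by (rule openin_imp_subset)
      obtain e where e: "e > 0" "polydisc r b e \<subseteq> U" using polydisc_basis[OF opU U] by blast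
      define D where "D = polydisc r b e"
      have D: "openin (top_of_set (cspace r)) D" "b \<in> D" "D \<subseteq> U"
        unfolding D_def using e b by (auto simp: openin_polydisc polydisc_self)
      have g1_meets: "{s\<in>V. g1 s \<noteq> 0} \<noteq> {}" if "openin (top_of_set (cspace r)) V" "V \<subseteq> U" "V \<noteq> {}" for V
        using dense_meets[OF dU _ that] UC that(2) by auto
      show "\<exists>T. openin (top_of_set (cspace r)) T \<and> b \<in> T \<and> (\<forall>x\<in>T. \<forall>y\<in>T. P x \<longrightarrow> P y)"
      proof (intro exI[of _ D] conjI ballI impI D)
        fix x y assume x: "x \<in> D" and y: "y \<in> D" and "P x"
        then obtain V where V: "openin (top_of_set (cspace r)) V" "x \<in> V"
            "V \<subseteq> closure {s\<in>V. g s \<noteq> 0 \<and> F s * g s = H s}"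
          by (auto simp: P_def)
        have VC: "V \<subseteq> cspace r" using V(1) by (rule openin_imp_subset)
        have VD: "openin (top_of_set (cspace r)) (V \<inter> D)" by (intro openin_Int V D)
        define V' where "V' = {s\<in>V \<inter> D. g1 s \<noteq> 0}"
        have V': "openin (top_of_set (cspace r)) V'" "V' \<noteq> {}"
        proof -
          have "V \<inter> D \<subseteq> U" "V \<inter> D \<noteq> {}" using x V D by auto
          thus "openin (top_of_set (cspace r)) V'" "V' \<noteq> {}"
            unfolding V'_def using openin_nonzero[OF holomorphic_cspace_subset[OF g1 _ VD]] g1_meets[OF VD] by blast+
        qed
        define k where "k = (\<lambda>s. f1 s * g s - g1 s * H s)"
        have kU: "holomorphic_cspace r k U"
          unfolding k_def by (intro holomorphic_cspace_diff holomorphic_cspace_mult f1 g1 holomorphic_cspace_restrict[OF g] holomorphic_cspace_restrict[OF H] opU)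
        have kV': "k s = 0" if s: "s \<in> V'" for s
        proof (rule vanish_dense[where f = k and K = "{s\<in>V'. g s \<noteq> 0 \<and> F s * g s = H s}", OF _ _ _ _ s])
          show "holomorphic_cspace r k V'"
            by (rule holomorphic_cspace_subset[OF kU _ V'(1)]) (use D in \<open>auto simp: V'_def\<close>)
          show "V' \<subseteq> closure {s\<in>V'. g s \<noteq> 0 \<and> F s * g s = H s}"
          proof (rule denseI[OF V'(1)])
            fix X assume X: "openin (top_of_set (cspace r)) X" "X \<subseteq> V'" "X \<noteq> {}"
            have "X \<inter> {s\<in>V. g s \<noteq> 0 \<and> F s * g s = H s} \<noteq> {}"
              by (rule dense_meets[OF V(3) _ X(1) _ X(3)]) (use X VC in \<open>auto simp: V'_def\<close>)
            thus "X \<inter> {s\<in>V'. g s \<noteq> 0 \<and> F s * g s = H s} \<noteq> {}" using X(2) by auto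
          qed
          show "k t = 0" if t: "t \<in> {s\<in>V'. g s \<noteq> 0 \<and> F s * g s = H s}" for t
          proof -
            have "f1 t = F t * g1 t" "H t = F t * g t"
              using t Feq[of t] D(3) by (auto simp: V'_def)
            thus ?thesis by (simp add: k_def)
          qed
        qed auto
        have kD: "k s = 0" if s: "s \<in> D" for s
        proof -
          obtain v where v: "v \<in> V'" using V' by blast
          show ?thesis
            by (rule identity_theorem_cspace[of r "\<lambda>k. ball (b k) e" D k V' v s])
               (use V' v kV' s holomorphic_cspace_subset[OF kU D(3,1)] in \<open>auto simp: D_def polydisc_def V'_def\<close>)
        qed
        have "D \<subseteq> closure {s\<in>D. g s \<noteq> 0 \<and> F s * g s = H s}"
        proof (rule denseI[OF D(1)])
          fix X assume X: "openin (top_of_set (cspace r)) X" "X \<subseteq> D" "X \<noteq> {}"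
          have XU: "X \<subseteq> U" using X D by blast
          have "openin (top_of_set (cspace r)) {s\<in>X. g1 s \<noteq> 0}" "{s\<in>X. g1 s \<noteq> 0} \<noteq> {}"
            by (intro openin_nonzero holomorphic_cspace_subset[OF g1 XU X(1)], rule g1_meets[OF X(1) XU X(3)])
          then obtain t where t: "t \<in> X" "g1 t \<noteq> 0" "g t \<noteq> 0" using nonzero_meets_openin by blast
          hence "F t = f1 t / g1 t" "k t = 0" using Feq XU kD X(2) by auto
          hence "F t * g t = H t" using t(2) by (simp add: k_def)
          thus "X \<inter> {s\<in>D. g s \<noteq> 0 \<and> F s * g s = H s} \<noteq> {}" using t X(2) by auto
        qed
        thus "P y" unfolding P_def using D(1) y by blast
      qed
    qed
  qed
  then obtain U where U: "openin (top_of_set (cspace r)) U" "a \<in> U" "U \<subseteq> closure {s\<in>U. g s \<noteq> 0 \<and> F s * g s = H s}"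
    using a by (auto simp: P_def)
  \<comment> \<open>Where \<open>g\<close> is nonzero the quotient is itself holomorphic, so nice
    meromorphy turns agreement on a dense set into agreement at \<open>a\<close>.\<close>
  define U' where "U' = {s\<in>U. g s \<noteq> 0}"
  have U': "openin (top_of_set (cspace r)) U'" "U' \<subseteq> cspace r"
    unfolding U'_def using openin_nonzero[OF holomorphic_cspace_restrict[OF g U(1)]] openin_imp_subset[OF U(1)] by auto
  have "F a = (\<lambda>s. H s / g s) a"
  proof -
    have "holomorphic_cspace r (\<lambda>s. H s / g s) U'"
      using U' by (intro holomorphic_cspace_subset[OF holomorphic_cspace_quotient]) (auto simp: U'_def)
    moreover have "{s\<in>U'. F s = H s / g s} = {s\<in>U. g s \<noteq> 0 \<and> F s * g s = H s}"
      by (auto simp: U'_def field_simps)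
    hence "U' \<subseteq> closure {s\<in>U'. F s = H s / g s}" using U(3) by (auto simp: U'_def)
    moreover have "a \<in> U'" using U a by (simp add: U'_def)
    ultimately show ?thesis
      using F unfolding nicely_meromorphic_cspace_def by blast
  qed
  thus ?thesis by simp
qed

end

section \<open>The Euler--Zagier function\<close>

text \<open>Telescoping (m+1)^(j+1) - m^(j+1) and expanding by the binomial theorem gives j + 1
  times the j-th power sum plus lower power sums.\<close>

lemma sum_powers_poly: "\<exists>Q :: complex poly. \<forall>n\<ge>1. (\<Sum>m=1..<n. of_nat m ^ j) = poly Q (of_nat n)"
proof (induction j rule: less_induct)
  case (less j)
  then obtain Q :: "nat \<Rightarrow> complex poly" where Q: "\<And>i n. i < j \<Longrightarrow> n \<ge> 1 \<Longrightarrow> (\<Sum>m=1..<n. of_nat m ^ i) = poly (Q i) (of_nat n)"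
    by metis
  define P where "P = smult (1 / of_nat (Suc j)) (monom 1 (Suc j) - 1 - (\<Sum>i<j. smult (of_nat (Suc j choose i)) (Q i)))"
  have "(\<Sum>m=1..<n. of_nat m ^ j) = poly P (of_nat n)" if n: "n \<ge> 1" for n
  proof -
    have "of_nat n ^ Suc j - 1 = (\<Sum>m=1..<n. of_nat (Suc m) ^ Suc j - of_nat m ^ Suc j :: complex)"
      using n by (subst sum_Suc_diff') auto
    also have "\<dots> = (\<Sum>m=1..<n. \<Sum>i\<le>j. of_nat (Suc j choose i) * of_nat m ^ i)"
    proof (intro sum.cong refl)
      fix m
      have "of_nat (Suc m) ^ Suc j = (\<Sum>i\<le>Suc j. of_nat (Suc j choose i) * of_nat m ^ i :: complex)"
        using binomial_ring[of "of_nat m :: complex" 1 "Suc j"] by (simp add: add.commute)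
      thus "of_nat (Suc m) ^ Suc j - of_nat m ^ Suc j = (\<Sum>i\<le>j. of_nat (Suc j choose i) * of_nat m ^ i :: complex)"
        by (simp only: sum.atMost_Suc) simp
    qed
    also have "\<dots> = (\<Sum>i\<le>j. of_nat (Suc j choose i) * (\<Sum>m=1..<n. of_nat m ^ i))"
      by (subst sum.swap) (simp only: sum_distrib_left)
    also have "{..j} = insert j {..<j}" by auto
    also have "(\<Sum>i\<in>insert j {..<j}. of_nat (Suc j choose i) * (\<Sum>m=1..<n. of_nat m ^ i)) =
        of_nat (Suc j) * (\<Sum>m=1..<n. of_nat m ^ j :: complex) + (\<Sum>i<j. of_nat (Suc j choose i) * poly (Q i) (of_nat n))"
      using Q n by (simp del: of_nat_Suc)
    finally have "of_nat (Suc j) * (\<Sum>m=1..<n. of_nat m ^ j :: complex) = of_nat n ^ Suc j - 1 - (\<Sum>i<j. of_nat (Suc j choose i) * poly (Q i) (of_nat n))"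
      by (simp add: algebra_simps)
    thus ?thesis
      by (simp add: P_def poly_monom poly_sum field_simps del: of_nat_Suc power_Suc)
  qed
  thus ?case by blast
qed

lemma sum_poly: "\<exists>Q :: complex poly. \<forall>n\<ge>1. (\<Sum>m=1..<n. poly P (of_nat m)) = poly Q (of_nat n)"
proof -
  obtain S :: "nat \<Rightarrow> complex poly" where S: "\<And>j n. n \<ge> 1 \<Longrightarrow> (\<Sum>m=1..<n. of_nat m ^ j) = poly (S j) (of_nat n)"
    using sum_powers_poly by metis
  have "(\<Sum>m=1..<n. poly P (of_nat m)) = poly (\<Sum>i\<le>degree P. smult (coeff P i) (S i)) (of_nat n)" if "n \<ge> 1" for n
    unfolding poly_altdef[of P] using that
    by (subst sum.swap) (simp add: poly_sum S[unfolded One_nat_def] flip: sum_distrib_left)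
  thus ?thesis by blast
qed

lemma nat_powr_of_nat: "n \<ge> 1 \<Longrightarrow> (of_nat n :: complex) powr of_nat k = of_nat n ^ k"
  by (subst powr_nat') auto

text \<open>At non-positive integers the factors are natural powers, and summation up to n - 1 maps
  polynomials to polynomials.\<close>

lemma EZ_partial_poly:
  assumes "\<And>i. i \<in> {1..k} \<Longrightarrow> s i = - of_nat (e i)"
  shows "\<exists>P. \<forall>n\<ge>1. EZ_partial s k n = poly P (of_nat n)"
  using assms
proof (induction k)
  case 0
  show ?case by (intro exI[of _ 1]) auto
next
  case (Suc k)
  then obtain P where P: "\<And>n. n \<ge> 1 \<Longrightarrow> EZ_partial s k n = poly P (of_nat n)" by auto
  obtain Q where Q: "\<And>n. n \<ge> 1 \<Longrightarrow> (\<Sum>m=1..<n. poly (P * monom 1 (e (Suc k))) (of_nat m)) = poly Q (of_nat n)"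
    using sum_poly by blast
  have "EZ_partial s (Suc k) n = (\<Sum>m=1..<n. poly (P * monom 1 (e (Suc k))) (of_nat m))" for n
    unfolding EZ_partial.simps
    by (intro sum.cong refl) (use Suc.prems[of "Suc k"] in \<open>auto simp: P poly_monom nat_powr_of_nat\<close>)
  thus ?case using Q by auto
qed

section \<open>The quotient representation of the Euler--Zagier function\<close>

definition EZ_den :: "nat \<Rightarrow> (nat \<Rightarrow> complex) \<Rightarrow> complex" where
  "EZ_den r s = per_prod r s * (s r - 1)"

lemma EZ_den_holo: "openin (top_of_set (cspace r)) U \<Longrightarrow> holomorphic_cspace r (EZ_den r) U"
  unfolding EZ_den_def
  by (intro holomorphic_cspace_mult holomorphic_cspace_diff holomorphic_cspace_coord
        holomorphic_cspace_const per_prod_holo)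

text \<open>Every argument of \<open>per\<close> differs from \<open>s r\<close> by an integer, so a
  single non-integral coordinate keeps all the factors away from 0.\<close>

lemma EZ_den_nonzero:
  assumes "r \<ge> 1" "\<And>k. k \<in> {1..<r} \<Longrightarrow> s k \<in> \<int>" "s r \<notin> \<int>"
  shows "EZ_den r s \<noteq> 0"
proof -
  have "(\<Sum>j=k..r. s j) \<notin> \<int>" if k: "k \<in> {1..<r}" for k
  proof
    assume *: "(\<Sum>j=k..r. s j) \<in> \<int>"
    have e: "{k..r} = insert r {k..<r}" using k by auto
    have "(\<Sum>j=k..<r. s j) \<in> \<int>" using assms(2) k by (intro Ints_sum) auto
    with * have "s r \<in> \<int>" unfolding e using Ints_diff by fastforce
    thus False using assms(3) by blast
  qed
  moreover have "s r \<noteq> 1" using assms(3) by auto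
  ultimately show ?thesis by (auto simp: EZ_den_def per_prod_def per_eq_0_iff)
qed

lemma half_not_Int: "(1 / 2 :: complex) \<notin> \<int>"
proof
  assume "(1 / 2 :: complex) \<in> \<int>"
  then obtain n :: int where n: "1 / 2 = (of_int n :: complex)" by (auto elim: Ints_cases)
  hence "of_int (2 * n) = (of_int 1 :: complex)" by (simp add: field_simps)
  hence "2 * n = 1" using of_int_eq_iff by blast
  thus False by presburger
qed

lemma EZ_sum_holo:
  assumes "R \<ge> 0"
  shows "holomorphic_cspace (Suc q) (EZ_sum (Suc q)) (rdom (Suc q) R (real q * (R + 1) + 1))"
  unfolding EZ_sum_def[abs_def] diff_Suc_1
proof (rule dirichlet_holomorphic)
  fix s m assume "\<forall>k\<in>{1..<Suc q}. - R < Re (s k)"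
  thus "norm (EZ_partial s q (Suc m)) \<le> real (Suc m) powr (real q * (R + 1))"
    by (intro EZ_coeff_bound[OF assms]) auto
qed (auto intro!: EZ_partial_holo)

text \<open>The continuation \<open>H\<close> first shows that the specification behind the choice
  operator can be met. Whatever function is chosen agrees with the series, hence with the quotient,
  when all real parts are large, and this agreement propagates to all points with nonzero
  denominator.\<close>

lemma EZ_zeta_quotient:
  assumes r: "r \<ge> 1"
  obtains H where "holomorphic_cspace r H (cspace r)"
    "\<And>s. s \<in> cspace r \<Longrightarrow> EZ_den r s \<noteq> 0 \<Longrightarrow> EZ_zeta r s = H s / EZ_den r s"
    "\<And>R. R \<ge> 0 \<Longrightarrow> \<exists>x. \<forall>s\<in>rdom r R x. H s = EZ_den r s * EZ_sum r s"
proof -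
  obtain q where q: "r = Suc q" using r by (cases r) auto
  obtain H where H: "holomorphic_cspace r H (cspace r)"
    "\<And>R. R \<ge> 0 \<Longrightarrow> \<exists>x. \<forall>s\<in>rdom r R x. H s = EZ_den r s * EZ_sum r s"
    using EZ_continuation[of q] unfolding q EZ_den_def by blast
  define p where "p = (\<lambda>i\<in>{1..r}. if i = r then 1 / 2 else 0 :: complex)"
  have p: "p \<in> cspace r" "EZ_den r p \<noteq> 0"
  proof -
    show "p \<in> cspace r" by (auto simp: p_def cspace_def)
    show "EZ_den r p \<noteq> 0" by (rule EZ_den_nonzero[OF r]) (use r half_not_Int in \<open>auto simp: p_def\<close>)
  qed
  have den: "holomorphic_cspace r (EZ_den r) (cspace r)" by (rule EZ_den_holo) simp
  obtain x where x: "\<And>s. s \<in> rdom r 1 x \<Longrightarrow> H s = EZ_den r s * EZ_sum r s" using H(2)[of 1] by auto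
  \<comment> \<open>The second entry is the abscissa of \<open>EZ_has_sum\<close> for
    \<open>R = 1\<close>; it also makes \<open>c\<close> at least 1, so that real parts above
    \<open>c\<close> exceed -1.\<close>
  define c where "c = max x (real q * (1 + 1) + 1)"
  have rd: "s \<in> rdom r 1 c" if "s \<in> cspace r" "\<forall>k\<in>{1..r}. Re (s k) > c" for s
  proof -
    have "c \<ge> 1" by (simp add: c_def)
    hence "\<forall>k\<in>{1..r}. Re (s k) > - 1" using that by fastforce
    thus ?thesis using that r by (auto simp: rdom_def)
  qed
  have hs: "(EZ_term r s has_sum EZ_sum r s) (pos_tuples r)" if "s \<in> rdom r 1 c" for s
    unfolding q by (rule EZ_has_sum[where R = 1]) (use that in \<open>auto simp: rdom_def q c_def\<close>)
  define spec where "spec = (\<lambda>F. nicely_meromorphic_cspace r F \<and>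
     (\<exists>c. \<forall>s\<in>cspace r. (\<forall>k\<in>{1..r}. Re (s k) > c) \<longrightarrow> (EZ_term r s has_sum F s) (pos_tuples r)))"
  have "\<exists>F. spec F"
  proof -
    obtain F where F: "nicely_meromorphic_cspace r F"
      "\<And>U h. holomorphic_cspace r h U \<Longrightarrow> (\<forall>s\<in>U. h s * EZ_den r s = H s) \<Longrightarrow> (\<forall>s\<in>U. F s = h s)"
      using nicely_meromorphic_quotient[OF H(1) den p] by blast
    have "\<forall>s\<in>rdom r 1 c. F s = EZ_sum r s"
    proof (rule F(2))
      show "holomorphic_cspace r (EZ_sum r) (rdom r 1 c)"
        unfolding q by (rule holomorphic_cspace_subset[OF EZ_sum_holo[of 1 q] rdom_mono openin_rdom]) (auto simp: c_def)
      have "rdom r 1 c \<subseteq> rdom r 1 x" by (rule rdom_mono) (auto simp: c_def)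
      thus "\<forall>s\<in>rdom r 1 c. EZ_sum r s * EZ_den r s = H s" using x by (auto simp: mult.commute)
    qed
    hence "spec F" unfolding spec_def using F(1) hs rd by (intro conjI exI[of _ c]) auto
    thus ?thesis by blast
  qed
  hence "spec (EZ_zeta r)" unfolding EZ_zeta_def spec_def by (rule someI_ex)
  then obtain c' where nm: "nicely_meromorphic_cspace r (EZ_zeta r)" and
    c': "\<And>s. s \<in> cspace r \<Longrightarrow> (\<forall>k\<in>{1..r}. Re (s k) > c') \<Longrightarrow> (EZ_term r s has_sum EZ_zeta r s) (pos_tuples r)"
    unfolding spec_def by blast
  define d where "d = max c c'"
  define W where "W = {s\<in>cspace r. \<forall>k\<in>{1..r}. s k \<in> {z. Re z > d}}"
  have "EZ_zeta r s = H s / EZ_den r s" if s: "s \<in> cspace r" "EZ_den r s \<noteq> 0" for s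
  proof (rule nicely_meromorphic_eq_quotient[OF H(1) den p nm _ _ _ s])
    show "openin (top_of_set (cspace r)) W"
      unfolding W_def by (rule openin_box) (auto intro: open_halfspace_Re_gt)
    have "(\<lambda>i\<in>{1..r}. of_real (d + 1)) \<in> W" by (auto simp: W_def cspace_def)
    thus "W \<noteq> {}" by blast
    fix t assume t: "t \<in> W"
    have t': "t \<in> rdom r 1 c" by (rule rd) (use t in \<open>auto simp: W_def d_def\<close>)
    have "(EZ_term r t has_sum EZ_zeta r t) (pos_tuples r)"
      by (rule c') (use t in \<open>auto simp: W_def d_def\<close>)
    hence "EZ_zeta r t = EZ_sum r t" using hs[OF t'] has_sum_unique by blast
    moreover have "t \<in> rdom r 1 x" using t' rdom_mono[of 1 1 x c r] by (auto simp: c_def)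
    ultimately show "EZ_zeta r t * EZ_den r t = H t" using x[of t] by simp
  qed
  thus ?thesis using that H by blast
qed

section \<open>Restriction to lines in the last variable\<close>

lemma eventually_not_Ints_at: "eventually (\<lambda>w. w \<notin> \<int>) (at (z :: complex))"
proof -
  have "eventually (\<lambda>w. w \<in> - (of_int ` {n. of_int n \<noteq> z})) (at z)"
    by (rule eventually_at_in_open') (auto intro: open_Compl closed_of_int_image)
  moreover have "eventually (\<lambda>w. w \<noteq> z) (at z)" by (rule eventually_neq_at_within)
  ultimately show ?thesis
    by eventually_elim (auto elim!: Ints_cases)
qed

lemma fun_upd_cspace_holomorphic:
  assumes "holomorphic_cspace r H (cspace r)" "s \<in> cspace r" "r \<ge> 1"
  shows "(\<lambda>z. H (s(r := z))) holomorphic_on A"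
  by (rule holomorphic_cspace_slice[OF assms(1,2)]) (use assms in \<open>auto intro: cspace_fun_upd\<close>)

lemma dirichlet_poly:
  assumes "Re z > degree P + 1"
  shows "dirichlet (\<lambda>m. poly P (of_nat (Suc m))) z = (\<Sum>j\<le>degree P. coeff P j * dirichlet (\<lambda>_. 1) (z - of_nat j))"
proof -
  have "(\<lambda>m. \<Sum>j\<le>degree P. coeff P j * (1 * of_nat (Suc m) powr (- (z - of_nat j)))) sums
          (\<Sum>j\<le>degree P. coeff P j * dirichlet (\<lambda>_. 1) (z - of_nat j))"
    by (intro sums_sum sums_mult dirichlet_sums[where c = 0]) (use assms in auto)
  also have "(\<lambda>m. \<Sum>j\<le>degree P. coeff P j * (1 * of_nat (Suc m) powr (- (z - of_nat j)))) =
             (\<lambda>m. poly P (of_nat (Suc m)) * of_nat (Suc m) powr (- z))"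
  proof
    fix m
    have "(of_nat (Suc m) :: complex) powr (- (z - of_nat j)) = of_nat (Suc m) ^ j * of_nat (Suc m) powr (- z)" for j
    proof -
      have "(of_nat (Suc m) :: complex) powr (- (z - of_nat j)) = of_nat (Suc m) powr (of_nat j + - z)"
        by (simp add: algebra_simps del: of_nat_Suc)
      also have "\<dots> = of_nat (Suc m) powr of_nat j * of_nat (Suc m) powr (- z)"
        by (rule powr_add)
      finally show ?thesis by (simp add: nat_powr_of_nat del: of_nat_Suc)
    qed
    thus "(\<Sum>j\<le>degree P. coeff P j * (1 * of_nat (Suc m) powr (- (z - of_nat j)))) =
             poly P (of_nat (Suc m)) * of_nat (Suc m) powr (- z)"
      by (simp add: poly_altdef sum_distrib_right mult.assoc del: of_nat_Suc)
  qed
  finally show ?thesis unfolding dirichlet_def by (rule sums_unique[symmetric])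
qed

text \<open>For integral earlier coordinates \<open>EZ_zeta\<close> may carry meaningless values
  where the last coordinate is an integer too. \<open>E\<close> is a function of the last variable
  that replaces it: equal off the integers, given by the series far to the right, and regular
  outside the positive integers.\<close>

definition EZ_line_ext :: "nat \<Rightarrow> (nat \<Rightarrow> complex) \<Rightarrow> (complex \<Rightarrow> complex) \<Rightarrow> bool" where
  "EZ_line_ext r s E \<longleftrightarrow> E meromorphic_on UNIV \<and> E analytic_on (- (of_nat ` {1..})) \<and>
     (\<forall>z. z \<notin> \<int> \<longrightarrow> EZ_zeta r (s(r := z)) = E z) \<and>
     (\<exists>x. E analytic_on {z. Re z > x} \<and>
          (\<forall>z. Re z > x \<longrightarrow> (EZ_term r (s(r := z)) has_sum E z) (pos_tuples r)))"

text \<open>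
  With all other arguments non-positive integers the coefficients are polynomial, so on this line
  the function is a linear combination of shifts of the Riemann zeta function.
\<close>

lemma EZ_line_ext_exists:
  assumes r: "r \<ge> 1" and s: "s \<in> cspace r" "\<And>k. k \<in> {1..<r} \<Longrightarrow> s k = - of_nat (e k)"
  shows "\<exists>E. EZ_line_ext r s E"
proof -
  obtain q where q: "r = Suc q" using r by (cases r) auto
  obtain H1 where H1: "holomorphic_cspace 1 H1 (cspace 1)"
    "\<And>R. R \<ge> 0 \<Longrightarrow> \<exists>x. \<forall>s\<in>rdom 1 R x. H1 s = EZ_den 1 s * EZ_sum 1 s"
    using EZ_zeta_quotient[OF order_refl] by metis
  obtain x1 where x1: "\<And>s. s \<in> rdom 1 0 x1 \<Longrightarrow> H1 s = EZ_den 1 s * EZ_sum 1 s" using H1(2)[of 0] by auto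
  define b where "b = (\<lambda>i\<in>{1..1::nat}. 0 :: complex)"
  have b: "b \<in> cspace 1" by (auto simp: b_def cspace_def)
  \<comment> \<open>This is the Riemann zeta function, taken from the case of dimension 1.\<close>
  define Z where "Z = (\<lambda>z. H1 (b(1 := z)) / (z - 1))"
  have Zhol: "Z holomorphic_on - {1}"
    unfolding Z_def by (intro holomorphic_intros fun_upd_cspace_holomorphic[OF H1(1) b]) auto
  have "(\<lambda>z. H1 (b(1 := z))) analytic_on UNIV"
    using fun_upd_cspace_holomorphic[OF H1(1) b] by (subst analytic_on_open) auto
  hence Zmer: "Z meromorphic_on UNIV"
    unfolding Z_def by (intro meromorphic_intros analytic_on_imp_meromorphic_on) auto
  have Zeq: "Z z = dirichlet (\<lambda>_. 1) z" if z: "Re z > x1" "z \<noteq> 1" for z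
  proof -
    have "b(1 := z) \<in> rdom 1 0 x1" using z b cspace_fun_upd[OF b, of 1 z] by (auto simp: rdom_def)
    hence "H1 (b(1 := z)) = (z - 1) * dirichlet (\<lambda>_. 1) z"
      by (simp add: x1 EZ_den_def EZ_sum_def per_prod_def)
    thus ?thesis using z by (simp add: Z_def)
  qed
  obtain P where P: "\<And>n. n \<ge> 1 \<Longrightarrow> EZ_partial s q n = poly P (of_nat n)"
    using EZ_partial_poly[of q s e] s(2) by (auto simp: q)
  define E where "E = (\<lambda>z. \<Sum>j\<le>degree P. coeff P j * Z (z - of_nat j))"
  have Eana: "E analytic_on A" if A: "\<And>j. j \<le> degree P \<Longrightarrow> of_nat (Suc j) \<notin> A" for A
  proof -
    have "(\<lambda>z. Z (z - of_nat j)) analytic_on A" if j: "j \<le> degree P" for j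
    proof (rule analytic_on_compose_gen[of "\<lambda>z. z - of_nat j" _ Z "- {1}", unfolded o_def])
      show "Z analytic_on - {1}" using Zhol by (subst analytic_on_open) auto
      fix z assume "z \<in> A"
      hence "z \<noteq> of_nat (Suc j)" using A[OF j] by auto
      thus "z - of_nat j \<in> - {1}" by (auto simp: algebra_simps)
    qed (auto intro!: analytic_intros)
    thus ?thesis unfolding E_def by (intro analytic_intros) auto
  qed
  have Emer: "E meromorphic_on UNIV"
    unfolding E_def by (intro meromorphic_intros meromorphic_on_compose[OF Zmer]) (auto intro!: analytic_intros)
  define R where "R = real (\<Sum>k\<in>{1..<r}. e k) + 1"
  have R: "R \<ge> 0" "\<And>k. k \<in> {1..<r} \<Longrightarrow> Re (s k) > - R"
  proof -
    show "R \<ge> 0" by (simp add: R_def del: of_nat_sum)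
    fix k assume k: "k \<in> {1..<r}"
    have "e k \<le> (\<Sum>k\<in>{1..<r}. e k)" using k by (intro member_le_sum) auto
    hence "real (e k) < R" by (simp add: R_def del: of_nat_sum)
    thus "Re (s k) > - R" using s(2)[OF k] by simp
  qed
  \<comment> \<open>The first entry places all shifts z - j, j up to the degree, to the right of
    both \<open>x1\<close> and 1; the second is the abscissa of the multiple series.\<close>
  define X where "X = max (real (degree P) + 1 + \<bar>x1\<bar>) (real q * (R + 1) + 1)"
  have ES: "E z = EZ_sum r (s(r := z))" if z: "Re z > X" for z
  proof -
    have "EZ_sum r (s(r := z)) = dirichlet (\<lambda>m. poly P (of_nat (Suc m))) z"
    proof -
      have "EZ_partial (s(r := z)) q (Suc m) = EZ_partial s q (Suc m)" for m
        by (rule EZ_partial_cong) (auto simp: q)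
      thus ?thesis by (simp add: EZ_sum_def q P del: of_nat_Suc)
    qed
    also have "\<dots> = (\<Sum>j\<le>degree P. coeff P j * dirichlet (\<lambda>_. 1) (z - of_nat j))"
      by (rule dirichlet_poly) (use z in \<open>auto simp: X_def\<close>)
    also have "\<dots> = E z"
      unfolding E_def
    proof (intro sum.cong refl)
      fix j assume "j \<in> {..degree P}"
      hence "real j \<le> real (degree P)" by simp
      hence "Re (z - of_nat j) > x1" "Re (z - of_nat j) > 1" using z by (auto simp: X_def)
      moreover from this(2) have "z - of_nat j \<noteq> 1" by (metis less_irrefl one_complex.sel(1))
      ultimately show "coeff P j * dirichlet (\<lambda>_. 1) (z - of_nat j) = coeff P j * Z (z - of_nat j)"
        by (subst Zeq) auto
    qed
    finally show ?thesis ..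
  qed
  have 1: "(EZ_term r (s(r := z)) has_sum E z) (pos_tuples r)" if z: "Re z > X" for z
    unfolding ES[OF z] unfolding q
    by (rule EZ_has_sum[OF R(1)]) (use R(2) z in \<open>auto simp: X_def q\<close>)
  obtain H where H: "holomorphic_cspace r H (cspace r)"
    "\<And>s. s \<in> cspace r \<Longrightarrow> EZ_den r s \<noteq> 0 \<Longrightarrow> EZ_zeta r s = H s / EZ_den r s"
    "\<And>R. R \<ge> 0 \<Longrightarrow> \<exists>x. \<forall>s\<in>rdom r R x. H s = EZ_den r s * EZ_sum r s"
    using EZ_zeta_quotient[OF r] by metis
  obtain x where x: "\<And>s. s \<in> rdom r R x \<Longrightarrow> H s = EZ_den r s * EZ_sum r s" using H(3)[OF R(1)] by blast
  have up: "s(r := z) \<in> cspace r" for z using s r by (auto intro: cspace_fun_upd)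
  have den: "EZ_den r (s(r := z)) \<noteq> 0" if "z \<notin> \<int>" for z
    by (rule EZ_den_nonzero[OF r]) (use that s(2) in auto)
  have 2: "EZ_zeta r (s(r := z)) = E z" if z: "z \<notin> \<int>" for z
  proof -
    define Y where "Y = max X x"
    have cl: "closed (\<int> :: complex set)" by simp
    have "H (s(r := z)) / EZ_den r (s(r := z)) = E z"
    proof (rule analytic_continuation_open[where f = "\<lambda>z. H (s(r := z)) / EZ_den r (s(r := z))" and g = E and s = "{z. Re z > Y} - \<int>" and s' = "UNIV - \<int>"])
      \<comment> \<open>Adding the imaginary unit moves the point off the integers.\<close>
      have "of_real (real_of_int \<lceil>Y\<rceil> + 1) + \<i> \<in> {z. Re z > Y} - \<int>"
      proof -
        have "Y < real_of_int \<lceil>Y\<rceil> + 1" by linarith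
        thus ?thesis by (auto simp: complex_is_Int_iff)
      qed
      thus "{z. Re z > Y} - \<int> \<noteq> {}" by blast
      show "connected (UNIV - \<int> :: complex set)"
        by (rule connected_open_diff_countable) (auto simp: Ints_def)
      show "(\<lambda>z. H (s(r := z)) / EZ_den r (s(r := z))) holomorphic_on UNIV - \<int>"
        using den by (intro holomorphic_intros fun_upd_cspace_holomorphic[OF H(1) s(1) r]
             fun_upd_cspace_holomorphic[OF EZ_den_holo s(1) r]) auto
      show "E holomorphic_on UNIV - \<int>"
        by (rule analytic_imp_holomorphic, rule Eana) auto
      fix w assume w: "w \<in> {z. Re z > Y} - \<int>"
      have "s(r := w) \<in> rdom r R x" using w up R(2) by (auto simp: rdom_def Y_def)
      thus "H (s(r := w)) / EZ_den r (s(r := w)) = E w"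
        using x den[of w] w by (simp add: ES Y_def)
    qed (use z cl in \<open>auto intro!: open_Diff open_halfspace_Re_gt\<close>)
    thus ?thesis using H(2)[OF up den[OF z]] by simp
  qed
  have 3: "E analytic_on {z. Re z > X}" by (rule Eana) (auto simp: X_def)
  have 4: "E analytic_on (- (of_nat ` {1..}))"
    by (rule Eana) (auto simp del: of_nat_Suc)
  show ?thesis unfolding EZ_line_ext_def using 1 2 3 4 Emer by blast
qed

text \<open>Only the point with all limits inserted has to lie in \<open>U\<close>, since the first
  \<open>k\<close> coordinates of \<open>s\<close> are overwritten. Openness keeps it in
  \<open>U\<close> while the outermost variable moves slightly, which supplies the inner limits by
  induction.\<close>

lemma has_iterated_limit_continuous:
  assumes U: "openin (top_of_set (cspace r)) U" "continuous_on U F" and "k \<le> r" "s \<in> cspace r"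
    and "(\<lambda>i. if i \<in> {1..k} then a i else s i) \<in> U"
  shows "has_iterated_limit F a k s (F (\<lambda>i. if i \<in> {1..k} then a i else s i))"
  using assms(3-5)
proof (induction k arbitrary: s)
  case (Suc k)
  define t where "t = (\<lambda>i. if i \<in> {1..Suc k} then a i else s i)"
  have k: "Suc k \<in> {1..r}" using Suc.prems by auto
  have t: "t \<in> U" "t \<in> cspace r" using Suc.prems(3) openin_imp_subset[OF U(1)] by (auto simp: t_def)
  have upd: "(\<lambda>i. if i \<in> {1..k} then a i else (s(Suc k := z)) i) = t(Suc k := z)" for z
    by (auto simp: t_def fun_eq_iff)
  have ta: "t (Suc k) = a (Suc k)" by (simp add: t_def)
  have op: "open {z. t(Suc k := z) \<in> U}" by (rule open_slice[OF U(1) t(2) k])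
  have mem: "a (Suc k) \<in> {z. t(Suc k := z) \<in> U}" using t(1) by (simp flip: ta)
  have "\<forall>\<^sub>F z in at (a (Suc k)). z \<in> {z. t(Suc k := z) \<in> U}"
    by (rule eventually_at_in_open'[OF op mem])
  hence "\<forall>\<^sub>F z in at (a (Suc k)). has_iterated_limit F a k (s(Suc k := z)) (F (t(Suc k := z)))"
  proof eventually_elim
    case (elim z)
    show ?case
      by (rule Suc.IH[of "s(Suc k := z)", unfolded upd])
         (use Suc.prems(1) elim cspace_fun_upd[OF Suc.prems(2) k] in \<open>auto simp del: fun_upd_apply\<close>)
  qed
  moreover have "continuous_on {z. t(Suc k := z) \<in> U} (\<lambda>z. F (t(Suc k := z)))"
    by (rule continuous_on_compose2[OF U(2) continuous_on_fun_upd]) auto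
  hence "isCont (\<lambda>z. F (t(Suc k := z))) (a (Suc k))"
    using op mem continuous_on_eq_continuous_at by blast
  hence "((\<lambda>z. F (t(Suc k := z))) \<longlongrightarrow> F (t(Suc k := a (Suc k)))) (at (a (Suc k)))"
    by (rule isContD)
  moreover have "t(Suc k := a (Suc k)) = t" using ta by auto
  ultimately show ?case unfolding t_def[symmetric] has_iterated_limit.simps by auto
qed simp

lemma has_iterated_limit_unique:
  "has_iterated_limit F a k s v \<Longrightarrow> has_iterated_limit F a k s v' \<Longrightarrow> v = v'"
proof (induction k arbitrary: s v v')
  case (Suc k)
  obtain g where g: "\<forall>\<^sub>F z in at (a (Suc k)). has_iterated_limit F a k (s(Suc k := z)) (g z)"
      "(g \<longlongrightarrow> v) (at (a (Suc k)))" using Suc.prems(1) by auto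
  obtain g' where g': "\<forall>\<^sub>F z in at (a (Suc k)). has_iterated_limit F a k (s(Suc k := z)) (g' z)"
      "(g' \<longlongrightarrow> v') (at (a (Suc k)))" using Suc.prems(2) by auto
  have "\<forall>\<^sub>F z in at (a (Suc k)). g z = g' z"
    using g(1) g'(1) by eventually_elim (rule Suc.IH)
  hence "(g' \<longlongrightarrow> v) (at (a (Suc k)))" using g(2) by (simp cong: tendsto_cong)
  thus ?case using g'(2) tendsto_unique trivial_limit_at by blast
qed simp

text \<open>Near its integer limit point the last variable is non-integral, so
  \<open>EZ_zeta\<close> is continuous at the inner limit point and the inner limits are just
  values, namely those of \<open>E\<close>. The outer limit then exists because \<open>E\<close> is
  regular at non-positive integers.\<close>

lemma EZ_rev_eq:
  assumes r: "r \<ge> 1" and s: "s \<in> cspace r" "\<And>k. k \<in> {1..<r} \<Longrightarrow> s k = - of_nat (e k)" "s r = - of_nat n"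
    and E: "EZ_line_ext r s E"
  shows "has_EZ_rev r s (E (s r))" "EZ_zeta_rev r s = E (s r)"
proof -
  obtain q where q: "r = Suc q" using r by (cases r) auto
  obtain H where H: "holomorphic_cspace r H (cspace r)"
    "\<And>s. s \<in> cspace r \<Longrightarrow> EZ_den r s \<noteq> 0 \<Longrightarrow> EZ_zeta r s = H s / EZ_den r s"
    using EZ_zeta_quotient[OF r] by metis
  define U where "U = {s\<in>cspace r. EZ_den r s \<noteq> 0}"
  have U: "openin (top_of_set (cspace r)) U"
    unfolding U_def by (rule openin_nonzero[OF EZ_den_holo]) simp
  have US: "U \<subseteq> cspace r" by (auto simp: U_def)
  have "holomorphic_cspace r (\<lambda>s. H s / EZ_den r s) U"
    by (intro holomorphic_cspace_divide EZ_den_holo U holomorphic_cspace_subset[OF H(1) US U]) (auto simp: U_def)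
  hence "holomorphic_cspace r (EZ_zeta r) U"
    by (rule holomorphic_cspace_cong) (use H(2) in \<open>auto simp: U_def\<close>)
  hence cont: "continuous_on U (EZ_zeta r)" by (rule holomorphic_cspace_continuous_on)
  have "\<forall>\<^sub>F z in at (s r). has_iterated_limit (EZ_zeta r) s q (s(r := z)) (E z)"
    using eventually_not_Ints_at[of "s r"]
  proof eventually_elim
    case (elim z)
    have up: "s(r := z) \<in> cspace r" using s(1) r by (auto intro: cspace_fun_upd)
    have "EZ_den r (s(r := z)) \<noteq> 0"
      by (rule EZ_den_nonzero[OF r]) (use elim s(2) in auto)
    hence mem: "s(r := z) \<in> U" using up by (simp add: U_def)
    have eq: "(\<lambda>i. if i \<in> {1..q} then s i else (s(r := z)) i) = s(r := z)"
      by (auto simp: q fun_eq_iff)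
    have "has_iterated_limit (EZ_zeta r) s q (s(r := z)) (EZ_zeta r (s(r := z)))"
      using has_iterated_limit_continuous[OF U cont _ up, of q s] mem unfolding eq by (simp add: q)
    thus ?case using E elim by (simp add: EZ_line_ext_def)
  qed
  moreover have "(E \<longlongrightarrow> E (s r)) (at (s r))"
  proof -
    have "s r \<in> - (of_nat ` {1..})"
    proof
      assume "s r \<in> of_nat ` {1..}"
      then obtain m where "m \<ge> 1" "- of_nat n = (of_nat m :: complex)" using s(3) by auto
      hence "of_nat (n + m) = (0 :: complex)" by (metis add.right_inverse of_nat_add)
      thus False using \<open>m \<ge> 1\<close> unfolding of_nat_eq_0_iff by simp
    qed
    hence "E analytic_on {s r}" using E by (auto simp: EZ_line_ext_def intro: analytic_on_subset)
    thus ?thesis by (intro isContD analytic_at_imp_isCont)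
  qed
  ultimately show *: "has_EZ_rev r s (E (s r))"
    unfolding has_EZ_rev_def q has_iterated_limit.simps by blast
  show "EZ_zeta_rev r s = E (s r)"
    unfolding EZ_zeta_rev_def
  proof (rule the_equality)
    show "has_EZ_rev r s (E (s r))" by (rule *)
    show "v = E (s r)" if "has_EZ_rev r s v" for v
      using that * unfolding has_EZ_rev_def by (rule has_iterated_limit_unique)
  qed
qed

section \<open>The zeta function of type A\<close>

lemma finite_A_index2: "finite (A_index2 r)"
  by (rule finite_subset[of _ "{..r} \<times> {..r}"]) (auto simp: A_index2_def)

lemma splittings_eq:
  assumes "(p, q) \<in> splittings r l"
  shows "\<And>ij. ij \<in> A_index2 r \<Longrightarrow> p ij = l ij - q ij" "\<And>ij. ij \<in> A_index2 r \<Longrightarrow> q ij \<le> l ij"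
  using assms unfolding splittings_def by (metis (mono_tags, lifting) add_diff_cancel_right' case_prodD mem_Collect_eq,
    metis (mono_tags, lifting) case_prodD le_add2 mem_Collect_eq)

lemma finite_splittings: "finite (splittings r l)"
proof (rule finite_subset)
  show "splittings r l \<subseteq> PiE (A_index2 r) (\<lambda>ij. {..l ij}) \<times> PiE (A_index2 r) (\<lambda>ij. {..l ij})"
  proof
    fix x assume x: "x \<in> splittings r l"
    obtain p q where e: "x = (p, q)" by (cases x)
    show "x \<in> PiE (A_index2 r) (\<lambda>ij. {..l ij}) \<times> PiE (A_index2 r) (\<lambda>ij. {..l ij})"
      using x splittings_eq[OF x[unfolded e]] by (auto simp: e splittings_def PiE_def Pi_def)
  qed
qed (auto intro!: finite_cartesian_product finite_PiE finite_A_index2)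

text \<open>In \<open>EZ_arg\<close> the \<open>p\<close> are collected by their second index and
  the \<open>q\<close> by their first index lowered by 1. These are the two matching ways to run
  through the triangle.\<close>

lemma prod_A_index2:
  "(\<Prod>k=1..r. \<Prod>i=2..k. f i k) = (\<Prod>(i, j)\<in>A_index2 r. f i j)"
  "(\<Prod>k=1..r. \<Prod>j=k+1..r. f (k + 1) j) = (\<Prod>(i, j)\<in>A_index2 r. f i j)"
proof -
  show "(\<Prod>k=1..r. \<Prod>i=2..k. f i k) = (\<Prod>(i, j)\<in>A_index2 r. f i j)"
    by (subst prod.Sigma, simp, simp, rule prod.reindex_bij_witness[of _ "\<lambda>(i, j). (j, i)" "\<lambda>(k, i). (i, k)"]) (auto simp: A_index2_def)
  show "(\<Prod>k=1..r. \<Prod>j=k+1..r. f (k + 1) j) = (\<Prod>(i, j)\<in>A_index2 r. f i j)"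
    by (subst prod.Sigma, simp, simp, rule prod.reindex_bij_witness[of _ "\<lambda>(i, j). (i - 1, j)" "\<lambda>(k, j). (k + 1, j)"]) (auto simp: A_index2_def)
qed

text \<open>As \<open>z\<close> varies, the argument moves along a line in the last coordinate,
  which makes the results on lines applicable.\<close>

lemma EZ_arg_eq:
  assumes "r \<ge> 1"
  shows "EZ_arg r l p q z = (EZ_arg r l p q 0)(r := z - of_nat (\<Sum>i=2..r. p (i, r)))"
  using assms by (auto simp: EZ_arg_def fun_eq_iff)

lemma EZ_arg_neg:
  assumes "k \<in> {1..<r}"
  shows "EZ_arg r l p q z k = - of_nat (l (1, k) + (\<Sum>i=2..k. p (i, k)) + (\<Sum>j=k+1..r. q (k + 1, j)))"
  using assms by (simp add: EZ_arg_def algebra_simps)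

lemma EZ_arg_last: "r \<ge> 1 \<Longrightarrow> EZ_arg r l p q z r = z - of_nat (\<Sum>i=2..r. p (i, r))"
  by (simp add: EZ_arg_def)

lemma EZ_arg_cspace: "EZ_arg r l p q z \<in> cspace r"
  by (auto simp: EZ_arg_def cspace_def)

text \<open>The exponent of M_k is sorted by origin. The part from \<open>q\<close> belongs to pairs
  with first index k + 1, so the base there is M_(i-1).\<close>

lemma EZ_term_EZ_arg:
  assumes r: "r \<ge> 1" and m: "m \<in> pos_tuples r"
  defines "M \<equiv> \<lambda>k. of_nat (\<Sum>i=1..k. m i) :: complex"
  shows "EZ_term r (EZ_arg r l p q z) m = (\<Prod>k=1..r. if k = r then M r powr (- z) else M k ^ l (1, k)) *
           (\<Prod>(i, j)\<in>A_index2 r. M j ^ p (i, j) * M (i - 1) ^ q (i, j))"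
proof -
  have pos: "(\<Sum>i=1..k. m i) \<ge> 1" if "k \<in> {1..r}" for k
  proof -
    have "m 1 \<ge> 1" using m that by (auto simp: pos_tuples_def PiE_def Pi_def)
    also have "m 1 \<le> (\<Sum>i=1..k. m i)" using that by (intro member_le_sum) auto
    finally show ?thesis .
  qed
  have pw: "M k powr of_nat n = M k ^ n" if "k \<in> {1..r}" for k n
    unfolding M_def by (rule nat_powr_of_nat[OF pos[OF that]])
  have "EZ_term r (EZ_arg r l p q z) m = (\<Prod>k=1..r. M k powr (- EZ_arg r l p q z k))"
    by (simp add: EZ_term_def M_def)
  also have "\<dots> = (\<Prod>k=1..r. (if k = r then M r powr (- z) else M k ^ l (1, k)) *
        ((\<Prod>i=2..k. M k ^ p (i, k)) * (\<Prod>j=k+1..r. M (k + 1 - 1) ^ q (k + 1, j))))"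
  proof (intro prod.cong refl)
    fix k assume k: "k \<in> {1..r}"
    show "M k powr (- EZ_arg r l p q z k) = (if k = r then M r powr (- z) else M k ^ l (1, k)) *
        ((\<Prod>i=2..k. M k ^ p (i, k)) * (\<Prod>j=k+1..r. M (k + 1 - 1) ^ q (k + 1, j)))"
    proof (cases "k = r")
      case True
      have "M r powr (- EZ_arg r l p q z r) = M r powr (- z + of_nat (\<Sum>i=2..r. p (i, r)))"
        unfolding EZ_arg_last[OF r] by (simp add: algebra_simps)
      also have "\<dots> = M r powr (- z) * M r ^ (\<Sum>i=2..r. p (i, r))"
        unfolding powr_add by (subst pw) (use r in auto)
      finally show ?thesis by (simp add: True power_sum)
    next
      case False
      hence "k \<in> {1..<r}" using k by auto
      thus ?thesis
        unfolding EZ_arg_neg[OF \<open>k \<in> {1..<r}\<close>] minus_minus pw[OF k] using False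
        by (simp add: power_add power_sum)
    qed
  qed
  also have "\<dots> = (\<Prod>k=1..r. if k = r then M r powr (- z) else M k ^ l (1, k)) *
      ((\<Prod>k=1..r. \<Prod>i=2..k. M k ^ p (i, k)) * (\<Prod>k=1..r. \<Prod>j=k+1..r. M (k + 1 - 1) ^ q (k + 1, j)))"
    by (simp only: prod.distrib)
  also have "(\<Prod>k=1..r. \<Prod>i=2..k. M k ^ p (i, k)) * (\<Prod>k=1..r. \<Prod>j=k+1..r. M (k + 1 - 1) ^ q (k + 1, j)) =
      (\<Prod>(i, j)\<in>A_index2 r. M j ^ p (i, j) * M (i - 1) ^ q (i, j))"
    unfolding prod_A_index2(1)[of "\<lambda>i j. M j ^ p (i, j)"] prod_A_index2(2)[of "\<lambda>i j. M (i - 1) ^ q (i, j)"]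
    by (simp only: prod.distrib[symmetric] case_prod_unfold)
  finally show ?thesis .
qed

text \<open>The pairs (1, k) contribute powers of M_k itself, every other pair a power of M_j -
  M_(i-1). The negative summand stands first so that the binomial theorem makes \<open>q\<close> its
  exponent.\<close>

lemma A_term_prod:
  assumes r: "r \<ge> 1" and m: "m \<in> pos_tuples r"
  defines "M \<equiv> \<lambda>k. of_nat (\<Sum>i=1..k. m i) :: complex"
  shows "A_term r ((\<lambda>ij. - of_nat (l ij))((1, r) := z)) m =
           (\<Prod>k=1..r. if k = r then M r powr (- z) else M k ^ l (1, k)) *
           (\<Prod>(i, j)\<in>A_index2 r. (- M (i - 1) + M j) ^ l (i, j))"
proof -
  have pos: "(\<Sum>k=i..j. m k) \<ge> 1" if "(i, j) \<in> A_index r" for i j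
  proof -
    have "m i \<ge> 1" using m that by (auto simp: pos_tuples_def PiE_def Pi_def A_index_def)
    also have "m i \<le> (\<Sum>k=i..j. m k)" using that by (intro member_le_sum) (auto simp: A_index_def)
    finally show ?thesis .
  qed
  define f where "f = (\<lambda>(i, j). of_nat (\<Sum>k=i..j. m k) powr (- ((\<lambda>ij. - of_nat (l ij))((1, r) := z)) (i, j)) :: complex)"
  have ind: "A_index r = Pair 1 ` {1..r} \<union> A_index2 r" "Pair 1 ` {1..r} \<inter> A_index2 r = {}"
    by (auto simp: A_index_def A_index2_def)
  have "A_term r ((\<lambda>ij. - of_nat (l ij))((1, r) := z)) m = (\<Prod>ij\<in>A_index r. f ij)"
    unfolding A_term_def f_def by (intro prod.cong) auto
  also have "\<dots> = (\<Prod>ij\<in>Pair 1 ` {1..r}. f ij) * (\<Prod>ij\<in>A_index2 r. f ij)"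
    unfolding ind(1) by (rule prod.union_disjoint[OF _ finite_A_index2 ind(2)]) auto
  also have "(\<Prod>ij\<in>Pair 1 ` {1..r}. f ij) = (\<Prod>k=1..r. if k = r then M r powr (- z) else M k ^ l (1, k))"
  proof (subst prod.reindex)
    show "inj_on (Pair 1) {1..r}" by (auto intro: inj_onI)
    show "prod (f \<circ> Pair 1) {1..r} = (\<Prod>k=1..r. if k = r then M r powr (- z) else M k ^ l (1, k))"
    proof (intro prod.cong refl)
      fix k assume k: "k \<in> {1..r}"
      hence "(1, k) \<in> A_index r" by (auto simp: A_index_def)
      thus "(f \<circ> Pair 1) k = (if k = r then M r powr (- z) else M k ^ l (1, k))"
        using nat_powr_of_nat[OF pos] by (auto simp: f_def M_def)
    qed
  qed
  also have "(\<Prod>ij\<in>A_index2 r. f ij) = (\<Prod>(i, j)\<in>A_index2 r. (- M (i - 1) + M j) ^ l (i, j))"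
  proof (intro prod.cong refl)
    fix ij assume ij: "ij \<in> A_index2 r"
    obtain i j where e: "ij = (i, j)" by (cases ij)
    have i: "2 \<le> i" "i \<le> j" "(i, j) \<in> A_index r" using ij by (auto simp: e A_index2_def A_index_def)
    have "{1..j} = {1..i - 1} \<union> {i..j}" using i by auto
    hence "(\<Sum>k=1..j. m k) = (\<Sum>k=1..i - 1. m k) + (\<Sum>k=i..j. m k)"
      using i by (simp add: sum.union_disjoint)
    hence "M j = M (i - 1) + of_nat (\<Sum>k=i..j. m k)" unfolding M_def by (metis of_nat_add)
    hence "of_nat (\<Sum>k=i..j. m k) = - M (i - 1) + M j" by (simp add: algebra_simps)
    thus "f ij = (case ij of (i, j) \<Rightarrow> (- M (i - 1) + M j) ^ l (i, j))"
      using nat_powr_of_nat[OF pos[OF i(3)], of "l (i, j)"] i(1) by (simp add: f_def e)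
  qed
  finally show ?thesis .
qed

text \<open>Multiplying out the binomial sums amounts to choosing an exponent \<open>q\<close> for
  every pair; \<open>p\<close> is then the complement, so the choices correspond to the
  splittings.\<close>

lemma A_term_expand:
  assumes r: "r \<ge> 1" and m: "m \<in> pos_tuples r"
  shows "A_term r ((\<lambda>ij. - of_nat (l ij))((1, r) := z)) m =
           (\<Sum>(p, q)\<in>splittings r l. (\<Prod>ij\<in>A_index2 r. of_nat (l ij choose q ij) * (-1) ^ q ij) *
              EZ_term r (EZ_arg r l p q z) m)"
proof -
  define M where "M = (\<lambda>k. of_nat (\<Sum>i=1..k. m i) :: complex)"
  define C where "C = (\<Prod>k=1..r. if k = r then M r powr (- z) else M k ^ l (1, k))"
  define h where "h = (\<lambda>(i, j) b. of_nat (l (i, j) choose b) * (- M (i - 1)) ^ b * M j ^ (l (i, j) - b))"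
  have "(\<Prod>(i, j)\<in>A_index2 r. (- M (i - 1) + M j) ^ l (i, j)) = (\<Prod>ij\<in>A_index2 r. \<Sum>b\<le>l ij. h ij b)"
  proof (intro prod.cong refl)
    fix ij :: "nat \<times> nat"
    obtain i j where e: "ij = (i, j)" by (cases ij)
    show "(case ij of (i, j) \<Rightarrow> (- M (i - 1) + M j) ^ l (i, j)) = (\<Sum>b\<le>l ij. h ij b)"
      by (simp only: e h_def prod.case binomial_ring)
  qed
  also have "\<dots> = (\<Sum>q\<in>PiE (A_index2 r) (\<lambda>ij. {..l ij}). \<Prod>ij\<in>A_index2 r. h ij (q ij))"
    by (rule prod_sum_PiE) (auto simp: finite_A_index2)
  also have "\<dots> = (\<Sum>(p, q)\<in>splittings r l. \<Prod>ij\<in>A_index2 r. h ij (q ij))"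
  proof (rule sum.reindex_bij_witness[of _ snd "\<lambda>q. (\<lambda>ij\<in>A_index2 r. l ij - q ij, q)"])
    fix x assume x: "x \<in> splittings r l"
    obtain p q where e: "x = (p, q)" by (cases x)
    note pq = x[unfolded e]
    show "snd x \<in> PiE (A_index2 r) (\<lambda>ij. {..l ij})"
      using pq splittings_eq[OF pq] by (auto simp: e splittings_def PiE_def Pi_def)
    have "(\<lambda>ij\<in>A_index2 r. l ij - q ij) = p"
      using pq splittings_eq[OF pq] by (auto simp: fun_eq_iff splittings_def PiE_def extensional_def)
    thus "(\<lambda>ij\<in>A_index2 r. l ij - snd x ij, snd x) = x" by (simp add: e)
  next
    fix q assume q: "q \<in> PiE (A_index2 r) (\<lambda>ij. {..l ij})"
    thus "(\<lambda>ij\<in>A_index2 r. l ij - q ij, q) \<in> splittings r l"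
      by (auto simp: splittings_def PiE_def Pi_def)
  qed auto
  also have "\<dots> = (\<Sum>(p, q)\<in>splittings r l. (\<Prod>ij\<in>A_index2 r. of_nat (l ij choose q ij) * (-1) ^ q ij) *
       (\<Prod>(i, j)\<in>A_index2 r. M j ^ p (i, j) * M (i - 1) ^ q (i, j)))"
  proof (intro sum.cong refl)
    fix x assume x: "x \<in> splittings r l"
    obtain p q where e: "x = (p, q)" by (cases x)
    have "(\<Prod>ij\<in>A_index2 r. h ij (q ij)) =
       (\<Prod>ij\<in>A_index2 r. (of_nat (l ij choose q ij) * (-1) ^ q ij) * (case ij of (i, j) \<Rightarrow> M j ^ p (i, j) * M (i - 1) ^ q (i, j)))"
    proof (intro prod.cong refl)
      fix ij assume ij: "ij \<in> A_index2 r"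
      obtain i j where eij: "ij = (i, j)" by (cases ij)
      have "p (i, j) = l (i, j) - q (i, j)" using splittings_eq(1)[OF x[unfolded e] ij] by (simp add: eij)
      thus "h ij (q ij) = (of_nat (l ij choose q ij) * (-1) ^ q ij) * (case ij of (i, j) \<Rightarrow> M j ^ p (i, j) * M (i - 1) ^ q (i, j))"
        by (simp only: h_def eij prod.case power_minus[of "M (i - 1)"] mult_ac)
    qed
    thus "(case x of (p, q) \<Rightarrow> \<Prod>ij\<in>A_index2 r. h ij (q ij)) =
          (case x of (p, q) \<Rightarrow> (\<Prod>ij\<in>A_index2 r. of_nat (l ij choose q ij) * (-1) ^ q ij) *
            (\<Prod>(i, j)\<in>A_index2 r. M j ^ p (i, j) * M (i - 1) ^ q (i, j)))"
      by (simp add: e prod.distrib)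
  qed
  finally have eq: "(\<Prod>(i, j)\<in>A_index2 r. (- M (i - 1) + M j) ^ l (i, j)) =
     (\<Sum>(p, q)\<in>splittings r l. (\<Prod>ij\<in>A_index2 r. of_nat (l ij choose q ij) * (-1) ^ q ij) *
       (\<Prod>(i, j)\<in>A_index2 r. M j ^ p (i, j) * M (i - 1) ^ q (i, j)))" .
  have "A_term r ((\<lambda>ij. - of_nat (l ij))((1, r) := z)) m =
     C * (\<Prod>(i, j)\<in>A_index2 r. (- M (i - 1) + M j) ^ l (i, j))"
    unfolding C_def M_def by (rule A_term_prod[OF r m])
  also have "\<dots> = (\<Sum>(p, q)\<in>splittings r l. (\<Prod>ij\<in>A_index2 r. of_nat (l ij choose q ij) * (-1) ^ q ij) *
       (C * (\<Prod>(i, j)\<in>A_index2 r. M j ^ p (i, j) * M (i - 1) ^ q (i, j))))"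
    unfolding eq sum_distrib_left by (intro sum.cong refl) (auto simp: mult_ac)
  also have "\<dots> = (\<Sum>(p, q)\<in>splittings r l. (\<Prod>ij\<in>A_index2 r. of_nat (l ij choose q ij) * (-1) ^ q ij) *
              EZ_term r (EZ_arg r l p q z) m)"
    unfolding C_def M_def EZ_term_EZ_arg[OF r m, symmetric] ..
  finally show ?thesis .
qed

section \<open>From the termwise identity to meromorphic functions\<close>

lemma has_sum_sum_family:
  fixes f :: "'i \<Rightarrow> 'a \<Rightarrow> complex"
  assumes "finite I" "\<And>i. i \<in> I \<Longrightarrow> (f i has_sum S i) A"
  shows "((\<lambda>x. \<Sum>i\<in>I. f i x) has_sum (\<Sum>i\<in>I. S i)) A"
  using assms by (induction I rule: finite_induct) (auto intro!: has_sum_add)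

text \<open>The difference is either almost everywhere 0 or almost everywhere nonzero, and the
  second alternative fails near a point of the half-plane.\<close>

lemma meromorphic_eq_of_halfplane:
  assumes "f meromorphic_on UNIV" "g meromorphic_on UNIV" "\<And>z. Re z > c \<Longrightarrow> f z = g z"
  shows "\<forall>\<^sub>\<approx>z\<in>UNIV. f z = g z"
proof -
  have "(\<lambda>z. f z - g z) meromorphic_on UNIV" using assms by (intro meromorphic_intros)
  hence "(\<forall>\<^sub>\<approx>z\<in>UNIV. f z - g z = 0) \<or> (\<forall>\<^sub>\<approx>z\<in>UNIV. f z - g z \<noteq> 0)"
    by (rule meromorphic_imp_constant_or_avoid) auto
  moreover have "\<not> (\<forall>\<^sub>\<approx>z\<in>UNIV. f z - g z \<noteq> 0)"
  proof
    define z where "z = complex_of_real (c + 1)"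
    assume "\<forall>\<^sub>\<approx>z\<in>UNIV. f z - g z \<noteq> 0"
    hence "\<forall>\<^sub>F z in at z. f z - g z \<noteq> 0" by (rule eventually_cosparse_imp_eventually_at) auto
    moreover have "\<forall>\<^sub>F z in at z. z \<in> {z. Re z > c}"
      by (rule eventually_at_in_open') (auto simp: z_def open_halfspace_Re_gt)
    ultimately have "\<forall>\<^sub>F z in at z. False"
      by eventually_elim (use assms(3) in auto)
    thus False by simp
  qed
  ultimately show ?thesis by simp
qed

text \<open>Equality of meromorphic functions is stated outside a sparse set, because restricted to
  the line \<open>EZ_zeta\<close> may have uninformative values at integers. Since
  \<open>Lim\<close> and \<open>THE\<close> are total, the existence of the limits is asserted
  separately.\<close>

theorem proposition26:
  fixes r :: nat and l :: "nat \<times> nat \<Rightarrow> nat"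
  assumes "r \<ge> 1"
  shows
    "(A_zeta r l meromorphic_on UNIV \<and>
      (\<forall>(p, q)\<in>splittings r l. (\<lambda>z. EZ_zeta r (EZ_arg r l p q z)) meromorphic_on UNIV) \<and>
      (\<forall>\<^sub>\<approx>z\<in>UNIV. A_zeta r l z =
         (\<Sum>(p, q)\<in>splittings r l.
            (\<Prod>ij\<in>A_index2 r. of_nat (l ij choose q ij) * (-1) ^ q ij) *
            EZ_zeta r (EZ_arg r l p q z)))) \<and>
     ((A_zeta r l \<longlongrightarrow> A_zeta_rev r l) (at (- of_nat (l (1, r)))) \<and>
      (\<forall>(p, q)\<in>splittings r l.
         has_EZ_rev r (EZ_arg r l p q (- of_nat (l (1, r))))
           (EZ_zeta_rev r (EZ_arg r l p q (- of_nat (l (1, r)))))) \<and>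
      A_zeta_rev r l =
        (\<Sum>(p, q)\<in>splittings r l.
           (\<Prod>ij\<in>A_index2 r. of_nat (l ij choose p ij) * (-1) ^ q ij) *
           EZ_zeta_rev r (EZ_arg r l p q (- of_nat (l (1, r))))))"
proof -
  note r = assms
  define z0 where "z0 = (- of_nat (l (1, r)) :: complex)"
  define N where "N = (\<lambda>p :: nat \<times> nat \<Rightarrow> nat. \<Sum>i=2..r. p (i, r))"
  define E where "E = (\<lambda>p q. SOME E. EZ_line_ext r (EZ_arg r l p q 0) E)"
  have E: "EZ_line_ext r (EZ_arg r l p q 0) (E p q)" for p q
    unfolding E_def by (rule someI_ex[OF EZ_line_ext_exists[OF r EZ_arg_cspace EZ_arg_neg]])
  \<comment> \<open>The extension along the line, re-parametrised by the free variable; by the next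
    equation the last coordinate is \<open>z - of_nat (N p)\<close>.\<close>
  define G where "G = (\<lambda>p q z. E p q (z - of_nat (N p)))"
  have arg: "EZ_arg r l p q z = (EZ_arg r l p q 0)(r := z - of_nat (N p))" for p q z
    unfolding N_def by (rule EZ_arg_eq[OF r])
  have Gmer: "G p q meromorphic_on UNIV" for p q
    unfolding G_def
  proof (rule meromorphic_on_compose[where g = "E p q" and f = "\<lambda>z. z - of_nat (N p)" and A = UNIV])
    show "E p q meromorphic_on UNIV" using E[of p q] by (simp add: EZ_line_ext_def)
  qed (auto intro!: analytic_intros)
  have Gz0: "G p q analytic_on {z0}" for p q
    unfolding G_def
  proof (rule analytic_on_compose_gen[of "\<lambda>z. z - of_nat (N p)" _ "E p q" "- (of_nat ` {1..})", unfolded o_def])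
    show "E p q analytic_on - (of_nat ` {1..})" using E[of p q] by (simp add: EZ_line_ext_def)
    fix z assume "z \<in> {z0}"
    hence z: "z - of_nat (N p) = - of_nat (l (1, r) + N p)" by (simp add: z0_def)
    show "z - of_nat (N p) \<in> - (of_nat ` {1..})"
      unfolding z
    proof (rule ComplI)
      assume "- of_nat (l (1, r) + N p) \<in> (of_nat ` {1..} :: complex set)"
      then obtain k where "k \<ge> 1" "- of_nat (l (1, r) + N p) = (of_nat k :: complex)" by auto
      hence "of_nat (l (1, r) + N p + k) = (0 :: complex)" by (metis add.right_inverse of_nat_add)
      thus False using \<open>k \<ge> 1\<close> unfolding of_nat_eq_0_iff by simp
    qed
  qed (auto intro!: analytic_intros)
  have GZ: "EZ_zeta r (EZ_arg r l p q z) = G p q z" if "z \<notin> \<int>" for p q z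
  proof -
    have "z - of_nat (N p) \<notin> \<int>" using that by (metis Ints_add Ints_of_nat diff_add_cancel)
    thus ?thesis using E[of p q] unfolding arg[of p q z] G_def EZ_line_ext_def by blast
  qed
  have notZ: "\<forall>\<^sub>\<approx>z\<in>UNIV. z \<notin> (\<int> :: complex set)"
    by (simp add: eventually_cosparse_open_eq eventually_not_Ints_at)
  have EZmer: "(\<lambda>z. EZ_zeta r (EZ_arg r l p q z)) meromorphic_on UNIV" for p q
  proof -
    have "\<forall>\<^sub>\<approx>z\<in>UNIV. EZ_zeta r (EZ_arg r l p q z) = G p q z"
      using notZ by eventually_elim (rule GZ)
    from meromorphic_on_cong'[OF this refl] show ?thesis using Gmer[of p q] by simp
  qed
  define c where "c = (\<lambda>q. \<Prod>ij\<in>A_index2 r. of_nat (l ij choose q ij) * (-1) ^ q ij :: complex)"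
  define Q where "Q = (\<lambda>z. \<Sum>(p, q)\<in>splittings r l. c q * G p q z)"
  have Qmer: "Q meromorphic_on UNIV"
    unfolding Q_def case_prod_unfold by (intro meromorphic_intros Gmer)
  have Qz0: "Q analytic_on {z0}"
    unfolding Q_def case_prod_unfold by (intro analytic_intros Gz0)
  \<comment> \<open>The half-plane depends on the splitting. A filter along growing real part allows
    the finitely many conditions to be combined into one bound.\<close>
  have "\<exists>X. \<forall>z. Re z > X \<longrightarrow> (\<forall>(p, q)\<in>splittings r l. G p q analytic_on {z} \<and>
           (EZ_term r (EZ_arg r l p q z) has_sum G p q z) (pos_tuples r))"
  proof -
    have "\<forall>\<^sub>F z in filtercomap Re at_top. G p q analytic_on {z} \<and>
           (EZ_term r (EZ_arg r l p q z) has_sum G p q z) (pos_tuples r)" for p q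
    proof -
      obtain x where x: "E p q analytic_on {z. Re z > x}"
        "\<And>z. Re z > x \<Longrightarrow> (EZ_term r ((EZ_arg r l p q 0)(r := z)) has_sum E p q z) (pos_tuples r)"
        using E[of p q] unfolding EZ_line_ext_def by blast
      have "G p q analytic_on {z} \<and> (EZ_term r (EZ_arg r l p q z) has_sum G p q z) (pos_tuples r)"
        if z: "Re z > x + real (N p)" for z
      proof
        show "G p q analytic_on {z}"
          unfolding G_def
          by (rule analytic_on_compose_gen[of "\<lambda>z. z - of_nat (N p)" _ "E p q", OF _ x(1), unfolded o_def])
             (use z in \<open>auto intro!: analytic_intros\<close>)
        show "(EZ_term r (EZ_arg r l p q z) has_sum G p q z) (pos_tuples r)"
          unfolding arg[of p q z] G_def by (rule x(2)) (use z in simp)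
      qed
      thus ?thesis unfolding eventually_filtercomap_at_top_dense by blast
    qed
    hence "\<forall>\<^sub>F z in filtercomap Re at_top. \<forall>(p, q)\<in>splittings r l. G p q analytic_on {z} \<and>
           (EZ_term r (EZ_arg r l p q z) has_sum G p q z) (pos_tuples r)"
      by (intro eventually_ball_finite finite_splittings) auto
    thus ?thesis unfolding eventually_filtercomap_at_top_dense by blast
  qed
  then obtain X where X: "\<And>z p q. Re z > X \<Longrightarrow> (p, q) \<in> splittings r l \<Longrightarrow> G p q analytic_on {z}"
    "\<And>z p q. Re z > X \<Longrightarrow> (p, q) \<in> splittings r l \<Longrightarrow> (EZ_term r (EZ_arg r l p q z) has_sum G p q z) (pos_tuples r)"
    by blast
  define T where "T = (\<lambda>z. A_term r ((\<lambda>ij. - of_nat (l ij))((1, r) := z)))"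
  have Qsum: "(T z has_sum Q z) (pos_tuples r)" if z: "Re z > X" for z
  proof -
    have "((\<lambda>m. \<Sum>(p, q)\<in>splittings r l. c q * EZ_term r (EZ_arg r l p q z) m) has_sum Q z) (pos_tuples r)"
      unfolding Q_def case_prod_unfold
      by (intro has_sum_sum_family has_sum_cmult_right finite_splittings X(2)[OF z]) auto
    thus ?thesis
      by (rule has_sum_cong[THEN iffD1, rotated]) (simp only: T_def A_term_expand[OF r] c_def)
  qed
  have Qana: "Q analytic_on {z}" if z: "Re z > X" for z
    unfolding Q_def case_prod_unfold by (intro analytic_intros X(1)[OF z]) auto
  define spec where "spec = (\<lambda>F. F nicely_meromorphic_on UNIV \<and> (\<exists>c. \<forall>z. Re z > c \<longrightarrow> (T z has_sum F z) (pos_tuples r)))"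
  \<comment> \<open>Removing singularities makes \<open>Q\<close> nicely meromorphic and keeps its
    values where it is analytic, in particular to the right of \<open>X\<close>; so the
    specification behind \<open>A_zeta\<close> can be met.\<close>
  have "spec (remove_sings Q)"
    unfolding spec_def using remove_sings_nicely_meromorphic[OF Qmer] Qsum Qana by (auto intro!: exI[of _ X])
  hence "spec (SOME F. spec F)" by (rule someI[where P = spec])
  moreover have "(SOME F. spec F) = A_zeta r l" unfolding A_zeta_def spec_def T_def ..
  ultimately have "spec (A_zeta r l)" by (simp only:)
  then obtain c' where A: "A_zeta r l nicely_meromorphic_on UNIV"
    "\<And>z. Re z > c' \<Longrightarrow> (T z has_sum A_zeta r l z) (pos_tuples r)"
    unfolding spec_def by blast
  have Amer: "A_zeta r l meromorphic_on UNIV" using A(1) by (simp add: nicely_meromorphic_on_def)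
  \<comment> \<open>Any function meeting the specification sums the same series far to the right, so
    the particular choice does not matter outside a sparse set.\<close>
  have AQ: "\<forall>\<^sub>\<approx>z\<in>UNIV. A_zeta r l z = Q z"
    by (rule meromorphic_eq_of_halfplane[OF Amer Qmer, of "max c' X"])
       (use A(2) Qsum has_sum_unique in fastforce)
  have 1: "\<forall>\<^sub>\<approx>z\<in>UNIV. A_zeta r l z = (\<Sum>(p, q)\<in>splittings r l. c q * EZ_zeta r (EZ_arg r l p q z))"
    using AQ notZ by eventually_elim (simp add: Q_def GZ)
  have rev: "has_EZ_rev r (EZ_arg r l p q z0) (G p q z0)" "EZ_zeta_rev r (EZ_arg r l p q z0) = G p q z0" for p q
  proof -
    have last: "EZ_arg r l p q z0 r = - of_nat (l (1, r) + N p)"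
      unfolding EZ_arg_last[OF r] by (simp add: z0_def N_def)
    have "EZ_line_ext r (EZ_arg r l p q z0) (E p q)"
      using E[of p q] unfolding EZ_line_ext_def arg[of p q z0] by simp
    note * = EZ_rev_eq[OF r EZ_arg_cspace EZ_arg_neg last this]
    have "E p q (EZ_arg r l p q z0 r) = G p q z0"
      unfolding G_def last by (simp add: z0_def)
    thus "has_EZ_rev r (EZ_arg r l p q z0) (G p q z0)" "EZ_zeta_rev r (EZ_arg r l p q z0) = G p q z0"
      using * by simp_all
  qed
  have lim: "(A_zeta r l \<longlongrightarrow> Q z0) (at z0)"
  proof -
    have "\<forall>\<^sub>F z in at z0. A_zeta r l z = Q z"
      using AQ by (rule eventually_cosparse_imp_eventually_at) simp
    moreover have "(Q \<longlongrightarrow> Q z0) (at z0)"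
      using Qz0 by (intro isContD analytic_at_imp_isCont)
    ultimately show ?thesis by (simp cong: tendsto_cong)
  qed
  hence Arev: "A_zeta_rev r l = Q z0"
    unfolding A_zeta_rev_def z0_def[symmetric] by (intro tendsto_Lim) auto
  \<comment> \<open>The two formulas use different lower indices of the binomial coefficients; they
    agree by symmetry, as p + q = l.\<close>
  have cp: "c q = (\<Prod>ij\<in>A_index2 r. of_nat (l ij choose p ij) * (-1) ^ q ij)" if "(p, q) \<in> splittings r l" for p q
    unfolding c_def
    by (intro prod.cong refl) (simp add: splittings_eq[OF that] flip: binomial_symmetric)
  have 2: "Q z0 = (\<Sum>(p, q)\<in>splittings r l.
           (\<Prod>ij\<in>A_index2 r. of_nat (l ij choose p ij) * (-1) ^ q ij) * EZ_zeta_rev r (EZ_arg r l p q z0))"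
    unfolding Q_def by (intro sum.cong refl) (auto simp: cp rev(2))
  show ?thesis
    unfolding z0_def[symmetric] Arev
  proof (intro conjI)
    show "\<forall>\<^sub>\<approx>z\<in>UNIV. A_zeta r l z = (\<Sum>(p, q)\<in>splittings r l.
            (\<Prod>ij\<in>A_index2 r. of_nat (l ij choose q ij) * (-1) ^ q ij) * EZ_zeta r (EZ_arg r l p q z))"
      using 1 unfolding c_def .
    show "\<forall>(p, q)\<in>splittings r l. has_EZ_rev r (EZ_arg r l p q z0) (EZ_zeta_rev r (EZ_arg r l p q z0))"
      unfolding rev(2) using rev(1) by blast
  qed (use Amer EZmer lim 2 in blast)+
qed

end
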